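(* Let $(V,c)$ be a finite metric space, let $s,t\in V$ with $s\neq t$, and let $E=\binom{V}{2}$. Let $\rho^* \coloneqq 1+\frac{1}{1+4\ln(5/4)}$. Then the best-of-many Christofides algorithm with lonely edge deletion (described in the context) computes a Hamiltonian $s$-$t$-path of cost at most $\rho^*\, c(x^* )$, where $x^*$ is the optimum solution of the LP relaxation computed in its first step.
   Context: For $F\subseteq E$ (or a multiset) write $c(F)=\sum_{e\in F}c(e)$, for $x\in\mathbb{R}^E$ write $c(x)=\sum_{e\in E}c(e)x(e)$ and $x(F)=\sum_{e\in F}x(e)$; $\delta(U)$ is the set of edges with exactly one endpoint in $U$, $\chi^F$ the incidence vector of $F$. The LP relaxation is: minimize $c(x)$ subject to $x(\delta(U))\ge 2$ for $\emptyset\neq U\subseteq V\setminus\{s,t\}$; $x(\delta(U))\ge 1$ for $\{s\}\subseteq U\subseteq V\setminus\{t\}$; $x(\delta(v))=2$ for $v\in V\setminus\{s,t\}$; $x(\delta(v))=1$ for $v\in\{s,t\}$; $x\ge 0$. Given an optimum solution $x^*$, the set of narrow cuts is $\mathcal{N}=\{\delta(U):\{s\}\subseteq U\subseteq V\setminus\{t\},\ x^*(\delta(U))<2\}$. Algorithm: (1) Compute an optimum LP solution $x^*$. (2) Compute spanning trees $(V,S_1),\dots,(V,S_k)$ and coefficients $p_1,\dots,p_k\ge 0$ with $\sum_j p_j=1$ and $x^*=\sum_j p_j\chi^{S_j}$, such that for every $C\in\mathcal{N}$ there is $r\in\{1,\dots,k\}$ with $\sum_{j=1}^r p_j=2-x^*(C)$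 and $|C\cap S_j|=1$ for all $j\le r$ (such a decomposition exists). An edge $e$ and a cut $C\in\mathcal{N}$ are called lonely in $S_j$ if $\{e\}=C\cap S_j$ and $\sum_{i=1}^j p_i\le 2-x^*(C)$; $\mathcal{L}(S_j)$ denotes the set of cuts lonely in $S_j$. Let $F_j$ be $S_j$ minus its lonely edges and $T_j=\{v\in V: |F_j\cap\delta(v)|\text{ odd}\}\triangle\{s,t\}$. Define $c^j(e)=c(e)+\sum_{C\in\mathcal{L}(S_j),\,e\in C}2c(C\cap S_j)-\max\{0,\max_{C\in\mathcal{L}(S_j),\,e\in C}2c(C\cap S_j)\}$. (3) For each $j$: (a) compute a $T_j$-join $J_j$ (an edge set whose set of odd-degree vertices is $T_j$) of minimum $c^j$-cost; (b) compute a minimum $c$-cost subset $R_j\subseteq S_j\setminus F_j$ such that $(V,F_j\,\dot\cup\, J_j\,\dot\cup\, R_j)$ is connected; (c) find an Eulerian $s$-$t$-walk in the multigraph with edge multiset $H_j=F_j\,\dot\cup\, J_j\,\dot\cup\, R_j\,\dot\cup\, R_j$ and shortcut repeated vertices to obtain a Hamiltonian $s$-$t$-path. (4) Return the cheapest of these $k$ paths. *)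

theory Defs
  imports "HOL-Analysis.Analysis" "HOL-Library.Multiset" "HOL-Library.Sublist"
begin

section \<open>Undirected graphs on a vertex set\<close>

text \<open>
  Edges are two-element vertex sets. A point of \<open>\<real>\<^sup>E\<close> is a function \<open>'a set \<Rightarrow> real\<close> of which
  only the values on \<open>E\<close> are ever used.
\<close>

definition edges_of :: "'a set \<Rightarrow> 'a set set" where
  "edges_of V = {e. e \<subseteq> V \<and> card e = 2}"

definition cut :: "'a set \<Rightarrow> 'a set \<Rightarrow> 'a set set" where
  "cut V U = {e \<in> edges_of V. card (e \<inter> U) = 1}"

definition edge_cost :: "('a \<Rightarrow> 'a \<Rightarrow> real) \<Rightarrow> 'a set \<Rightarrow> real" where
  "edge_cost c e = (THE r. \<exists>u v. e = {u, v} \<and> u \<noteq> v \<and> r = c u v)"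

text \<open>The description above is well defined for symmetric \<open>c\<close>:\<close>

lemma edge_cost_doubleton:
  assumes "c u v = c v u" and "u \<noteq> v"
  shows "edge_cost c {u, v} = c u v"
  unfolding edge_cost_def
  by (rule the_equality) (use assms in \<open>auto simp: doubleton_eq_iff\<close>)

fun walk_edges :: "'a list \<Rightarrow> 'a set list" where
  "walk_edges (u # v # w) = {u, v} # walk_edges (v # w)"
| "walk_edges _ = []"

definition graph_connected :: "'a set \<Rightarrow> 'a set set \<Rightarrow> bool" where
  "graph_connected V F \<longleftrightarrow>
     (\<forall>u\<in>V. \<forall>v\<in>V. \<exists>w. w \<noteq> [] \<and> hd w = u \<and> last w = v \<and> set (walk_edges w) \<subseteq> F)"

definition graph_acyclic :: "'a set set \<Rightarrow> bool" where
  "graph_acyclic F \<longleftrightarrow>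
     \<not> (\<exists>w. length w \<ge> 3 \<and> distinct w \<and> set (walk_edges (w @ [hd w])) \<subseteq> F)"

definition spanning_tree :: "'a set \<Rightarrow> 'a set set \<Rightarrow> bool" where
  "spanning_tree V S \<longleftrightarrow> S \<subseteq> edges_of V \<and> graph_connected V S \<and> graph_acyclic S"

definition odd_vertices :: "'a set \<Rightarrow> 'a set set \<Rightarrow> 'a set" where
  "odd_vertices V F = {v \<in> V. odd (card (F \<inter> cut V {v}))}"

definition T_join :: "'a set \<Rightarrow> 'a set \<Rightarrow> 'a set set \<Rightarrow> bool" where
  "T_join V T J \<longleftrightarrow> J \<subseteq> edges_of V \<and> odd_vertices V J = T"

text \<open>
  A walk is given by its vertex list. Parallel edges have the same endpoints and the same cost, so
  a walk traverses every edge of a multigraph exactly once if and only if the multiset of its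
  endpoint pairs is the edge multiset.
\<close>

definition eulerian_walk :: "'a set \<Rightarrow> 'a set multiset \<Rightarrow> 'a \<Rightarrow> 'a \<Rightarrow> 'a list \<Rightarrow> bool" where
  "eulerian_walk V H s t w \<longleftrightarrow>
     w \<noteq> [] \<and> set w \<subseteq> V \<and> hd w = s \<and> last w = t \<and> mset (walk_edges w) = H"

text \<open>
  Shortcutting keeps exactly one occurrence of every visited vertex, in the order of the walk, and
  keeps the two ends of the walk. Which of the other occurrences is kept is left open.
\<close>

definition shortcut :: "'a list \<Rightarrow> 'a list \<Rightarrow> bool" where
  "shortcut w Q \<longleftrightarrow>
     subseq Q w \<and> distinct Q \<and> set Q = set w \<and> hd Q = hd w \<and> last Q = last w"

definition hamiltonian_path :: "'a set \<Rightarrow> 'a \<Rightarrow> 'a \<Rightarrow> 'a list \<Rightarrow> bool" where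
  "hamiltonian_path V s t Q \<longleftrightarrow>
     Q \<noteq> [] \<and> distinct Q \<and> set Q = V \<and> hd Q = s \<and> last Q = t"

definition path_cost :: "('a \<Rightarrow> 'a \<Rightarrow> real) \<Rightarrow> 'a list \<Rightarrow> real" where
  "path_cost c Q = (\<Sum>e\<leftarrow>walk_edges Q. edge_cost c e)"


section \<open>The linear programming relaxation\<close>

definition lp_feasible :: "'a set \<Rightarrow> 'a \<Rightarrow> 'a \<Rightarrow> ('a set \<Rightarrow> real) \<Rightarrow> bool" where
  "lp_feasible V s t x \<longleftrightarrow>
     (\<forall>U. U \<noteq> {} \<and> U \<subseteq> V - {s, t} \<longrightarrow> sum x (cut V U) \<ge> 2) \<and>
     (\<forall>U. {s} \<subseteq> U \<and> U \<subseteq> V - {t} \<longrightarrow> sum x (cut V U) \<ge> 1) \<and>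
     (\<forall>v \<in> V - {s, t}. sum x (cut V {v}) = 2) \<and>
     (\<forall>v \<in> {s, t}. sum x (cut V {v}) = 1) \<and>
     (\<forall>e \<in> edges_of V. x e \<ge> 0)"

definition lp_cost :: "'a set \<Rightarrow> ('a \<Rightarrow> 'a \<Rightarrow> real) \<Rightarrow> ('a set \<Rightarrow> real) \<Rightarrow> real" where
  "lp_cost V c x = (\<Sum>e\<in>edges_of V. edge_cost c e * x e)"

definition lp_optimum ::
    "'a set \<Rightarrow> ('a \<Rightarrow> 'a \<Rightarrow> real) \<Rightarrow> 'a \<Rightarrow> 'a \<Rightarrow> ('a set \<Rightarrow> real) \<Rightarrow> bool" where
  "lp_optimum V c s t x \<longleftrightarrow> is_arg_min (lp_cost V c) (lp_feasible V s t) x"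

definition narrow_cuts :: "'a set \<Rightarrow> 'a \<Rightarrow> 'a \<Rightarrow> ('a set \<Rightarrow> real) \<Rightarrow> 'a set set set" where
  "narrow_cuts V s t x =
     {cut V U | U. {s} \<subseteq> U \<and> U \<subseteq> V - {t} \<and> sum x (cut V U) < 2}"


section \<open>Best-of-many Christofides with lonely edge deletion\<close>

text \<open>The trees are \<open>S 1, \<dots>, S k\<close> with coefficients \<open>p 1, \<dots>, p k\<close>.\<close>

definition tree_decomposition ::
    "'a set \<Rightarrow> 'a \<Rightarrow> 'a \<Rightarrow> ('a set \<Rightarrow> real) \<Rightarrow> nat \<Rightarrow> (nat \<Rightarrow> real) \<Rightarrow> (nat \<Rightarrow> 'a set set) \<Rightarrow> bool" where
  "tree_decomposition V s t x k p S \<longleftrightarrow>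
     (\<forall>j\<in>{1..k}. spanning_tree V (S j)) \<and>
     (\<forall>j\<in>{1..k}. p j \<ge> 0) \<and>
     (\<Sum>j=1..k. p j) = 1 \<and>
     (\<forall>e\<in>edges_of V. x e = (\<Sum>j=1..k. p j * indicator (S j) e)) \<and>
     (\<forall>C\<in>narrow_cuts V s t x.
        \<exists>r\<in>{1..k}. (\<Sum>j=1..r. p j) = 2 - sum x C \<and> (\<forall>j\<in>{1..r}. card (C \<inter> S j) = 1))"

definition lonely ::
    "'a set \<Rightarrow> 'a \<Rightarrow> 'a \<Rightarrow> ('a set \<Rightarrow> real) \<Rightarrow> (nat \<Rightarrow> real) \<Rightarrow> (nat \<Rightarrow> 'a set set) \<Rightarrow> nat \<Rightarrow>
     'a set \<Rightarrow> 'a set set \<Rightarrow> bool" where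
  "lonely V s t x p S j e C \<longleftrightarrow>
     C \<in> narrow_cuts V s t x \<and> {e} = C \<inter> S j \<and> (\<Sum>i=1..j. p i) \<le> 2 - sum x C"

definition lonely_cuts ::
    "'a set \<Rightarrow> 'a \<Rightarrow> 'a \<Rightarrow> ('a set \<Rightarrow> real) \<Rightarrow> (nat \<Rightarrow> real) \<Rightarrow> (nat \<Rightarrow> 'a set set) \<Rightarrow> nat \<Rightarrow>
     'a set set set" where
  "lonely_cuts V s t x p S j = {C. \<exists>e. lonely V s t x p S j e C}"

definition forest ::
    "'a set \<Rightarrow> 'a \<Rightarrow> 'a \<Rightarrow> ('a set \<Rightarrow> real) \<Rightarrow> (nat \<Rightarrow> real) \<Rightarrow> (nat \<Rightarrow> 'a set set) \<Rightarrow> nat \<Rightarrow>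
     'a set set" where
  "forest V s t x p S j = S j - {e. \<exists>C. lonely V s t x p S j e C}"

definition parity_set ::
    "'a set \<Rightarrow> 'a \<Rightarrow> 'a \<Rightarrow> ('a set \<Rightarrow> real) \<Rightarrow> (nat \<Rightarrow> real) \<Rightarrow> (nat \<Rightarrow> 'a set set) \<Rightarrow> nat \<Rightarrow>
     'a set" where
  "parity_set V s t x p S j = sym_diff (odd_vertices V (forest V s t x p S j)) {s, t}"

definition join_cost ::
    "'a set \<Rightarrow> ('a \<Rightarrow> 'a \<Rightarrow> real) \<Rightarrow> 'a \<Rightarrow> 'a \<Rightarrow> ('a set \<Rightarrow> real) \<Rightarrow>
     (nat \<Rightarrow> real) \<Rightarrow> (nat \<Rightarrow> 'a set set) \<Rightarrow> nat \<Rightarrow> 'a set \<Rightarrow> real" where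
  "join_cost V c s t x p S j e =
     edge_cost c e
     + (\<Sum>C | C \<in> lonely_cuts V s t x p S j \<and> e \<in> C. 2 * sum (edge_cost c) (C \<inter> S j))
     - Max (insert 0 {2 * sum (edge_cost c) (C \<inter> S j) | C. C \<in> lonely_cuts V s t x p S j \<and> e \<in> C})"

definition join_step ::
    "'a set \<Rightarrow> ('a \<Rightarrow> 'a \<Rightarrow> real) \<Rightarrow> 'a \<Rightarrow> 'a \<Rightarrow> ('a set \<Rightarrow> real) \<Rightarrow>
     (nat \<Rightarrow> real) \<Rightarrow> (nat \<Rightarrow> 'a set set) \<Rightarrow> nat \<Rightarrow> 'a set set \<Rightarrow> bool" where
  "join_step V c s t x p S j J \<longleftrightarrow>
     is_arg_min (sum (join_cost V c s t x p S j)) (T_join V (parity_set V s t x p S j)) J"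

definition reconnect_step ::
    "'a set \<Rightarrow> ('a \<Rightarrow> 'a \<Rightarrow> real) \<Rightarrow> 'a \<Rightarrow> 'a \<Rightarrow> ('a set \<Rightarrow> real) \<Rightarrow>
     (nat \<Rightarrow> real) \<Rightarrow> (nat \<Rightarrow> 'a set set) \<Rightarrow> nat \<Rightarrow> 'a set set \<Rightarrow> 'a set set \<Rightarrow> bool" where
  "reconnect_step V c s t x p S j J R \<longleftrightarrow>
     is_arg_min (sum (edge_cost c))
       (\<lambda>R. R \<subseteq> S j - forest V s t x p S j \<and>
            graph_connected V (forest V s t x p S j \<union> J \<union> R)) R"

definition walk_step ::
    "'a set \<Rightarrow> 'a \<Rightarrow> 'a \<Rightarrow> ('a set \<Rightarrow> real) \<Rightarrow> (nat \<Rightarrow> real) \<Rightarrow> (nat \<Rightarrow> 'a set set) \<Rightarrow> nat \<Rightarrow>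
     'a set set \<Rightarrow> 'a set set \<Rightarrow> 'a list \<Rightarrow> bool" where
  "walk_step V s t x p S j J R w \<longleftrightarrow>
     eulerian_walk V
       (mset_set (forest V s t x p S j) + mset_set J + mset_set R + mset_set R) s t w"

text \<open>
  The steps are nondeterministic: any choice meeting the specification of a step is allowed. The
  following says that the iteration for the tree \<open>S j\<close> cannot get stuck, whatever choices are made.
\<close>

definition iteration_executable ::
    "'a set \<Rightarrow> ('a \<Rightarrow> 'a \<Rightarrow> real) \<Rightarrow> 'a \<Rightarrow> 'a \<Rightarrow> ('a set \<Rightarrow> real) \<Rightarrow>
     (nat \<Rightarrow> real) \<Rightarrow> (nat \<Rightarrow> 'a set set) \<Rightarrow> nat \<Rightarrow> bool" where
  "iteration_executable V c s t x p S j \<longleftrightarrow>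
     (\<exists>J. join_step V c s t x p S j J) \<and>
     (\<forall>J. join_step V c s t x p S j J \<longrightarrow>
        (\<exists>R. reconnect_step V c s t x p S j J R) \<and>
        (\<forall>R. reconnect_step V c s t x p S j J R \<longrightarrow>
           (\<exists>w. walk_step V s t x p S j J R w) \<and>
           (\<forall>w. walk_step V s t x p S j J R w \<longrightarrow> (\<exists>Q. shortcut w Q))))"

definition iteration_result ::
    "'a set \<Rightarrow> ('a \<Rightarrow> 'a \<Rightarrow> real) \<Rightarrow> 'a \<Rightarrow> 'a \<Rightarrow> ('a set \<Rightarrow> real) \<Rightarrow>
     (nat \<Rightarrow> real) \<Rightarrow> (nat \<Rightarrow> 'a set set) \<Rightarrow> nat \<Rightarrow> 'a list \<Rightarrow> bool" where
  "iteration_result V c s t x p S j Q \<longleftrightarrow>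
     (\<exists>J R w. join_step V c s t x p S j J \<and> reconnect_step V c s t x p S j J R \<and>
        walk_step V s t x p S j J R w \<and> shortcut w Q)"

definition algorithm_output ::
    "'a set \<Rightarrow> ('a \<Rightarrow> 'a \<Rightarrow> real) \<Rightarrow> 'a \<Rightarrow> 'a \<Rightarrow> ('a set \<Rightarrow> real) \<Rightarrow>
     nat \<Rightarrow> (nat \<Rightarrow> real) \<Rightarrow> (nat \<Rightarrow> 'a set set) \<Rightarrow> 'a list \<Rightarrow> bool" where
  "algorithm_output V c s t x k p S P \<longleftrightarrow>
     (\<exists>Q. (\<forall>j\<in>{1..k}. iteration_result V c s t x p S j (Q j)) \<and>
          is_arg_min (path_cost c) (\<lambda>P. P \<in> Q ` {1..k}) P)"

definition rho_star :: real where
  "rho_star = 1 + 1 / (1 + 4 * ln (5 / 4))"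

end

theory Submission
  imports Defs
begin

text \<open>
  Write \<open>\<sigma> j = p 1 + \<dots> + p j\<close> and let \<open>\<phi> j\<close> be the integral of \<open>4 / (4 + \<sigma>)\<close> over the
  interval from \<open>\<sigma> (j - 1)\<close> to \<open>\<sigma> j\<close>. The path obtained from the tree \<open>S j\<close> is weighted by
  \<open>p j + \<phi> j\<close>; these weights sum to \<open>1 + 4 ln (5/4)\<close>, and it suffices that the weighted
  costs sum to at most \<open>2 + 4 ln (5/4)\<close> times the LP value.

  A minimum T-join costs at most as much as any fractional one, so the join \<open>J\<close> is compared
  with \<open>\<beta> x + (1 - 2 \<beta>) \<chi>\<^sup>F\<close>, \<open>\<beta> = \<phi> j / (p j + \<phi> j) \<le> 1 / 2\<close>, plus a correction for narrow cuts.
  At a cut lonely in \<open>S j\<close> the lonely edge itself is added, and deleting lonely edges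
  saves more than this costs. At the other narrow cuts edges lonely at that cut in
  other trees are added, paid for by those savings. For a cut of LP value
  \<open>2 - \<tau>\<close> the balance of the two is an inequality in \<open>\<tau>\<close> between logarithms, and
  \<open>\<phi>\<close> is chosen to make it hold.
\<close>

section \<open>Parity and connectivity\<close>

text \<open>Deleting a lonely edge leaves its cut without forest edges and odd for the parity set,
  so the join must cross it and may reconnect it. But a join edge that crosses several lonely cuts
  is credited with reconnecting only one of them; every other lonely edge may have to be bought back
  twice, and \<open>join_cost\<close> charges exactly that. This stays affordable because narrow
  cuts form a chain, and any m of them together carry LP weight at least m: the one free
  reconnection per join edge then pays on average for one reconnection per cut.

  Why 4: let the density be a / (a + \<sigma>). For a cut of value 2 - \<tau> the deficit in later
  trees has density (1 + \<tau>) a / (a + \<sigma>) - 1, positive until \<sigma> = a \<tau>. To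
  second order it totals (a/2 - 1 + 1/(2a)) \<tau>^2, against a surplus of (1 + 1/(2a)) \<tau>^2
  from the earlier trees, so small \<tau> force a \<le> 4. The weights sum to W = 1 + a ln (1 +
  1/a), which grows with a, and the ratio is 1 + 1/W; hence a = 4 is the best choice of this
  form.\<close>

lemma odd_card_sym_diff:
  assumes "finite A" "finite B"
  shows "odd (card (sym_diff A B)) \<longleftrightarrow> odd (card A) \<noteq> odd (card B)"
proof -
  have "card (sym_diff A B) = card (A - B) + card (B - A)"
    using assms by (intro card_Un_disjoint) auto
  moreover have "card A = card (A - B) + card (A \<inter> B)"
    using assms by (metis card_Int_Diff add.commute)
  moreover have "card B = card (B - A) + card (A \<inter> B)"
    using assms by (metis card_Int_Diff add.commute Int_commute)
  ultimately show ?thesis by presburger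
qed

lemma finite_edges_of: "finite V \<Longrightarrow> finite (edges_of V)"
  unfolding edges_of_def by (rule finite_subset[of _ "Pow V"]) auto

lemma finite_cut: "finite V \<Longrightarrow> finite (cut V U)"
  unfolding cut_def by (simp add: finite_edges_of)

lemma cut_subset: "cut V U \<subseteq> edges_of V"
  by (auto simp: cut_def)

lemma edges_ofE:
  assumes "e \<in> edges_of V"
  obtains u v where "e = {u, v}" "u \<noteq> v" "u \<in> V" "v \<in> V"
  using assms unfolding edges_of_def card_2_iff by auto

lemma doubleton_in_edges_of: "{u, v} \<in> edges_of V \<longleftrightarrow> u \<noteq> v \<and> u \<in> V \<and> v \<in> V"
  by (cases "u = v") (auto simp: edges_of_def)

lemma card_doubleton_Int:
  assumes "u \<noteq> v"
  shows "card ({u, v} \<inter> U) = 1 \<longleftrightarrow> (u \<in> U \<longleftrightarrow> v \<notin> U)"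
  using assms by (cases "u \<in> U"; cases "v \<in> U") (auto simp: Int_insert_left)

lemma doubleton_in_cut:
  "{u, v} \<in> cut V U \<longleftrightarrow> u \<noteq> v \<and> u \<in> V \<and> v \<in> V \<and> (u \<in> U \<longleftrightarrow> v \<notin> U)"
  using card_doubleton_Int[of u v U] by (auto simp: cut_def doubleton_in_edges_of)

lemma cutE:
  assumes "e \<in> cut V U"
  obtains u v where "e = {u, v}" "u \<noteq> v" "u \<in> V" "v \<in> V" "u \<in> U" "v \<notin> U"
proof -
  obtain a b where ab: "e = {a, b}" "a \<noteq> b" "a \<in> V" "b \<in> V"
    using assms cut_subset by (meson edges_ofE subsetD)
  then show thesis
    using assms that[of a b] that[of b a] by (cases "a \<in> U") (auto simp: doubleton_in_cut insert_commute)
qed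

lemma cut_sym_diff: "cut V (sym_diff U W) = sym_diff (cut V U) (cut V W)"
proof (rule set_eqI)
  fix e show "e \<in> cut V (sym_diff U W) \<longleftrightarrow> e \<in> sym_diff (cut V U) (cut V W)"
  proof (cases "e \<in> edges_of V")
    case True
    then show ?thesis by (elim edges_ofE) (auto simp: doubleton_in_cut)
  qed (auto simp: cut_def)
qed

lemma cut_empty: "cut V {} = {}"
  by (simp add: cut_def)

lemma cut_whole: "cut V V = {}"
  by (auto simp: cut_def edges_of_def Int_absorb2)

lemma cut_Diff: "cut V (V - U) = cut V U"
proof -
  have "e \<in> cut V (V - U) \<longleftrightarrow> e \<in> cut V U" for e
  proof (cases "e \<in> edges_of V")
    case True
    then show ?thesis by (elim edges_ofE) (auto simp: doubleton_in_cut)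
  qed (use cut_subset in blast)
  then show ?thesis by blast
qed

lemma odd_vertices_subset: "odd_vertices V F \<subseteq> V"
  by (auto simp: odd_vertices_def)

lemma odd_vertices_empty: "odd_vertices V {} = {}"
  by (simp add: odd_vertices_def)

lemma odd_vertices_sym_diff:
  assumes "finite V"
  shows "odd_vertices V (sym_diff A B) = sym_diff (odd_vertices V A) (odd_vertices V B)"
proof -
  have "odd (card (sym_diff A B \<inter> cut V {v})) \<longleftrightarrow>
      odd (card (A \<inter> cut V {v})) \<noteq> odd (card (B \<inter> cut V {v}))" for v
  proof -
    have "sym_diff A B \<inter> cut V {v} = sym_diff (A \<inter> cut V {v}) (B \<inter> cut V {v})" by auto
    then show ?thesis using odd_card_sym_diff[of "A \<inter> cut V {v}" "B \<inter> cut V {v}"] finite_cut[OF assms]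
      by simp
  qed
  then show ?thesis unfolding odd_vertices_def by blast
qed

lemma odd_vertices_edge:
  assumes "u \<noteq> v" "u \<in> V" "v \<in> V"
  shows "odd_vertices V {{u, v}} = {u, v}"
proof -
  have "{{u, v}} \<inter> cut V {w} = (if w \<in> {u, v} then {{u, v}} else {})" if "w \<in> V" for w
    using assms that by (auto simp: doubleton_in_cut)
  then show ?thesis using assms by (auto simp: odd_vertices_def split: if_splits)
qed

lemma insert_eq_sym_diff: "x \<notin> A \<Longrightarrow> insert x A = sym_diff {x} A"
  by auto

text \<open>Adding an edge toggles its two ends as odd vertices; the number of odd vertices in
  \<open>U\<close> changes parity exactly if the edge crosses \<open>U\<close>.\<close>

lemma handshake:
  assumes "finite V" "F \<subseteq> edges_of V"
  shows "odd (card (odd_vertices V F \<inter> U)) \<longleftrightarrow> odd (card (F \<inter> cut V U))"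
proof -
  have "finite F" by (rule finite_subset[OF assms(2) finite_edges_of[OF assms(1)]])
  then show ?thesis using assms(2)
  proof (induction F rule: finite_induct)
    case empty
    then show ?case by (simp add: odd_vertices_empty)
  next
    case (insert e F)
    then obtain u v where uv: "e = {u, v}" "u \<noteq> v" "u \<in> V" "v \<in> V" by (auto elim: edges_ofE)
    note ins = insert_eq_sym_diff[OF insert.hyps(2)]
    have fin: "finite (odd_vertices V F)"
      by (rule finite_subset[OF odd_vertices_subset assms(1)])
    have "odd_vertices V (insert e F) = sym_diff (odd_vertices V {e}) (odd_vertices V F)"
      by (simp only: ins odd_vertices_sym_diff[OF assms(1)])
    also have "odd_vertices V {e} = {u, v}" by (simp only: uv(1) odd_vertices_edge[OF uv(2-4)])
    finally have 1: "odd_vertices V (insert e F) \<inter> U = sym_diff ({u, v} \<inter> U) (odd_vertices V F \<inter> U)"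
      by blast
    have 2: "insert e F \<inter> cut V U = sym_diff ({e} \<inter> cut V U) (F \<inter> cut V U)"
      using insert.hyps(2) by auto
    have 3: "odd (card ({u, v} \<inter> U)) \<longleftrightarrow> e \<in> cut V U"
      using uv by (auto simp: doubleton_in_cut Int_insert_left)
    have 4: "odd (card ({e} \<inter> cut V U)) \<longleftrightarrow> e \<in> cut V U"
      by (cases "e \<in> cut V U") auto
    show ?case
      unfolding 1 2
      using odd_card_sym_diff[of "{u, v} \<inter> U" "odd_vertices V F \<inter> U"]
        odd_card_sym_diff[of "{e} \<inter> cut V U" "F \<inter> cut V U"] fin insert 3 4 by (simp only: finite_Int finite.intros) simp
  qed
qed

section \<open>Reachability, cuts and paths modulo 2\<close>

definition adj :: "'a set set \<Rightarrow> ('a \<times> 'a) set" where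
  "adj F = {(a, b). {a, b} \<in> F}"

lemma adj_rtrancl_iff_walk:
  "(u, v) \<in> (adj F)\<^sup>* \<longleftrightarrow> (\<exists>w. w \<noteq> [] \<and> hd w = u \<and> last w = v \<and> set (walk_edges w) \<subseteq> F)"
proof
  assume "(u, v) \<in> (adj F)\<^sup>*"
  then show "\<exists>w. w \<noteq> [] \<and> hd w = u \<and> last w = v \<and> set (walk_edges w) \<subseteq> F"
  proof (induction rule: converse_rtrancl_induct)
    case base
    then show ?case by (intro exI[of _ "[v]"]) simp
  next
    case (step y z)
    then obtain w where "w \<noteq> []" "hd w = z" "last w = v" "set (walk_edges w) \<subseteq> F" by blast
    then show ?case using step(1) by (intro exI[of _ "y # w"]) (cases w; auto simp: adj_def)
  qed
next
  have "(hd w, last w) \<in> (adj F)\<^sup>*" if "w \<noteq> []" "set (walk_edges w) \<subseteq> F" for w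
    using that
  proof (induction w rule: walk_edges.induct)
    case (1 a b w)
    then show ?case by (auto simp: adj_def intro: converse_rtrancl_into_rtrancl)
  qed auto
  then show "\<exists>w. w \<noteq> [] \<and> hd w = u \<and> last w = v \<and> set (walk_edges w) \<subseteq> F \<Longrightarrow> (u, v) \<in> (adj F)\<^sup>*"
    by blast
qed

lemma graph_connected_iff_adj:
  "graph_connected V F \<longleftrightarrow> (\<forall>u\<in>V. \<forall>v\<in>V. (u, v) \<in> (adj F)\<^sup>*)"
  unfolding graph_connected_def adj_rtrancl_iff_walk ..

lemma adj_rtrancl_cross:
  assumes "(u, v) \<in> (adj F)\<^sup>*" "F \<subseteq> edges_of V" "u \<in> U" "v \<notin> U"
  shows "F \<inter> cut V U \<noteq> {}"
  using assms
proof (induction rule: converse_rtrancl_induct)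
  case (step y z)
  then have e: "{y, z} \<in> F" by (simp add: adj_def)
  then have "{y, z} \<in> edges_of V" using step.prems by blast
  then show ?case
    using step e doubleton_in_cut[of y z V U] by (cases "z \<in> U") (auto simp: doubleton_in_edges_of)
qed simp

lemma graph_connected_iff_cuts:
  assumes "F \<subseteq> edges_of V"
  shows "graph_connected V F \<longleftrightarrow> (\<forall>U. U \<noteq> {} \<and> U \<subset> V \<longrightarrow> F \<inter> cut V U \<noteq> {})"
proof
  assume con: "graph_connected V F"
  show "\<forall>U. U \<noteq> {} \<and> U \<subset> V \<longrightarrow> F \<inter> cut V U \<noteq> {}"
  proof (intro allI impI, elim conjE)
    fix U assume "U \<noteq> {}" "U \<subset> V"
    then obtain u v where "u \<in> U" "u \<in> V" "v \<in> V" "v \<notin> U" by blast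
    then show "F \<inter> cut V U \<noteq> {}"
      using con adj_rtrancl_cross[OF _ assms] unfolding graph_connected_iff_adj by blast
  qed
next
  assume *: "\<forall>U. U \<noteq> {} \<and> U \<subset> V \<longrightarrow> F \<inter> cut V U \<noteq> {}"
  show "graph_connected V F"
    unfolding graph_connected_iff_adj
  proof (intro ballI, rule ccontr)
    fix u v assume uv: "u \<in> V" "v \<in> V" "(u, v) \<notin> (adj F)\<^sup>*"
    define U where "U = {w \<in> V. (u, w) \<in> (adj F)\<^sup>*}"
    have "u \<in> U" "v \<notin> U" "U \<subset> V" using uv by (auto simp: U_def)
    then have "F \<inter> cut V U \<noteq> {}" using * by blast
    then obtain e where e: "e \<in> F" "e \<in> cut V U" by blast
    then obtain a b where ab: "e = {a, b}" "a \<in> V" "b \<in> V"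
      using assms by (meson edges_ofE subsetD)
    have "(a, b) \<in> adj F" "(b, a) \<in> adj F" using e ab by (auto simp: adj_def insert_commute)
    moreover have "a \<in> U \<longleftrightarrow> b \<notin> U" using e ab by (auto simp: doubleton_in_cut)
    ultimately show False using ab by (auto simp: U_def intro: rtrancl_into_rtrancl)
  qed
qed

text \<open>A path is represented by its edges modulo 2, so no simple path has to be extracted:
  repeated edges cancel. \<open>sym_diff {u} {v}\<close> is empty for \<open>u = v\<close>, which
  covers closed walks.\<close>

lemma ex_join_of_adj_rtrancl:
  assumes "(u, v) \<in> (adj F)\<^sup>*" "F \<subseteq> edges_of V" "finite V" "v \<in> V"
  shows "\<exists>P \<subseteq> F. odd_vertices V P = sym_diff {u} {v}"
  using assms
proof (induction rule: converse_rtrancl_induct)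
  case base
  then show ?case by (intro exI[of _ "{}"]) (simp add: odd_vertices_empty)
next
  case (step y z)
  then obtain P where P: "P \<subseteq> F" "odd_vertices V P = sym_diff {z} {v}" by blast
  have "{y, z} \<in> F" using step by (auto simp: adj_def)
  moreover from this have "{y, z} \<in> edges_of V" using step.prems(1) by blast
  then have "y \<noteq> z" "y \<in> V" "z \<in> V" by (auto simp: doubleton_in_edges_of)
  ultimately show ?case using P
    by (intro exI[of _ "sym_diff {{y, z}} P"])
      (auto simp: odd_vertices_sym_diff[OF step.prems(2)] odd_vertices_edge)
qed

text \<open>\<open>S\<close> misses the cut of the symmetric difference of \<open>U\<close> and
  \<open>W\<close>; connectivity makes this difference empty or all of \<open>V\<close>. Working
  with cuts and not with vertex sets absorbs the complement.\<close>

lemma cut_eq_if_same_tree_edges: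
  assumes "graph_connected V S" "S \<subseteq> edges_of V" "U \<subseteq> V" "W \<subseteq> V"
    and "cut V U \<inter> S = cut V W \<inter> S"
  shows "cut V U = cut V W"
proof -
  have "S \<inter> cut V (sym_diff U W) = {}" using assms(5) unfolding cut_sym_diff by blast
  moreover have "sym_diff U W \<subseteq> V" using assms(3,4) by blast
  ultimately have "sym_diff U W = {} \<or> sym_diff U W = V"
    using assms(1)[unfolded graph_connected_iff_cuts[OF assms(2)], rule_format, of "sym_diff U W"]
    unfolding psubset_eq by argo
  then have "cut V (sym_diff U W) = {}" by (metis cut_empty cut_whole)
  then show ?thesis unfolding cut_sym_diff by blast
qed

text \<open>The graph is complete, so toggling the edge between two vertices of \<open>T\<close>
  removes both from the requirement.\<close>

lemma ex_T_join:
  assumes "finite V" "T \<subseteq> V" "even (card T)"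
  shows "\<exists>J. T_join V T J"
proof -
  have "finite T" using assms finite_subset by blast
  then show ?thesis using assms(2,3)
  proof (induction "card T" arbitrary: T rule: less_induct)
    case less
    show ?case
    proof (cases "T = {}")
      case True
      then show ?thesis by (intro exI[of _ "{}"]) (simp add: T_join_def odd_vertices_empty)
    next
      case False
      then obtain u where u: "u \<in> T" by blast
      have "T \<noteq> {u}" using less.prems(3) by auto
      then obtain v where v: "v \<in> T" "v \<noteq> u" using u by blast
      have c: "card T = Suc (Suc (card (T - {u, v})))"
        using card_Suc_Diff1[of T u] card_Suc_Diff1[of "T - {u}" v] u v less.prems(1)
        by (simp add: Diff_insert2[symmetric] insert_commute)
      then have "\<exists>J. T_join V (T - {u, v}) J"
        using less.hyps[of "T - {u, v}"] less.prems by (metis Diff_subset even_Suc_Suc_iff finite_Diff lessI less_Suc_eq subset_trans)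
      then obtain J where J: "J \<subseteq> edges_of V" "odd_vertices V J = T - {u, v}"
        by (auto simp: T_join_def)
      show ?thesis
        using J u v less.prems
        by (intro exI[of _ "sym_diff J {{u, v}}"])
          (auto simp: T_join_def odd_vertices_sym_diff[OF assms(1)] odd_vertices_edge doubleton_in_edges_of subset_iff)
    qed
  qed
qed

section \<open>The T-join polyhedron\<close>

text \<open>Compactness makes the linear programs below attain their minima without any polyhedral
  theory. The index set \<open>K\<close> of the constraints may be infinite.\<close>

lemma attains_min_on_box:
  fixes a :: "'k \<Rightarrow> 'i \<Rightarrow> real" and b :: "'k \<Rightarrow> real" and g :: "'i \<Rightarrow> real" and M :: real
  assumes "finite I"
    and x0: "x0 \<in> PiE I (\<lambda>_. {0..M})" "\<forall>k\<in>K. b k \<le> (\<Sum>i\<in>I. a k i * x0 i)"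
  shows "\<exists>x\<in>PiE I (\<lambda>_. {0..M}). (\<forall>k\<in>K. b k \<le> (\<Sum>i\<in>I. a k i * x i)) \<and>
    (\<forall>y\<in>PiE I (\<lambda>_. {0..M}). (\<forall>k\<in>K. b k \<le> (\<Sum>i\<in>I. a k i * y i)) \<longrightarrow>
       (\<Sum>i\<in>I. g i * x i) \<le> (\<Sum>i\<in>I. g i * y i))"
proof -
  let ?B = "PiE I (\<lambda>_. {0..M})"
  let ?F = "\<lambda>k. {x. b k \<le> (\<Sum>i\<in>I. a k i * x i)}"
  \<comment> \<open>Coordinates outside \<open>I\<close> are fixed at \<open>undefined\<close>,
    which turns the extensional functions on \<open>I\<close> into a product of compact sets over
    all indices.\<close>
  have "compactin (product_topology (\<lambda>_. euclidean) UNIV) (PiE UNIV (\<lambda>i. if i \<in> I then {0..M} else {undefined::real}))"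
    unfolding compactin_PiE by (auto simp: compactin_euclidean_iff)
  moreover have "PiE UNIV (\<lambda>i. if i \<in> I then {0..M} else {undefined::real}) = ?B"
    by (auto simp: PiE_iff extensional_def split: if_splits)
  ultimately have "compact ?B"
    by (simp add: euclidean_product_topology compactin_euclidean_iff)
  moreover have lin: "continuous_on A (\<lambda>x. \<Sum>i\<in>I. h i * x i)" for h :: "'i \<Rightarrow> real" and A
    by (intro continuous_intros continuous_on_product_coordinates continuous_on_subset[OF continuous_on_product_coordinates]) auto
  have "closed (\<Inter>k\<in>K. ?F k)"
    by (intro closed_INT ballI closed_Collect_le lin continuous_on_const)
  ultimately have "compact (?B \<inter> (\<Inter>k\<in>K. ?F k))" by (rule compact_Int_closed)
  moreover have "?B \<inter> (\<Inter>k\<in>K. ?F k) \<noteq> {}" using x0 by blast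
  ultimately obtain x where "x \<in> ?B \<inter> (\<Inter>k\<in>K. ?F k)"
    "\<forall>y \<in> ?B \<inter> (\<Inter>k\<in>K. ?F k). (\<Sum>i\<in>I. g i * x i) \<le> (\<Sum>i\<in>I. g i * y i)"
    using continuous_attains_inf[OF _ _ lin] by meson
  then show ?thesis by (intro bexI[of _ x]) auto
qed

lemma ex_minimizer:
  fixes f :: "'b \<Rightarrow> real"
  assumes "finite A" "A \<noteq> {}"
  shows "\<exists>a\<in>A. \<forall>b\<in>A. f a \<le> f b"
  by (intro bexI[of _ "arg_min_on f A"] ballI arg_min_least arg_min_if_finite assms)

text \<open>
  Among all \<open>r, x \<in> V\<close> take \<open>K\<close> of least cost with odd vertices \<open>sym_diff T (sym_diff {r} {x})\<close>, and
  let \<open>X\<close> be the set of vertices joined to \<open>x\<close> by edges of cost \<open>0\<close>. Such a \<open>K\<close> never crosses \<open>X\<close>,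
  since dropping a crossing edge would make it cheaper. Exchanging \<open>J\<close> and \<open>K\<close> along a path from
  \<open>r\<close> to \<open>X\<close> then shows that the path contains all edges of \<open>J\<close> that cross \<open>X\<close>.
\<close>

lemma ex_tight_cut:
  fixes d :: "'a set \<Rightarrow> real"
  assumes V: "finite V" and T: "T \<subseteq> V" "even (card T)"
    and d: "\<And>e. e \<in> edges_of V \<Longrightarrow> 0 \<le> d e"
    and pos: "\<And>J. T_join V T J \<Longrightarrow> 0 < sum d J"
  shows "\<exists>X\<subseteq>V. odd (card (T \<inter> X)) \<and> (\<forall>e\<in>cut V X. 0 < d e) \<and>
    (\<forall>J. T_join V T J \<and> (\<forall>J'. T_join V T J' \<longrightarrow> sum d J \<le> sum d J') \<longrightarrow> card (J \<inter> cut V X) = 1)"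
proof -
  define E where "E = edges_of V"
  have finE: "finite E" using V by (simp add: E_def finite_edges_of)
  \<comment> \<open>The case \<open>r = x\<close> is included: there \<open>sym_diff {r} {x}\<close>
    is empty, so T-joins themselves compete with the sets \<open>K\<close>.\<close>
  define M where "M = (\<lambda>(r, x, K). r \<in> V \<and> x \<in> V \<and> K \<subseteq> E \<and> odd_vertices V K = sym_diff T (sym_diff {r} {x}))"
  have finM: "finite {m. M m}"
    by (rule finite_subset[of _ "V \<times> V \<times> Pow E"]) (use V finE in \<open>auto simp: M_def\<close>)
  obtain J0 where J0: "T_join V T J0" using ex_T_join[OF V T] by blast
  then have "J0 \<noteq> {}" using pos by fastforce
  then obtain e0 where e0: "e0 \<in> J0" by blast
  then have "e0 \<in> edges_of V" using J0 by (auto simp: T_join_def)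
  then obtain r0 x0 where rx0: "e0 = {r0, x0}" "r0 \<noteq> x0" "r0 \<in> V" "x0 \<in> V" by (rule edges_ofE)
  have "M (r0, r0, J0)" using rx0 J0 by (auto simp: M_def T_join_def E_def)
  then have "{m. M m} \<noteq> {}" by blast
  then obtain m where m: "M m" "\<And>m'. M m' \<Longrightarrow> sum d (snd (snd m)) \<le> sum d (snd (snd m'))"
    using ex_minimizer[OF finM, of "\<lambda>m. sum d (snd (snd m))"] by blast
  obtain r x K where mrx: "m = (r, x, K)" by (cases m)
  then have K: "r \<in> V" "x \<in> V" "K \<subseteq> E" "odd_vertices V K = sym_diff T (sym_diff {r} {x})"
    and Kmin: "\<And>r' x' K'. r' \<in> V \<Longrightarrow> x' \<in> V \<Longrightarrow> K' \<subseteq> E \<Longrightarrow>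
      odd_vertices V K' = sym_diff T (sym_diff {r'} {x'}) \<Longrightarrow> sum d K \<le> sum d K'"
    using m by (auto simp: M_def)
  define Z where "Z = {e \<in> E. d e = 0}"
  have Zsub: "Z \<subseteq> edges_of V" by (auto simp: Z_def E_def)
  define X where "X = {u \<in> V. (u, x) \<in> (adj Z)\<^sup>*}"
  have xX: "x \<in> X" "X \<subseteq> V" using K by (auto simp: X_def)
  have sum_sd: "sum d (sym_diff A B) \<le> sum d A + sum d B" if "A \<subseteq> E" "B \<subseteq> E" for A B
  proof -
    have fin: "finite A" "finite B" by (rule finite_subset[OF that(1) finE], rule finite_subset[OF that(2) finE])
    have "sum d (sym_diff A B) = sum d (A - B) + sum d (B - A)"
      using fin by (intro sum.union_disjoint) auto
    also have "\<dots> \<le> sum d A + sum d B"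
      using fin that d by (intro add_mono sum_mono2) (auto simp: E_def)
    finally show ?thesis .
  qed
  have zero_path: "\<exists>P\<subseteq>Z. odd_vertices V P = sym_diff {u} {x} \<and> P \<inter> cut V X = {}" if "u \<in> X" for u
  proof -
    have "(u, x) \<in> (adj Z)\<^sup>*" using that by (simp add: X_def)
    from ex_join_of_adj_rtrancl[OF this Zsub V K(2)]
    obtain P where P: "P \<subseteq> Z" "odd_vertices V P = sym_diff {u} {x}" by metis
    have "Z \<inter> cut V X = {}"
    proof (rule ccontr)
      assume "Z \<inter> cut V X \<noteq> {}"
      then obtain e where e: "e \<in> Z" "e \<in> cut V X" by blast
      obtain a b where ab: "e = {a, b}" "a \<noteq> b" "a \<in> V" "b \<in> V" "a \<in> X" "b \<notin> X"
        using e(2) by (rule cutE)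
      then have "(b, a) \<in> adj Z" using e(1) by (simp add: adj_def insert_commute)
      then show False using ab by (auto simp: X_def intro: converse_rtrancl_into_rtrancl)
    qed
    then show ?thesis using P by blast
  qed
  have Zcut: "0 < d e" if e: "e \<in> cut V X" for e
  proof (rule ccontr)
    assume "\<not> 0 < d e"
    moreover have "e \<in> E" using e cut_subset by (auto simp: E_def)
    ultimately have "e \<in> Z" using d[of e] by (auto simp: Z_def E_def)
    moreover obtain a b where ab: "e = {a, b}" "a \<noteq> b" "a \<in> V" "b \<in> V" "a \<in> X" "b \<notin> X"
      using e by (rule cutE)
    ultimately have "(b, a) \<in> adj Z" by (simp add: adj_def insert_commute)
    then show False using ab by (auto simp: X_def intro: converse_rtrancl_into_rtrancl)
  qed
  have sumZ: "sum d P = 0" if "P \<subseteq> Z" for P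
    using that by (intro sum.neutral) (auto simp: Z_def)
  have no_cross: "K' \<inter> cut V X = {}"
    if K': "K' \<subseteq> E" "odd_vertices V K' = sym_diff T (sym_diff {r} {x})" "sum d K' \<le> sum d K" for K'
  proof (rule ccontr)
    assume "K' \<inter> cut V X \<noteq> {}"
    then obtain e where e: "e \<in> K'" "e \<in> cut V X" by blast
    obtain u v where uv: "e = {u, v}" "u \<noteq> v" "u \<in> V" "v \<in> V" "u \<in> X" "v \<notin> X"
      using e(2) by (rule cutE)
    obtain P where P: "P \<subseteq> Z" "odd_vertices V P = sym_diff {u} {x}" using zero_path[OF uv(5)] by blast
    \<comment> \<open>Dropping \<open>e = {u, v}\<close> and adding a free path from
      \<open>u\<close> to \<open>x\<close> moves the second terminal from \<open>x\<close> to
      \<open>v\<close>, so the result is again a candidate for the minimum.\<close>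
    let ?L = "sym_diff (sym_diff K' {e}) P"
    have Lodd: "odd_vertices V ?L = sym_diff T (sym_diff {r} {v})"
      unfolding odd_vertices_sym_diff[OF V] K'(2) P(2) uv(1) odd_vertices_edge[OF uv(2-4)]
      using uv(2) by blast
    have LE: "sym_diff K' {e} \<subseteq> E" "P \<subseteq> E" using K'(1) e P(1) by (auto simp: Z_def)
    then have "?L \<subseteq> E" by blast
    then have "sum d K \<le> sum d ?L" by (rule Kmin[OF K(1) uv(4) _ Lodd])
    also have "\<dots> \<le> sum d (sym_diff K' {e}) + sum d P" using LE by (intro sum_sd)
    also have "sym_diff K' {e} = K' - {e}" using e by blast
    also have "sum d (K' - {e}) = sum d K' - d e"
      using e K'(1) finE finite_subset by (subst sum_diff1) auto
    finally show False using K'(3) Zcut[OF e(2)] sumZ[OF P(1)] by linarith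
  qed
  \<comment> \<open>If \<open>r\<close> were in \<open>X\<close>, a free path would complete
    \<open>K\<close> to a T-join. By \<open>pos\<close> it has an edge of positive cost, and
    deleting that edge gives a cheaper candidate whose terminals are the ends of the edge.\<close>
  have rX: "r \<notin> X"
  proof
    assume "r \<in> X"
    then obtain P where P: "P \<subseteq> Z" "odd_vertices V P = sym_diff {r} {x}" using zero_path by blast
    then have "odd_vertices V (sym_diff K P) = T"
      unfolding odd_vertices_sym_diff[OF V] K(4) by blast
    moreover have PE: "P \<subseteq> E" using P by (auto simp: Z_def)
    ultimately have J: "T_join V T (sym_diff K P)" using K(3) by (auto simp: T_join_def E_def)
    then have "0 < sum d (sym_diff K P)" by (rule pos)
    then obtain f where f: "f \<in> sym_diff K P" "0 < d f"
      by (metis sum_nonpos linorder_not_less)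
    then have "f \<in> edges_of V" using J by (auto simp: T_join_def)
    then obtain a b where ab: "f = {a, b}" "a \<noteq> b" "a \<in> V" "b \<in> V" by (rule edges_ofE)
    let ?L = "sym_diff (sym_diff K P) {f}"
    have Lodd: "odd_vertices V ?L = sym_diff T (sym_diff {a} {b})"
      using ab by (auto simp: odd_vertices_sym_diff[OF V] odd_vertices_edge
          \<open>odd_vertices V (sym_diff K P) = T\<close>[unfolded odd_vertices_sym_diff[OF V]])
    have "?L \<subseteq> E" using K(3) PE f by blast
    then have "sum d K \<le> sum d ?L" by (rule Kmin[OF ab(3,4) _ Lodd])
    also have "?L = sym_diff K P - {f}" using f by blast
    also have "sum d (sym_diff K P - {f}) = sum d (sym_diff K P) - d f"
      using f K(3) PE finE by (subst sum_diff1) (auto dest: finite_subset)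
    also have "\<dots> \<le> sum d K + sum d P - d f" using sum_sd[OF K(3) PE] by simp
    finally show False using f sumZ[OF P(1)] by linarith
  qed
  have "K \<inter> cut V X = {}" using no_cross K by simp
  then have "even (card (sym_diff T (sym_diff {r} {x}) \<inter> X))"
    using handshake[OF V, of K X] K(3,4) by (simp add: E_def)
  moreover have "sym_diff T (sym_diff {r} {x}) \<inter> X = sym_diff (T \<inter> X) {x}" using rX xX by blast
  moreover have finT: "finite T" by (rule finite_subset[OF T(1) V])
  ultimately have odd: "odd (card (T \<inter> X))" using odd_card_sym_diff[of "T \<inter> X" "{x}"] by simp
  have "card (J \<inter> cut V X) = 1"
    if J: "T_join V T J" and Jmin: "\<And>J'. T_join V T J' \<Longrightarrow> sum d J \<le> sum d J'" for J
  proof -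
    have JE: "J \<subseteq> E" "odd_vertices V J = T" using J by (auto simp: T_join_def E_def)
    let ?D = "sym_diff J K"
    have DE: "?D \<subseteq> edges_of V" using JE K by (auto simp: E_def)
    have "odd_vertices V ?D = sym_diff {r} {x}"
      unfolding odd_vertices_sym_diff[OF V] JE(2) K(4) by blast
    then have Dodd: "odd_vertices V ?D = {r, x}" using rX xX by blast
    have reach: "(r, x) \<in> (adj ?D)\<^sup>*"
    proof (rule ccontr)
      assume nr: "(r, x) \<notin> (adj ?D)\<^sup>*"
      define U where "U = {u \<in> V. (r, u) \<in> (adj ?D)\<^sup>*}"
      have "?D \<inter> cut V U = {}"
      proof (rule ccontr)
        assume "?D \<inter> cut V U \<noteq> {}"
        then obtain e where e: "e \<in> ?D" "e \<in> cut V U" by blast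
        obtain a b where ab: "e = {a, b}" "a \<noteq> b" "a \<in> V" "b \<in> V" "a \<in> U" "b \<notin> U"
          using e(2) by (rule cutE)
        then have "(a, b) \<in> adj ?D" using e(1) by (simp add: adj_def)
        then show False using ab(4-) by (auto simp: U_def intro: rtrancl_into_rtrancl)
      qed
      then have "even (card ({r, x} \<inter> U))" using handshake[OF V DE, of U] Dodd by simp
      moreover have "{r, x} \<inter> U = {r}" using nr K(1) by (auto simp: U_def)
      ultimately show False by simp
    qed
    \<comment> \<open>\<open>A\<close> is the part of the path from \<open>r\<close> up to its first
      entry into \<open>X\<close>. Only the entering edge crosses the cut, as earlier edges have
      both ends outside \<open>X\<close>.\<close>
    have "\<exists>u\<in>X. \<exists>A\<subseteq>?D. odd_vertices V A = sym_diff {r} {u} \<and> card (A \<inter> cut V X) = 1"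
      using reach rX
    proof (induction rule: converse_rtrancl_induct)
      case base
      then show ?case using xX by blast
    next
      case (step y z)
      have e: "{y, z} \<in> ?D" using step(1) by (simp add: adj_def)
      have yz: "y \<noteq> z" "y \<in> V" "z \<in> V" using subsetD[OF DE e] by (auto simp: doubleton_in_edges_of)
      show ?case
      proof (cases "z \<in> X")
        case True
        then have "{{y, z}} \<inter> cut V X = {{y, z}}" using step.prems yz by (auto simp: doubleton_in_cut)
        then show ?thesis using True e yz odd_vertices_edge[OF yz]
          by (intro bexI[of _ z] exI[of _ "{{y, z}}"]) auto
      next
        case False
        then obtain u A where A: "u \<in> X" "A \<subseteq> ?D" "odd_vertices V A = sym_diff {z} {u}" "card (A \<inter> cut V X) = 1"
          using step.IH by blast
        have "sym_diff A {{y, z}} \<inter> cut V X = A \<inter> cut V X"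
          using step.prems False by (auto simp: doubleton_in_cut)
        moreover have "odd_vertices V (sym_diff A {{y, z}}) = sym_diff {y} {u}"
          unfolding odd_vertices_sym_diff[OF V] A(3) odd_vertices_edge[OF yz] using yz by blast
        moreover have "sym_diff A {{y, z}} \<subseteq> ?D" using A(2) e by blast
        ultimately show ?thesis using A(1,4) by (intro bexI[of _ u] exI[of _ "sym_diff A {{y, z}}"]) auto
      qed
    qed
    then obtain u A where A: "u \<in> X" "A \<subseteq> ?D" "odd_vertices V A = sym_diff {r} {u}" "card (A \<inter> cut V X) = 1"
      by blast
    obtain P where P: "P \<subseteq> Z" "odd_vertices V P = sym_diff {u} {x}" "P \<inter> cut V X = {}"
      using zero_path[OF A(1)] by blast
    have PE: "P \<subseteq> E" and AE: "A \<subseteq> E" using P A(2) JE K(3) by (auto simp: Z_def)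
    have "T_join V T (sym_diff (sym_diff K A) P)"
      unfolding T_join_def odd_vertices_sym_diff[OF V] K(4) A(3) P(2)
      using K(3) AE PE by (auto simp: E_def)
    then have "sum d J \<le> sum d (sym_diff (sym_diff K A) P)" by (rule Jmin)
    also have "\<dots> \<le> sum d (sym_diff K A) + sum d P" using K(3) AE PE by (intro sum_sd) auto
    finally have 1: "sum d J \<le> sum d (sym_diff K A)" using sumZ[OF P(1)] by simp
    have fin: "finite J" "finite K" "finite A"
      by (rule finite_subset[OF JE(1) finE], rule finite_subset[OF K(3) finE], rule finite_subset[OF AE finE])
    \<comment> \<open>Every edge of \<open>A\<close> lies in exactly one of \<open>J\<close> and
      \<open>K\<close>, so exchanging along \<open>A\<close> preserves the total cost. Since
      \<open>J\<close> does not become cheaper to replace, \<open>sym_diff J A\<close> costs at most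
      \<open>K\<close>.\<close>
    have 2: "sum d (sym_diff K A) + sum d (sym_diff J A) = sum d J + sum d K"
    proof -
      have JA: "sum d (sym_diff J A) = sum d (J - A) + sum d (A - J)"
        and KA: "sum d (sym_diff K A) = sum d (K - A) + sum d (A - K)"
        using fin by (auto intro!: sum.union_disjoint)
      have "A - J = A \<inter> K" "A - K = A \<inter> J" using A(2) by blast+
      then show ?thesis unfolding JA KA
        using sum.Int_Diff[OF fin(1), of d A] sum.Int_Diff[OF fin(2), of d A]
        by (simp add: Int_commute)
    qed
    let ?L = "sym_diff (sym_diff J A) P"
    have "sum d ?L \<le> sum d (sym_diff J A) + sum d P" using JE AE PE by (intro sum_sd) auto
    then have "sum d ?L \<le> sum d K" using 1 2 sumZ[OF P(1)] by simp
    moreover have "odd_vertices V ?L = sym_diff T (sym_diff {r} {x})"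
      unfolding odd_vertices_sym_diff[OF V] JE(2) A(3) P(2) by blast
    moreover have "?L \<subseteq> E" using JE AE PE by blast
    ultimately have L0: "?L \<inter> cut V X = {}" by (intro no_cross)
    \<comment> \<open>\<open>?L\<close> is as cheap as \<open>K\<close> and hence avoids the cut; so
      \<open>J\<close> and \<open>A\<close> must agree there.\<close>
    have "J \<inter> cut V X = A \<inter> cut V X" using L0 P(3) by blast
    then show ?thesis using A(4) by simp
  qed
  then show ?thesis using xX odd Zcut by blast
qed


lemma ex_pos_lower_bound:
  fixes A :: "real set"
  assumes "finite A" "\<And>a. a \<in> A \<Longrightarrow> 0 < a"
  shows "\<exists>\<theta>>0. \<forall>a\<in>A. \<theta> \<le> a"
  using assms by (intro exI[of _ "Min (insert 1 A)"]) auto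

text \<open>
  Let \<open>h\<close> minimise \<open>\<Sum>e. z e * h e\<close> among the nonnegative costs for which every T-join costs at
  least \<open>1\<close>. If the minimum were below \<open>1\<close>, moving \<open>h\<close> away from the incidence vector of a cut that
  is tight for \<open>h\<close> would decrease it further.
\<close>

theorem min_T_join_le_fractional:
  fixes d z :: "'a set \<Rightarrow> real"
  assumes V: "finite V" and T: "T \<subseteq> V" "even (card T)"
    and d: "\<And>e. e \<in> edges_of V \<Longrightarrow> 0 \<le> d e"
    and z: "\<And>e. e \<in> edges_of V \<Longrightarrow> 0 \<le> z e"
    and cuts: "\<And>U. U \<subseteq> V \<Longrightarrow> odd (card (T \<inter> U)) \<Longrightarrow> 1 \<le> sum z (cut V U)"
  shows "\<exists>J. T_join V T J \<and> sum d J \<le> (\<Sum>e\<in>edges_of V. d e * z e)"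
proof (rule ccontr)
  assume "\<not> ?thesis"
  then have less: "(\<Sum>e\<in>edges_of V. d e * z e) < sum d J" if "T_join V T J" for J
    using that by (meson linorder_not_less)
  define E where "E = edges_of V"
  have finE: "finite E" using V by (simp add: E_def finite_edges_of)
  define \<J> where "\<J> = {J. T_join V T J}"
  have JE: "J \<subseteq> E" if "J \<in> \<J>" for J using that by (simp add: \<J>_def T_join_def E_def)
  have finJ: "finite \<J>" by (rule finite_subset[of _ "Pow E"]) (use JE finE in auto)
  have J0: "\<J> \<noteq> {}" using ex_T_join[OF V T] by (auto simp: \<J>_def)
  have dz0: "0 \<le> (\<Sum>e\<in>E. d e * z e)" using d z by (intro sum_nonneg) (auto simp: E_def)
  have dJpos: "0 < sum d J" if "J \<in> \<J>" for J
    using less[of J] that dz0 by (simp add: \<J>_def E_def)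
  have sum_ind: "(\<Sum>e\<in>E. indicator J e * h e) = sum h J" if "J \<subseteq> E" for J and h :: "'a set \<Rightarrow> real"
  proof -
    have "sum h J = (\<Sum>e\<in>J. indicator J e * h e)" by (intro sum.cong) auto
    also have "\<dots> = (\<Sum>e\<in>E. indicator J e * h e)"
      using that finE by (intro sum.mono_neutral_left) auto
    finally show ?thesis by simp
  qed
  let ?B = "PiE E (\<lambda>_. {0..1::real})"
  have one: "restrict (\<lambda>_. 1) E \<in> ?B" "\<forall>J\<in>\<J>. 1 \<le> (\<Sum>e\<in>E. indicator J e * restrict (\<lambda>_. 1::real) E e)"
  proof -
    have "1 \<le> (\<Sum>e\<in>E. indicator J e * restrict (\<lambda>_. 1::real) E e)" if "J \<in> \<J>" for J
    proof -
      have "J \<noteq> {}" using dJpos[OF that] by auto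
      then have "1 \<le> card J" using JE[OF that] finE by (metis One_nat_def Suc_leI card_gt_0_iff finite_subset)
      moreover have "(\<Sum>e\<in>E. indicator J e * restrict (\<lambda>_. 1::real) E e) = (\<Sum>e\<in>J. restrict (\<lambda>_. 1::real) E e)"
        by (rule sum_ind[OF JE[OF that]])
      moreover have "(\<Sum>e\<in>J. restrict (\<lambda>_. 1::real) E e) = (\<Sum>e\<in>J. 1)"
        using JE[OF that] by (intro sum.cong) auto
      ultimately show ?thesis by simp
    qed
    then show "\<forall>J\<in>\<J>. 1 \<le> (\<Sum>e\<in>E. indicator J e * restrict (\<lambda>_. 1::real) E e)" by blast
  qed auto
  obtain h where h: "h \<in> ?B" "\<forall>J\<in>\<J>. 1 \<le> (\<Sum>e\<in>E. indicator J e * h e)"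
    and hmin: "\<And>y. y \<in> ?B \<Longrightarrow> (\<forall>J\<in>\<J>. 1 \<le> (\<Sum>e\<in>E. indicator J e * y e)) \<Longrightarrow>
       (\<Sum>e\<in>E. z e * h e) \<le> (\<Sum>e\<in>E. z e * y e)"
    using attains_min_on_box[OF finE one, of z] by blast
  have h0: "0 \<le> h e" if "e \<in> E" for e using h(1) that by (auto simp: PiE_iff)
  have hJ: "1 \<le> sum h J" if "J \<in> \<J>" for J
    using bspec[OF h(2) that] unfolding sum_ind[OF JE[OF that]] .
  have hmin': "(\<Sum>e\<in>E. z e * h e) \<le> (\<Sum>e\<in>E. z e * y e)"
    if y0: "\<And>e. e \<in> E \<Longrightarrow> 0 \<le> y e" and yJ: "\<And>J. J \<in> \<J> \<Longrightarrow> 1 \<le> sum y J" for y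
  proof -
    \<comment> \<open>Truncating at 1 does not raise the objective, and it preserves feasibility:
      one edge of value at least 1 already pays for a whole T-join. Hence the box, imposed only for
      compactness, costs nothing.\<close>
    let ?y = "restrict (\<lambda>e. min 1 (y e)) E"
    have "1 \<le> sum ?y J" if "J \<in> \<J>" for J
    proof -
      have sub: "J \<subseteq> E" "finite J" using JE[OF that] finite_subset[OF JE[OF that] finE] .
      then have eq: "sum ?y J = (\<Sum>e\<in>J. min 1 (y e))" by (intro sum.cong) auto
      show ?thesis
      proof (cases "\<exists>e\<in>J. 1 \<le> y e")
        case True
        then obtain e where "e \<in> J" "1 \<le> y e" by blast
        then have "1 \<le> min 1 (y e)" by simp
        also have "\<dots> \<le> (\<Sum>e\<in>J. min 1 (y e))"
          using sub y0 \<open>e \<in> J\<close> by (intro member_le_sum) auto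
        finally show ?thesis using eq by simp
      next
        case False
        then have "(\<Sum>e\<in>J. min 1 (y e)) = sum y J" by (intro sum.cong) (auto simp: min_def)
        then show ?thesis using yJ[OF that] eq by simp
      qed
    qed
    then have "\<forall>J\<in>\<J>. 1 \<le> (\<Sum>e\<in>E. indicator J e * ?y e)"
      by (intro ballI) (subst sum_ind[OF JE], assumption, blast)
    moreover have "?y \<in> ?B" using y0 by auto
    ultimately have "(\<Sum>e\<in>E. z e * h e) \<le> (\<Sum>e\<in>E. z e * ?y e)" by (intro hmin)
    also have "\<dots> \<le> (\<Sum>e\<in>E. z e * y e)" using z by (intro sum_mono mult_left_mono) (auto simp: E_def)
    finally show ?thesis .
  qed
  have hz: "1 \<le> (\<Sum>e\<in>E. z e * h e)"
  proof (rule ccontr)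
    assume lt: "\<not> 1 \<le> (\<Sum>e\<in>E. z e * h e)"
    obtain X where X: "X \<subseteq> V" "odd (card (T \<inter> X))" "\<forall>e\<in>cut V X. 0 < h e"
      and tight: "\<And>J. J \<in> \<J> \<Longrightarrow> (\<forall>J'\<in>\<J>. sum h J \<le> sum h J') \<Longrightarrow> card (J \<inter> cut V X) = 1"
    proof -
      have "\<exists>X\<subseteq>V. odd (card (T \<inter> X)) \<and> (\<forall>e\<in>cut V X. 0 < h e) \<and>
          (\<forall>J. T_join V T J \<and> (\<forall>J'. T_join V T J' \<longrightarrow> sum h J \<le> sum h J') \<longrightarrow> card (J \<inter> cut V X) = 1)"
        by (rule ex_tight_cut[OF V T]) (use h0 hJ in \<open>force simp: E_def \<J>_def\<close>)+
      then show ?thesis using that by (auto simp: \<J>_def)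
    qed
    define C where "C = cut V X"
    have C: "C \<subseteq> E" "finite C" using cut_subset finite_cut[OF V] by (auto simp: C_def E_def)
    obtain J1 where J1: "J1 \<in> \<J>" "\<And>J. J \<in> \<J> \<Longrightarrow> sum h J1 \<le> sum h J"
      using ex_minimizer[OF finJ J0, of "sum h"] by blast
    \<comment> \<open>These are the bounds for the step length: the values on the cut keep
      \<open>y\<close> nonnegative, the scaled cost gaps keep the non-minimal T-joins feasible, each
      of which crosses the cut in at most \<open>card E\<close> edges.\<close>
    define A where "A = h ` C \<union> (\<lambda>J. (sum h J - sum h J1) / (1 + card E)) ` {J \<in> \<J>. sum h J1 < sum h J}"
    have "finite A" using C finJ by (auto simp: A_def)
    moreover have "0 < a" if "a \<in> A" for a using that X(3) by (auto simp: A_def C_def)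
    ultimately have "\<exists>\<theta>>0. \<forall>a\<in>A. \<theta> \<le> a" by (rule ex_pos_lower_bound)
    then obtain \<theta> where \<theta>: "0 < \<theta>" "\<And>a. a \<in> A \<Longrightarrow> \<theta> \<le> a" by blast
    \<comment> \<open>Scaling \<open>h\<close> up by 1 + \<theta> and subtracting \<theta> on the
      cut keeps minimum T-joins feasible, since they cross the cut once. The objective changes by
      \<theta> times its value minus \<open>sum z C\<close>, which is negative if the value is below
      1.\<close>
    define y where "y e = h e + \<theta> * (h e - indicator C e)" for e
    have y0: "0 \<le> y e" if "e \<in> E" for e
    proof (cases "e \<in> C")
      case True
      then have "\<theta> \<le> h e" using \<theta>(2) by (auto simp: A_def)
      moreover have "0 \<le> \<theta> * h e" using \<theta>(1) h0[OF that] by simp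
      ultimately show ?thesis using True by (simp add: y_def algebra_simps)
    next
      case False
      then show ?thesis using \<theta>(1) h0[OF that] by (simp add: y_def)
    qed
    have sumy: "sum y J = sum h J + \<theta> * (sum h J - card (J \<inter> C))" if "J \<in> \<J>" for J
    proof -
      have "finite J" by (rule finite_subset[OF JE[OF that] finE])
      then have "sum (indicator C) J = (card (J \<inter> C) :: real)"
        by (simp add: indicator_def sum_of_bool_eq)
      then show ?thesis by (simp add: y_def sum.distrib sum_subtractf flip: sum_distrib_left)
    qed
    have yJ: "1 \<le> sum y J" if J: "J \<in> \<J>" for J
    proof (cases "sum h J1 < sum h J")
      case False
      then have "\<forall>J'\<in>\<J>. sum h J \<le> sum h J'" using J1(2) by fastforce
      then have "card (J \<inter> C) = 1" using tight[OF J] by (simp add: C_def)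
      moreover have "0 \<le> \<theta> * (sum h J - 1)" using \<theta>(1) hJ[OF J] by simp
      ultimately show ?thesis using sumy[OF J] hJ[OF J] by simp
    next
      case True
      then have "(sum h J - sum h J1) / (1 + card E) \<in> A" using J by (auto simp: A_def)
      then have "\<theta> \<le> (sum h J - sum h J1) / (1 + card E)" by (rule \<theta>(2))
      then have "\<theta> * (1 + card E) \<le> sum h J - sum h J1" by (subst (asm) pos_le_divide_eq) auto
      moreover have "card (J \<inter> C) \<le> card E" using C finE by (intro card_mono) auto
      then have "\<theta> * card (J \<inter> C) \<le> \<theta> * (1 + card E)" using \<theta>(1) by (intro mult_left_mono) auto
      moreover have "0 \<le> \<theta> * sum h J" using \<theta>(1) hJ[OF J] by simp
      ultimately show ?thesis using sumy[OF J] hJ[OF J1(1)] by (simp add: right_diff_distrib)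
    qed
    have "(\<Sum>e\<in>E. z e * h e) \<le> (\<Sum>e\<in>E. z e * y e)" using y0 yJ by (intro hmin')
    also have "\<dots> = (\<Sum>e\<in>E. z e * h e) + \<theta> * ((\<Sum>e\<in>E. z e * h e) - (\<Sum>e\<in>E. indicator C e * z e))"
      by (simp add: y_def algebra_simps sum.distrib sum_subtractf sum_distrib_left)
    also have "(\<Sum>e\<in>E. indicator C e * z e) = sum z C" by (rule sum_ind[OF C(1)])
    finally have "0 \<le> \<theta> * ((\<Sum>e\<in>E. z e * h e) - sum z C)" by simp
    moreover have "1 \<le> sum z C" using cuts[OF X(1,2)] by (simp add: C_def)
    ultimately show False using lt \<theta>(1) by (simp add: zero_le_mult_iff)
  qed
  obtain J1 where J1: "J1 \<in> \<J>" "\<And>J. J \<in> \<J> \<Longrightarrow> sum d J1 \<le> sum d J"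
    using ex_minimizer[OF finJ J0, of "sum d"] by blast
  let ?t = "sum d J1"
  have t: "0 < ?t" by (rule dJpos[OF J1(1)])
  \<comment> \<open>Normalising \<open>d\<close> by the minimum cost of a T-join makes it a
    competitor of \<open>h\<close>; this converts the bound for \<open>h\<close> into the claim for
    \<open>d\<close>.\<close>
  have "(\<Sum>e\<in>E. z e * h e) \<le> (\<Sum>e\<in>E. z e * (d e / ?t))"
    by (rule hmin') (use d t J1(2) in \<open>auto simp: E_def simp flip: sum_divide_distrib\<close>)
  also have "\<dots> = (\<Sum>e\<in>E. d e * z e) / ?t" by (simp add: sum_divide_distrib mult.commute)
  also have "\<dots> < 1" using less[of J1] J1(1) t by (simp add: \<J>_def E_def)
  finally show False using hz by simp
qed

section \<open>Eulerian walks and shortcuts\<close>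

definition mdegree :: "'a set multiset \<Rightarrow> 'a \<Rightarrow> nat" where
  "mdegree H v = size (filter_mset (\<lambda>e. v \<in> e) H)"

lemma mdegree_empty [simp]: "mdegree {#} v = 0"
  by (simp add: mdegree_def)

lemma mdegree_add_mset [simp]: "mdegree (add_mset e H) v = mdegree H v + (if v \<in> e then 1 else 0)"
  by (simp add: mdegree_def)

lemma mdegree_union [simp]: "mdegree (G + H) v = mdegree G v + mdegree H v"
  by (simp add: mdegree_def)

lemma walk_edges_append: "walk_edges (xs @ v # ys) = walk_edges (xs @ [v]) @ walk_edges (v # ys)"
  by (induction xs rule: walk_edges.induct) simp_all

lemma Union_walk_edges: "\<Union>(set (walk_edges w)) \<subseteq> set w"
  by (induction w rule: walk_edges.induct) auto

lemma Union_walk_edges_eq: "length w \<ge> 2 \<Longrightarrow> \<Union>(set (walk_edges w)) = set w"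
proof (induction w rule: walk_edges.induct)
  case (1 u v w)
  then show ?case by (cases w) auto
qed auto

lemma length_walk_edges: "length (walk_edges w) = length w - 1"
  by (induction w rule: walk_edges.induct) auto

lemma odd_mdegree_walk:
  assumes "w \<noteq> []" "\<And>e. e \<in> set (walk_edges w) \<Longrightarrow> card e = 2"
  shows "odd (mdegree (mset (walk_edges w)) v) \<longleftrightarrow> (v = hd w) \<noteq> (v = last w)"
  using assms
proof (induction w rule: walk_edges.induct)
  case (1 a b w)
  have "a \<noteq> b" using "1.prems"(2)[of "{a, b}"] by auto
  moreover have "odd (mdegree (mset (walk_edges (b # w))) v) \<longleftrightarrow> (v = b) \<noteq> (v = last (b # w))"
    using "1.IH" "1.prems"(2) by simp
  ultimately show ?case by (cases "v = a"; cases "v = b") simp_all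
qed auto

text \<open>The start \<open>a\<close> has odd degree, so an edge leaves it. Removing this edge
  moves the odd vertex to its other end, and the walk continues from there until it meets
  \<open>b\<close>.\<close>

lemma ex_trail:
  assumes "\<And>e. e \<in># H \<Longrightarrow> card e = 2" "\<And>v. odd (mdegree H v) \<longleftrightarrow> (v = a) \<noteq> (v = b)" "a \<noteq> b"
  shows "\<exists>w. w \<noteq> [] \<and> hd w = a \<and> last w = b \<and> mset (walk_edges w) \<subseteq># H"
  using assms
proof (induction "size H" arbitrary: H a)
  case 0
  then show ?case by auto
next
  case (Suc n)
  have "mdegree H a \<noteq> 0" using Suc.prems(2)[of a] Suc.prems(3) by (metis even_zero)
  then have "filter_mset (\<lambda>e. a \<in> e) H \<noteq> {#}" by (simp add: mdegree_def)
  then obtain e where "e \<in># filter_mset (\<lambda>e. a \<in> e) H" by (rule multiset_nonemptyE)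
  then have e: "e \<in># H" "a \<in> e" by auto
  then obtain y where y: "e = {a, y}" "a \<noteq> y"
    using Suc.prems(1)[OF e(1)] by (auto simp: card_2_iff insert_commute)
  obtain H' where H': "H = add_mset e H'" using e(1) by (meson mset_add)
  show ?case
  proof (cases "y = b")
    case True
    then show ?thesis using y H' by (intro exI[of _ "[a, b]"]) auto
  next
    case False
    have "odd (mdegree H' v) \<longleftrightarrow> (v = y) \<noteq> (v = b)" for v
      using Suc.prems(2)[of v] Suc.prems(3) y H' False by (auto split: if_splits)
    then obtain w where w: "w \<noteq> []" "hd w = y" "last w = b" "mset (walk_edges w) \<subseteq># H'"
      using Suc.hyps(1)[of H' y] Suc.hyps(2) Suc.prems(1) H' False by auto
    then show ?thesis using y H' by (intro exI[of _ "a # w"]) (cases w; auto)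
  qed
qed

text \<open>Once the edge from \<open>v\<close> to \<open>y\<close> is removed, \<open>y\<close> and
  \<open>v\<close> are the only odd vertices, and a trail leads back.\<close>

lemma ex_closed_trail:
  assumes "\<And>e. e \<in># H \<Longrightarrow> card e = 2" "\<And>v. even (mdegree H v)" "e \<in># H" "v \<in> e"
  shows "\<exists>w. hd w = v \<and> last w = v \<and> length w \<ge> 2 \<and> mset (walk_edges w) \<subseteq># H"
proof -
  obtain y where y: "e = {v, y}" "v \<noteq> y"
    using assms by (auto simp: card_2_iff insert_commute)
  obtain H' where H': "H = add_mset e H'" using assms(3) by (meson mset_add)
  have "odd (mdegree H' u) \<longleftrightarrow> (u = y) \<noteq> (u = v)" for u
    using assms(2)[of u] y H' by (auto split: if_splits)
  then obtain w where w: "w \<noteq> []" "hd w = y" "last w = v" "mset (walk_edges w) \<subseteq># H'"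
    using ex_trail[of H' y v] assms(1) y H' by auto
  then show ?thesis using y H' by (intro exI[of _ "v # w"]) (cases w; auto)
qed

text \<open>A longest trail from \<open>a\<close> to \<open>b\<close> is Eulerian: otherwise a closed trail could be spliced in.\<close>

theorem ex_euler_walk:
  assumes H: "\<And>e. e \<in># H \<Longrightarrow> card e = 2" "\<And>v. odd (mdegree H v) \<longleftrightarrow> (v = a) \<noteq> (v = b)" and "a \<noteq> b"
    and conn: "\<And>e v. e \<in># H \<Longrightarrow> v \<in> e \<Longrightarrow> (a, v) \<in> (adj (set_mset H))\<^sup>*"
  shows "\<exists>w. w \<noteq> [] \<and> hd w = a \<and> last w = b \<and> mset (walk_edges w) = H"
proof -
  define trail where "trail w \<longleftrightarrow> w \<noteq> [] \<and> hd w = a \<and> last w = b \<and> mset (walk_edges w) \<subseteq># H" for w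
  have bound: "length w < size H + 2" if "trail w" for w
    using that size_mset_mono[of "mset (walk_edges w)" H] by (simp add: trail_def length_walk_edges)
  obtain w0 where "trail w0" using ex_trail[OF H \<open>a \<noteq> b\<close>] by (auto simp: trail_def)
  then obtain w where w: "trail w" "\<And>w'. trail w' \<Longrightarrow> length w' \<le> length w"
    using ex_has_greatest_nat[of trail w0 length "size H + 2"] bound by blast
  then have w': "w \<noteq> []" "hd w = a" "last w = b" and sub: "mset (walk_edges w) \<subseteq># H"
    by (auto simp: trail_def)
  define G where "G = H - mset (walk_edges w)"
  have HG: "H = mset (walk_edges w) + G" using sub by (simp add: G_def)
  have "G = {#}"
  proof (rule ccontr)
    assume "G \<noteq> {#}"
    then obtain e where e: "e \<in># G" by blast
    have evenG: "even (mdegree G v)" for v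
      using H(2)[of v] odd_mdegree_walk[OF w'(1), of v] H(1) w' HG by auto
    \<comment> \<open>Otherwise the vertices of \<open>w\<close> could never be left: along a path
      from \<open>a\<close>, every edge that starts on \<open>w\<close> is itself an edge of
      \<open>w\<close>.\<close>
    have "\<exists>e\<in>#G. \<exists>v\<in>e. v \<in> set w"
    proof (rule ccontr)
      assume none: "\<not> ?thesis"
      obtain v where v: "v \<in> e" using H(1)[of e] e HG by fastforce
      have "(a, v) \<in> (adj (set_mset H))\<^sup>*" using conn[of e v] e v HG by simp
      then have "v \<in> set w"
      proof (induction rule: rtrancl_induct)
        case base
        then show ?case using w' by (metis hd_in_set)
      next
        case (step y z)
        then have "{y, z} \<in># H" by (simp add: adj_def)
        moreover have "{y, z} \<notin># G" using none step.IH by blast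
        ultimately have "{y, z} \<in> set (walk_edges w)" using HG by auto
        then have "z \<in> \<Union>(set (walk_edges w))" by blast
        then show ?case by (rule subsetD[OF Union_walk_edges])
      qed
      then show False using none e v by blast
    qed
    then obtain f v where fv: "f \<in># G" "v \<in> f" "v \<in> set w" by blast
    obtain q where q: "hd q = v" "last q = v" "length q \<ge> 2" "mset (walk_edges q) \<subseteq># G"
      using ex_closed_trail[of G f v] H(1) evenG fv HG by auto
    obtain q' where q': "q = v # q'" using q(1,3) by (cases q) auto
    obtain w1 w2 where w12: "w = w1 @ v # w2" using fv(3) by (meson split_list)
    have "q' \<noteq> []" using q(3) q' by auto
    moreover from this have "last q' = v" using q(2) q' by simp
    ultimately have qq: "q = v # butlast q' @ [v]" using q' by (metis append_butlast_last_id)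
    let ?w = "w1 @ q @ w2"
    have "walk_edges ?w = walk_edges (w1 @ [v]) @ walk_edges (v # butlast q' @ v # w2)"
      using walk_edges_append[of w1 v "butlast q' @ v # w2"] qq by simp
    also have "walk_edges (v # butlast q' @ v # w2) = walk_edges q @ walk_edges (v # w2)"
      using walk_edges_append[of "v # butlast q'" v w2] qq by simp
    finally have "mset (walk_edges ?w) = mset (walk_edges w) + mset (walk_edges q)"
      using walk_edges_append[of w1 v w2] w12 by simp
    moreover have "hd ?w = a" using w' w12 q' by (cases w1) auto
    moreover have "q \<noteq> []" using q' by simp
    then have "last ?w = b" using w'(3) w12 q(2) by (cases w2) (simp_all add: last_append)
    ultimately have "trail ?w" using q(4) HG q' by (auto simp: trail_def)
    then show False using w(2)[of ?w] w12 q(3) by auto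
  qed
  then show ?thesis using HG w' by auto
qed

text \<open>The witness keeps the first occurrence of the start and, by \<open>remdups\<close>, the
  last occurrence of every other vertex; so both ends stay in place.\<close>

lemma ex_shortcut:
  assumes "w \<noteq> []" "hd w \<noteq> last w"
  shows "\<exists>Q. shortcut w Q"
proof -
  obtain s w' where w: "w = s # w'" using assms by (cases w) auto
  have w': "w' \<noteq> []" "last w' \<noteq> s" using assms w by auto
  define B where "B = filter (\<lambda>v. v \<noteq> s) w'"
  have "filter (\<lambda>v. v \<noteq> s) w' = filter (\<lambda>v. v \<noteq> s) (butlast w' @ [last w'])"
    using w'(1) by simp
  also have "\<dots> = filter (\<lambda>v. v \<noteq> s) (butlast w') @ [last w']"
    unfolding filter_append using w'(2) by simp
  finally have "B = filter (\<lambda>v. v \<noteq> s) (butlast w') @ [last w']" unfolding B_def .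
  then have B: "B \<noteq> []" "last B = last w'" by auto
  have last_remdups: "last (remdups ys) = last ys" for ys :: "'a list"
    by (induction ys) auto
  have "subseq (remdups ys) ys" for ys :: "'a list"
    by (induction ys) auto
  moreover have "subseq B w'" by (simp add: B_def)
  ultimately have "subseq (remdups B) w'" by (meson subseq_order.order_trans)
  then show ?thesis
    using B w w' last_remdups[of B] by (intro exI[of _ "s # remdups B"]) (auto simp: shortcut_def B_def)
qed

text \<open>Uses distances instead of \<open>edge_cost\<close>: sublists of a walk may have equal
  neighbours, and \<open>edge_cost\<close> says nothing about singletons.\<close>

fun dist_sum :: "('a \<Rightarrow> 'a \<Rightarrow> real) \<Rightarrow> 'a list \<Rightarrow> real" where
  "dist_sum c (u # v # w) = c u v + dist_sum c (v # w)"
| "dist_sum c _ = 0"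

context Metric_space
begin

text \<open>The vertex \<open>a\<close> before the list is fixed, so that dropping the next vertex
  is one use of the triangle inequality.\<close>

lemma dist_sum_subseq:
  assumes "subseq Q w" "a \<in> M" "set w \<subseteq> M"
  shows "dist_sum d (a # Q) \<le> dist_sum d (a # w)"
  using assms
proof (induction w arbitrary: a Q rule: list.induct)
  case (Cons b w)
  have IH: "dist_sum d (x # R) \<le> dist_sum d (x # w)" if "subseq R w" "x \<in> M" for x R
    using Cons.IH that Cons.prems by simp
  show ?case
  proof (cases "\<exists>Q'. Q = b # Q' \<and> subseq Q' w")
    case True
    then show ?thesis using IH[of _ b] Cons.prems by auto
  next
    case False
    then have "subseq Q w" using Cons.prems(1) by (cases Q) (auto split: if_splits)
    then have "dist_sum d (a # Q) \<le> dist_sum d (a # w)" using IH Cons.prems by simp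
    also have "\<dots> \<le> dist_sum d (a # b # w)"
      using Cons.prems triangle[of a b "hd w"] by (cases w) auto
    finally show ?thesis .
  qed
next
  case Nil
  have "Q = []" using Nil.prems(1) by (rule list_emb_Nil2)
  then show ?case by simp
qed

lemma edge_cost_doubleton': "u \<noteq> v \<Longrightarrow> edge_cost d {u, v} = d u v"
  by (intro edge_cost_doubleton commute)

lemma edge_cost_nonneg: "e \<in> edges_of V \<Longrightarrow> 0 \<le> edge_cost d e"
  by (elim edges_ofE) (simp add: edge_cost_doubleton')

lemma path_cost_eq_dist_sum:
  assumes "set (walk_edges w) \<subseteq> edges_of V"
  shows "path_cost d w = dist_sum d w"
  using assms
  by (induction w rule: walk_edges.induct)
    (auto simp: path_cost_def edge_cost_doubleton' doubleton_in_edges_of)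

lemma walk_edges_distinct:
  assumes "distinct w" "set w \<subseteq> V"
  shows "set (walk_edges w) \<subseteq> edges_of V"
  using assms by (induction w rule: walk_edges.induct) (auto simp: doubleton_in_edges_of)

lemma path_cost_shortcut_le:
  assumes "shortcut w Q" "w \<noteq> []" "set w \<subseteq> M" "set (walk_edges w) \<subseteq> edges_of M"
  shows "path_cost d Q \<le> path_cost d w"
proof -
  obtain s w' where w: "w = s # w'" using assms by (cases w) auto
  have Q: "subseq Q w" "distinct Q" "set Q = set w" "hd Q = hd w" using assms by (auto simp: shortcut_def)
  then obtain Q' where "Q = s # Q'" using w by (cases Q) auto
  moreover from this have "subseq Q' w'" using Q(1) w by simp
  ultimately have "dist_sum d Q \<le> dist_sum d w" using dist_sum_subseq w assms(3) by auto
  then show ?thesis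
    using path_cost_eq_dist_sum[OF assms(4)]
      path_cost_eq_dist_sum[OF walk_edges_distinct[OF Q(2), of M]] Q(3) assms(3) by simp
qed

end

section \<open>The linear program and its narrow cuts\<close>

lemma sum_eq_sum_of_bool:
  fixes x :: "'b \<Rightarrow> real"
  assumes "finite E" "A \<subseteq> E"
  shows "sum x A = (\<Sum>e\<in>E. of_bool (e \<in> A) * x e)"
proof -
  have "sum x A = (\<Sum>e\<in>A. of_bool (e \<in> A) * x e)" by (intro sum.cong) auto
  also have "\<dots> = (\<Sum>e\<in>E. of_bool (e \<in> A) * x e)"
    using assms by (intro sum.mono_neutral_left) auto
  finally show ?thesis .
qed

lemma sum_cut_eq:
  fixes x :: "'a set \<Rightarrow> real"
  assumes "finite V" "U \<subseteq> V"
  shows "sum x (cut V U) = (\<Sum>u\<in>U. \<Sum>v\<in>V - U. x {u, v})"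
proof -
  have "bij_betw (\<lambda>(u, v). {u, v}) (U \<times> (V - U)) (cut V U)"
  proof (intro bij_betwI')
    fix p q assume "p \<in> U \<times> (V - U)" "q \<in> U \<times> (V - U)"
    then show "(case p of (u, v) \<Rightarrow> {u, v}) = (case q of (u, v) \<Rightarrow> {u, v}) \<longleftrightarrow> p = q"
      by (auto simp: doubleton_eq_iff)
  next
    fix p assume "p \<in> U \<times> (V - U)"
    then show "(case p of (u, v) \<Rightarrow> {u, v}) \<in> cut V U"
      using assms(2) by (auto simp: doubleton_in_cut)
  next
    fix e assume "e \<in> cut V U"
    then obtain u v where "e = {u, v}" "u \<noteq> v" "u \<in> V" "v \<in> V" "u \<in> U" "v \<notin> U" by (rule cutE)
    then show "\<exists>p\<in>U \<times> (V - U). e = (case p of (u, v) \<Rightarrow> {u, v})" by auto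
  qed
  then have "sum x (cut V U) = (\<Sum>(u, v)\<in>U \<times> (V - U). x {u, v})"
    by (subst sum.reindex_bij_betw[symmetric]) (auto simp: case_prod_unfold)
  then show ?thesis by (simp add: sum.cartesian_product)
qed

section \<open>Existence of an optimum LP solution\<close>

lemma ex_lp_feasible:
  assumes "finite V" "s \<in> V" "t \<in> V" "s \<noteq> t"
  shows "\<exists>x. lp_feasible V s t x"
proof (cases "V = {s, t}")
  case True
  define x :: "'a set \<Rightarrow> real" where "x = (\<lambda>_. 1)"
  have st: "cut V {s} = {{s, t}}" "cut V {t} = {{s, t}}"
    using assms True by (auto elim!: cutE simp: doubleton_in_cut)
  have U: "U = {s}" if "{s} \<subseteq> U" "U \<subseteq> V - {t}" for U using that True by auto
  have "lp_feasible V s t x"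
    unfolding lp_feasible_def
  proof (intro conjI allI ballI impI)
    fix U assume "U \<noteq> {} \<and> U \<subseteq> V - {s, t}"
    then show "2 \<le> sum x (cut V U)" using True by blast
  next
    fix U assume "{s} \<subseteq> U \<and> U \<subseteq> V - {t}"
    then show "1 \<le> sum x (cut V U)" using U[of U] st by (simp add: x_def)
  qed (use True st in \<open>auto simp: x_def\<close>)
  then show ?thesis by blast
next
  case False
  define m where "m = card (V - {s, t})"
  have "V - {s, t} \<noteq> {}" using False assms by blast
  then have m: "m > 0" using assms(1) by (simp only: m_def card_gt_0_iff finite_Diff simp_thms)
  define h :: "'a \<Rightarrow> real" where "h v = of_bool (v \<notin> {s, t})" for v
  \<comment> \<open>The average of all Hamiltonian paths from \<open>s\<close> to \<open>t\<close>:
    value 2/m between two inner vertices, 1/m between an end and an inner vertex, 0 on the edge from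
    \<open>s\<close> to \<open>t\<close>. With no inner vertex the only path is that edge, whence
    the separate case.\<close>
  define x :: "'a set \<Rightarrow> real" where "x e = (\<Sum>v\<in>e. h v) / m" for e
  have x2: "x {u, v} = (h u + h v) / m" if "u \<noteq> v" for u v
    using that by (simp add: x_def)
  have cutx: "sum x (cut V U) = (card (V - U) * card (U - {s, t}) + card U * card (V - U - {s, t})) / m"
    if "U \<subseteq> V" for U
  proof -
    have sumh: "sum h W = card (W - {s, t})" if "finite W" for W
      using that by (simp add: h_def Diff_eq Compl_eq)
    have "sum x (cut V U) = (\<Sum>u\<in>U. \<Sum>v\<in>V - U. (h u + h v) / m)"
      unfolding sum_cut_eq[OF assms(1) that]
      by (intro sum.cong refl x2) auto
    also have "\<dots> = (card (V - U) * sum h U + card U * sum h (V - U)) / m"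
      by (simp add: sum.distrib sum_distrib_left add_divide_distrib sum_divide_distrib)
    finally show ?thesis using sumh assms(1) that finite_subset[OF that assms(1)] by simp
  qed
  have "card V = m + 2"
  proof -
    have "V \<inter> {s, t} = {s, t}" using assms by blast
    then show ?thesis
      using card_Int_Diff[OF assms(1), of "{s, t}"] assms(4) by (simp add: m_def)
  qed
  have inner: "sum x (cut V U) = 2 * real (card U) * (real m + 1 - real (card U)) / m" "card U \<le> m" if "U \<subseteq> V - {s, t}" for U
  proof -
    have UV: "U \<subseteq> V" using that assms(2) by blast
    then have fU: "finite U" using assms(1) by (rule finite_subset)
    show le: "card U \<le> m" unfolding m_def using that assms(1) by (intro card_mono) auto
    have 1: "card (V - U) = m + 2 - card U" using that fU \<open>card V = m + 2\<close>
      by (subst card_Diff_subset) auto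
    have 2: "V - U - {s, t} = (V - {s, t}) - U" "U - {s, t} = U" using that by auto
    have 3: "card (V - {s, t} - U) = m - card U" using that fU
      by (subst card_Diff_subset) (auto simp: m_def)
    show "sum x (cut V U) = 2 * real (card U) * (real m + 1 - real (card U)) / m"
      using cutx[OF UV] le unfolding 1 2 3
      by (simp only: of_nat_add of_nat_mult of_nat_diff trans_le_add1) (simp add: algebra_simps)
  qed
  have outer: "sum x (cut V U) = (2 * real (card (U - {s})) * (real m - real (card (U - {s}))) + m) / m" "card (U - {s}) \<le> m"
    if "{s} \<subseteq> U" "U \<subseteq> V - {t}" for U
  proof -
    have UV: "U \<subseteq> V" using that assms(2) by blast
    then have fU: "finite U" using assms(1) by (rule finite_subset)
    let ?k = "card (U - {s})"
    show le: "?k \<le> m" unfolding m_def using that assms(1) by (intro card_mono) auto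
    have 0: "card U = ?k + 1" using that(1) card_Suc_Diff1[OF fU, of s] by simp
    have 1: "card (V - U) = m + 1 - ?k" using that fU \<open>card V = m + 2\<close> 0
      by (subst card_Diff_subset) auto
    have 2: "V - U - {s, t} = (V - {s, t}) - (U - {s})" "U - {s, t} = U - {s}" using that by auto
    have 3: "card (V - {s, t} - (U - {s})) = m - ?k" using that fU
      by (subst card_Diff_subset) (auto simp: m_def)
    show "sum x (cut V U) = (2 * real ?k * (real m - real ?k) + m) / m"
      using cutx[OF UV] le unfolding 0 1 2 3
      by (simp only: of_nat_add of_nat_mult of_nat_diff trans_le_add1) (simp add: algebra_simps)
  qed
  have "2 \<le> sum x (cut V U)" if U: "U \<noteq> {}" "U \<subseteq> V - {s, t}" for U
  proof -
    have "finite U" using U(2) assms(1) by (meson finite_Diff finite_subset)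
    then have "card U \<noteq> 0" using U(1) by simp
    then have k: "1 \<le> card U" "card U \<le> m" using inner(2)[OF U(2)] by simp_all
    then have "0 \<le> (real (card U) - 1) * (real m - card U)" by simp
    then have "real m \<le> real (card U) * (real m + 1 - real (card U))" by (simp add: algebra_simps)
    then show ?thesis unfolding inner(1)[OF U(2)] using m by (simp add: pos_le_divide_eq algebra_simps)
  qed
  moreover have "1 \<le> sum x (cut V U)" if U: "{s} \<subseteq> U" "U \<subseteq> V - {t}" for U
    unfolding outer(1)[OF U] using m outer(2)[OF U] by (simp add: pos_le_divide_eq)
  moreover have "sum x (cut V {v}) = 2" if "v \<in> V - {s, t}" for v
    using inner[of "{v}"] that m by simp
  moreover have "sum x (cut V {s}) = 1" using outer[of "{s}"] assms m by simp
  moreover have "sum x (cut V {t}) = 1"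
    using cutx[of "{t}"] assms m by (simp add: m_def Diff_insert2[symmetric] insert_commute)
  moreover have "0 \<le> x e" for e by (auto simp: x_def h_def intro!: sum_nonneg divide_nonneg_nonneg)
  ultimately have "lp_feasible V s t x" by (auto simp: lp_feasible_def)
  then show ?thesis by blast
qed

lemma lp_feasible_cong:
  assumes "\<And>e. e \<in> edges_of V \<Longrightarrow> x e = y e"
  shows "lp_feasible V s t x \<longleftrightarrow> lp_feasible V s t y"
proof -
  have "sum x (cut V U) = sum y (cut V U)" for U
    using assms cut_subset[of V U] by (intro sum.cong) auto
  then show ?thesis using assms by (simp add: lp_feasible_def)
qed

lemma lp_feasible_nonneg: "lp_feasible V s t x \<Longrightarrow> e \<in> edges_of V \<Longrightarrow> 0 \<le> x e"
  unfolding lp_feasible_def by blast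

lemma lp_feasible_inner_cut:
  "lp_feasible V s t x \<Longrightarrow> U \<noteq> {} \<Longrightarrow> U \<subseteq> V - {s, t} \<Longrightarrow> 2 \<le> sum x (cut V U)"
  unfolding lp_feasible_def by blast

lemma lp_feasible_separating_cut:
  "lp_feasible V s t x \<Longrightarrow> {s} \<subseteq> U \<Longrightarrow> U \<subseteq> V - {t} \<Longrightarrow> 1 \<le> sum x (cut V U)"
  unfolding lp_feasible_def by blast

text \<open>The degree constraints bound each coordinate; this supplies the box for the compactness
  argument.\<close>

lemma lp_feasible_le_2:
  assumes "finite V" "lp_feasible V s t x" "e \<in> edges_of V"
  shows "x e \<le> 2"
proof -
  obtain u v where uv: "e = {u, v}" "u \<noteq> v" "u \<in> V" "v \<in> V" using assms(3) by (rule edges_ofE)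
  have "0 \<le> x f" if "f \<in> cut V {u}" for f
    using lp_feasible_nonneg[OF assms(2)] that cut_subset by blast
  then have "x e \<le> sum x (cut V {u})"
    using uv finite_cut[OF assms(1)] by (intro member_le_sum) (auto simp: doubleton_in_cut)
  also have "sum x (cut V {u}) = 2 \<or> sum x (cut V {u}) = 1"
    using assms(2) uv(3) unfolding lp_feasible_def by blast
  then have "sum x (cut V {u}) \<le> 2" by auto
  finally show ?thesis .
qed

theorem ex_lp_optimum:
  assumes "finite V" "s \<in> V" "t \<in> V" "s \<noteq> t"
  shows "\<exists>x. lp_optimum V c s t x"
proof -
  define E where "E = edges_of V"
  have finE: "finite E" using assms by (simp add: E_def finite_edges_of)
  define ind :: "'a set \<Rightarrow> 'a set \<Rightarrow> real" where "ind U e = of_bool (e \<in> cut V U)" for U e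
  have ind: "(\<Sum>e\<in>E. ind U e * x e) = sum x (cut V U)" for U x
    unfolding ind_def using sum_eq_sum_of_bool[OF finE, of "cut V U" x] cut_subset[of V U, folded E_def]
    by simp
  \<comment> \<open>Each constraint is a pair of a coefficient vector and a lower bound; every
    degree equation appears as two inequalities of opposite sign.\<close>
  define K :: "(('a set \<Rightarrow> real) \<times> real) set" where "K = (\<lambda>U. (ind U, 2)) ` {U. U \<noteq> {} \<and> U \<subseteq> V - {s, t}} \<union>
    (\<lambda>U. (ind U, 1)) ` {U. {s} \<subseteq> U \<and> U \<subseteq> V - {t}} \<union>
    (\<lambda>v. (ind {v}, 2)) ` (V - {s, t}) \<union> (\<lambda>v. (\<lambda>e. - ind {v} e, - 2)) ` (V - {s, t}) \<union>
    (\<lambda>v. (ind {v}, 1)) ` {s, t} \<union> (\<lambda>v. (\<lambda>e. - ind {v} e, - 1)) ` {s, t}"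
  let ?B = "PiE E (\<lambda>_. {0..2::real})"
  let ?P = "\<lambda>x. \<forall>k\<in>K. snd k \<le> (\<Sum>e\<in>E. fst k e * x e)"
  have KP: "?P x \<longleftrightarrow> lp_feasible V s t x" if "x \<in> ?B" for x
  proof -
    have "\<forall>e\<in>edges_of V. 0 \<le> x e" using that by (auto simp: PiE_iff E_def)
    moreover have neg: "(\<Sum>e\<in>E. - ind U e * x e) = - sum x (cut V U)" for U
      using ind[of U x] by (simp add: sum_negf)
    have "?P x \<longleftrightarrow>
      (\<forall>U. U \<noteq> {} \<and> U \<subseteq> V - {s, t} \<longrightarrow> 2 \<le> sum x (cut V U)) \<and>
      (\<forall>U. {s} \<subseteq> U \<and> U \<subseteq> V - {t} \<longrightarrow> 1 \<le> sum x (cut V U)) \<and>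
      (\<forall>v\<in>V - {s, t}. 2 \<le> sum x (cut V {v})) \<and> (\<forall>v\<in>V - {s, t}. - 2 \<le> - sum x (cut V {v})) \<and>
      (\<forall>v\<in>{s, t}. 1 \<le> sum x (cut V {v})) \<and> (\<forall>v\<in>{s, t}. - 1 \<le> - sum x (cut V {v}))"
      unfolding K_def ball_Un ball_simps fst_conv snd_conv ind neg mem_Collect_eq conj_assoc ..
    moreover have eq: "sum x (cut V {v}) = b \<longleftrightarrow> b \<le> sum x (cut V {v}) \<and> - b \<le> - sum x (cut V {v})" for v b
      by auto
    ultimately show ?thesis
      unfolding lp_feasible_def
      by (simp only: ball_conj_distrib) argo
  qed
  have restrict: "restrict x E \<in> ?B" "lp_feasible V s t (restrict x E)" if "lp_feasible V s t x" for x
  proof -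
    show "lp_feasible V s t (restrict x E)"
      using that lp_feasible_cong[of V "restrict x E" x s t] by (simp add: E_def)
    show "restrict x E \<in> ?B"
      using that lp_feasible_le_2[OF assms(1) that] by (auto simp: E_def lp_feasible_def)
  qed
  obtain x0 where "lp_feasible V s t x0" using ex_lp_feasible[OF assms] by blast
  note x0 = restrict[OF this]
  then have "restrict x0 E \<in> ?B" "?P (restrict x0 E)" unfolding KP[OF x0(1)] by blast+
  from attains_min_on_box[OF finE this, of "edge_cost c"]
  obtain x where x: "x \<in> ?B" "?P x"
    and min: "\<And>y. y \<in> ?B \<Longrightarrow> ?P y \<Longrightarrow> (\<Sum>e\<in>E. edge_cost c e * x e) \<le> (\<Sum>e\<in>E. edge_cost c e * y e)"
    by blast
  have "lp_cost V c x \<le> lp_cost V c y" if "lp_feasible V s t y" for y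
  proof -
    note y = restrict[OF that]
    have "?P (restrict y E)" unfolding KP[OF y(1)] by (rule y(2))
    from min[OF y(1) this] have "lp_cost V c x \<le> lp_cost V c (restrict y E)"
      unfolding lp_cost_def E_def .
    also have "\<dots> = lp_cost V c y" by (simp add: lp_cost_def E_def)
    finally show ?thesis .
  qed
  then have "lp_optimum V c s t x"
    using x KP by (auto simp: lp_optimum_def is_arg_min_def not_less)
  then show ?thesis by blast
qed

section \<open>The chain of narrow cuts and a Hall condition\<close>

lemma sum_cut_posimodular:
  fixes x :: "'a set \<Rightarrow> real"
  assumes "finite V" "\<And>e. e \<in> edges_of V \<Longrightarrow> 0 \<le> x e"
  shows "sum x (cut V (U - W)) + sum x (cut V (W - U)) \<le> sum x (cut V U) + sum x (cut V W)"
proof -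
  note sums = sum_eq_sum_of_bool[OF finite_edges_of[OF assms(1)] cut_subset]
  have "of_bool (e \<in> cut V (U - W)) * x e + of_bool (e \<in> cut V (W - U)) * x e
      \<le> of_bool (e \<in> cut V U) * x e + of_bool (e \<in> cut V W) * x e" if e: "e \<in> edges_of V" for e
    using e assms(2)[OF e] by (elim edges_ofE) (auto simp: doubleton_in_cut)
  then show ?thesis unfolding sums sum.distrib[symmetric] by (rule sum_mono)
qed

text \<open>Both sets contain \<open>s\<close> and omit \<open>t\<close>, so their differences avoid
  both ends. If neither difference were empty, each would have cut value at least 2, contradicting
  posimodularity.\<close>

lemma narrow_chain:
  assumes "finite V" "lp_feasible V s t x"
    and "{s} \<subseteq> U" "U \<subseteq> V - {t}" "sum x (cut V U) < 2"
    and "{s} \<subseteq> W" "W \<subseteq> V - {t}" "sum x (cut V W) < 2"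
  shows "U \<subseteq> W \<or> W \<subseteq> U"
proof (rule ccontr)
  assume "\<not> ?thesis"
  then have "2 \<le> sum x (cut V (U - W))" "2 \<le> sum x (cut V (W - U))"
    using assms by (auto intro!: lp_feasible_inner_cut[OF assms(2)])
  then show False
    using sum_cut_posimodular[where x = x and U = U and W = W, OF assms(1) lp_feasible_nonneg[OF assms(2)]] assms(5,8) by simp
qed

lemma Union_in_finite_chain:
  assumes "finite \<U>" "\<U> \<noteq> {}" "\<And>U W. U \<in> \<U> \<Longrightarrow> W \<in> \<U> \<Longrightarrow> U \<subseteq> W \<or> W \<subseteq> U"
  shows "\<Union>\<U> \<in> \<U>"
  using assms
proof (induction \<U> rule: finite_ne_induct)
  case (insert U \<U>)
  then have "\<Union>\<U> \<in> \<U>" by blast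
  then have "U \<subseteq> \<Union>\<U> \<or> \<Union>\<U> \<subseteq> U" using insert.prems by blast
  then show ?case using \<open>\<Union>\<U> \<in> \<U>\<close> by (auto simp: Un_absorb1 Un_absorb2)
qed simp

text \<open>The summand for the largest set makes the statement inductive along the chain.\<close>

lemma narrow_sets_Union:
  fixes x :: "'a set \<Rightarrow> real"
  assumes V: "finite V" and x: "lp_feasible V s t x"
    and "finite \<U>" "\<U> \<noteq> {}"
    and nar: "\<And>U. U \<in> \<U> \<Longrightarrow> {s} \<subseteq> U \<and> U \<subseteq> V - {t} \<and> sum x (cut V U) < 2"
  shows "2 * real (card \<U>) - 1 + sum x (cut V (\<Union>\<U>)) \<le> 2 * sum x (\<Union>(cut V ` \<U>))"
  using assms(3-)
proof (induction "card \<U>" arbitrary: \<U> rule: less_induct)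
  case less
  have chain: "U \<subseteq> W \<or> W \<subseteq> U" if "U \<in> \<U>" "W \<in> \<U>" for U W
    using less.prems(3)[OF that(1)] less.prems(3)[OF that(2)] by (intro narrow_chain[OF V x]) simp_all
  define W where "W = \<Union>\<U>"
  have W: "W \<in> \<U>" unfolding W_def using less.prems(1,2) chain by (rule Union_in_finite_chain)
  have W1: "1 \<le> sum x (cut V W)" using less.prems(3)[OF W] lp_feasible_separating_cut[OF x] by blast
  show ?case
  proof (cases "\<U> = {W}")
    case True
    then show ?thesis using W1 by simp
  next
    case False
    define \<U>' where "\<U>' = \<U> - {W}"
    define U where "U = \<Union>\<U>'"
    have U': "finite \<U>'" "\<U>' \<noteq> {}" "card \<U> = Suc (card \<U>')" "\<U> = insert W \<U>'"
      using less.prems(1) W False card_Suc_Diff1[OF less.prems(1) W] unfolding \<U>'_def by auto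
    have U: "U \<in> \<U>'" unfolding U_def using U'(1,2) chain
      by (rule Union_in_finite_chain) (auto simp: \<U>'_def)
    then have UW: "U \<subseteq> W" "U \<noteq> W" "U \<in> \<U>" by (auto simp: \<U>'_def W_def)
    have IH: "2 * real (card \<U>') - 1 + sum x (cut V U) \<le> 2 * sum x (\<Union>(cut V ` \<U>'))"
      using less.hyps[of \<U>'] less.prems(3) U' by (auto simp: U_def)
    \<comment> \<open>The layer between the two largest sets of the chain avoids \<open>s\<close>
      and \<open>t\<close>. Its cut value 2 is what one more set adds to the left-hand side.\<close>
    have D: "2 \<le> sum x (cut V (W - U))"
      using less.prems(3)[OF W] less.prems(3)[OF UW(3)] UW(1,2)
      by (intro lp_feasible_inner_cut[OF x]) auto
    have sub: "\<Union>(cut V ` \<A>) \<subseteq> edges_of V" for \<A> using cut_subset by blast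
    note finE = finite_edges_of[OF V]
    note sums = sum_eq_sum_of_bool[OF finE cut_subset] sum_eq_sum_of_bool[OF finE sub]
    let ?A = "\<Union>(cut V ` \<U>)" and ?A' = "\<Union>(cut V ` \<U>')"
    \<comment> \<open>The critical edges leave \<open>W\<close> from the layer \<open>W - U\<close>:
      having no end in \<open>U\<close>, they lie in no smaller cut and are new in the
      union.\<close>
    have "2 * (of_bool (e \<in> ?A') * x e) + of_bool (e \<in> cut V W) * x e + of_bool (e \<in> cut V (W - U)) * x e
       \<le> 2 * (of_bool (e \<in> ?A) * x e) + of_bool (e \<in> cut V U) * x e" if e: "e \<in> edges_of V" for e
    proof -
      obtain u v where uv: "e = {u, v}" "u \<noteq> v" "u \<in> V" "v \<in> V" using e by (rule edges_ofE)
      have A: "e \<in> ?A \<longleftrightarrow> e \<in> ?A' \<or> e \<in> cut V W" using U'(4) by auto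
      have A'1: "e \<in> cut V U \<Longrightarrow> e \<in> ?A'" using U by blast
      have A'2: "e \<in> ?A' \<Longrightarrow> u \<in> U \<or> v \<in> U" using uv by (auto simp: U_def doubleton_in_cut)
      have x0: "0 \<le> x e" using x e by (rule lp_feasible_nonneg)
      have 1: "e \<in> cut V B \<longleftrightarrow> (u \<in> B \<longleftrightarrow> v \<notin> B)" for B using uv by (simp add: doubleton_in_cut)
      show ?thesis using x0 A A'1 A'2 UW(1) unfolding 1
        by (cases "u \<in> U"; cases "v \<in> U"; cases "u \<in> W"; cases "v \<in> W"; cases "e \<in> ?A'") auto
    qed
    then have "2 * sum x ?A' + sum x (cut V W) + sum x (cut V (W - U)) \<le> 2 * sum x ?A + sum x (cut V U)"
      unfolding sums sum_distrib_left sum.distrib[symmetric] by (intro sum_mono) simp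
    then show ?thesis using IH D U'(3) by (simp add: W_def[symmetric])
  qed
qed

text \<open>Hall's condition for assigning LP weight 1 to each narrow cut:
  \<open>narrow_sets_Union\<close> with the remaining summand bounded below by 1, as the largest set
  still separates \<open>s\<close> from \<open>t\<close>.\<close>

lemma narrow_cuts_Union:
  fixes x :: "'a set \<Rightarrow> real"
  assumes V: "finite V" and x: "lp_feasible V s t x" and A: "\<A> \<subseteq> narrow_cuts V s t x"
  shows "card \<A> \<le> sum x (\<Union>\<A>)"
proof (cases "\<A> = {}")
  case False
  have "\<forall>C\<in>\<A>. \<exists>U. C = cut V U \<and> {s} \<subseteq> U \<and> U \<subseteq> V - {t} \<and> sum x (cut V U) < 2"
    using A by (auto simp: narrow_cuts_def)
  then obtain g where g: "\<And>C. C \<in> \<A> \<Longrightarrow> C = cut V (g C)"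
    "\<And>C. C \<in> \<A> \<Longrightarrow> {s} \<subseteq> g C \<and> g C \<subseteq> V - {t} \<and> sum x (cut V (g C)) < 2" by metis
  have inj: "inj_on g \<A>" by (intro inj_onI) (metis g(1))
  have fin: "finite (g ` \<A>)" by (rule finite_subset[of _ "Pow V"]) (use g(2) V in auto)
  have chain: "U \<subseteq> W \<or> W \<subseteq> U" if UW: "U \<in> g ` \<A>" "W \<in> g ` \<A>" for U W
  proof -
    obtain C D where "C \<in> \<A>" "U = g C" "D \<in> \<A>" "W = g D" using UW by blast
    then show ?thesis using g(2)[of C] g(2)[of D] by (intro narrow_chain[OF V x]) simp_all
  qed
  have "\<Union>(g ` \<A>) \<in> g ` \<A>" using Union_in_finite_chain[OF fin] False chain by blast
  then obtain D where D: "D \<in> \<A>" "\<Union>(g ` \<A>) = g D" by blast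
  have "1 \<le> sum x (cut V (\<Union>(g ` \<A>)))"
    unfolding D(2) using g(2)[OF D(1)] by (intro lp_feasible_separating_cut[OF x]) simp_all
  moreover have "cut V ` g ` \<A> = (\<lambda>C. C) ` \<A>"
    unfolding image_image by (intro image_cong refl g(1)[symmetric])
  then have "sum x (\<Union>(cut V ` g ` \<A>)) = sum x (\<Union>\<A>)" by (simp only: image_ident)
  moreover have "2 * real (card (g ` \<A>)) - 1 + sum x (cut V (\<Union>(g ` \<A>))) \<le> 2 * sum x (\<Union>(cut V ` g ` \<A>))"
  proof (rule narrow_sets_Union[OF V x fin])
    fix U assume "U \<in> g ` \<A>"
    then obtain C where C: "C \<in> \<A>" "U = g C" by blast
    show "{s} \<subseteq> U \<and> U \<subseteq> V - {t} \<and> sum x (cut V U) < 2" unfolding C(2) by (rule g(2)[OF C(1)])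
  qed (use False in simp)
  moreover have "card (g ` \<A>) = card \<A>" by (rule card_image[OF inj])
  ultimately show ?thesis by linarith
qed simp

text \<open>A layer-cake argument: subtracting the least weight \<open>w D\<close> from all sets
  costs \<open>card\<close> many copies on the left and \<open>sum x\<close> of the union many on
  the right, which Hall's condition compares. \<open>D\<close> then has weight 0 and drops
  out.\<close>

lemma weighted_Hall:
  fixes x m :: "'e \<Rightarrow> real" and w :: "'e set \<Rightarrow> real"
  assumes "finite E" "finite \<A>"
    and "\<And>C. C \<in> \<A> \<Longrightarrow> C \<subseteq> E"
    and "\<And>\<B>. \<B> \<subseteq> \<A> \<Longrightarrow> card \<B> \<le> sum x (\<Union>\<B>)"
    and "\<And>e. e \<in> E \<Longrightarrow> 0 \<le> x e" "\<And>e. e \<in> E \<Longrightarrow> 0 \<le> m e"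
    and "\<And>C. C \<in> \<A> \<Longrightarrow> 0 \<le> w C"
    and "\<And>C e. C \<in> \<A> \<Longrightarrow> e \<in> C \<Longrightarrow> w C \<le> m e"
  shows "sum w \<A> \<le> (\<Sum>e\<in>E. x e * m e)"
  using assms(2-)
proof (induction "card \<A>" arbitrary: \<A> m w rule: less_induct)
  case less
  show ?case
  proof (cases "\<A> = {}")
    case True
    then show ?thesis using less.prems by (auto intro!: sum_nonneg)
  next
    case False
    obtain D where D: "D \<in> \<A>" "\<And>C. C \<in> \<A> \<Longrightarrow> w D \<le> w C"
      using ex_minimizer[OF less.prems(1) False, of w] by blast
    define m' where "m' e = m e - w D * of_bool (e \<in> \<Union>\<A>)" for e
    have m'0: "0 \<le> m' e" if e: "e \<in> E" for e
    proof (cases "e \<in> \<Union>\<A>")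
      case True
      then obtain C where "C \<in> \<A>" "e \<in> C" by blast
      then show ?thesis using D(2)[of C] less.prems(7)[of C e] True by (simp add: m'_def)
    next
      case False
      then show ?thesis using less.prems(5)[OF e] by (simp add: m'_def)
    qed
    have "sum (\<lambda>C. w C - w D) (\<A> - {D}) \<le> (\<Sum>e\<in>E. x e * m' e)"
    proof (rule less.hyps)
      show "card (\<A> - {D}) < card \<A>" using less.prems(1) D(1) by (metis card_Diff1_less)
      fix \<B> assume "\<B> \<subseteq> \<A> - {D}"
      then show "card \<B> \<le> sum x (\<Union>\<B>)" by (intro less.prems(3)) blast
    qed (use less.prems(1,2,4-) D m'0 in \<open>auto simp: m'_def\<close>)
    moreover have "sum (\<lambda>C. w C - w D) (\<A> - {D}) = sum w \<A> - card \<A> * w D"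
      using sum.remove[OF less.prems(1) D(1), of "\<lambda>C. w C - w D"] by (simp add: sum_subtractf)
    moreover have "(\<Sum>e\<in>E. x e * m' e) = (\<Sum>e\<in>E. x e * m e) - w D * sum x (\<Union>\<A>)"
    proof -
      have "\<Union>\<A> \<subseteq> E" using less.prems(2) by blast
      then show ?thesis
        using sum_eq_sum_of_bool[OF assms(1), of "\<Union>\<A>" x]
        by (simp add: m'_def algebra_simps sum_subtractf sum_distrib_left)
    qed
    moreover have "w D * card \<A> \<le> w D * sum x (\<Union>\<A>)"
      using less.prems(3)[of \<A>] less.prems(6)[OF D(1)] by (intro mult_left_mono) auto
    ultimately show ?thesis by (simp add: mult.commute)
  qed
qed

section \<open>The choice of the weights\<close>

lemma ln_one_plus_ge_quadratic:
  fixes x :: real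
  assumes "0 \<le> x"
  shows "x - x\<^sup>2 / 2 \<le> ln (1 + x)"
proof -
  have "ln (1 + 0) - (0 - 0\<^sup>2 / 2) \<le> ln (1 + x) - (x - x\<^sup>2 / 2)"
  proof (rule DERIV_nonneg_imp_nondecreasing[OF assms])
    fix y :: real assume y: "0 \<le> y" "y \<le> x"
    have "((\<lambda>y. ln (1 + y) - (y - y\<^sup>2 / 2)) has_real_derivative (1 / (1 + y) - (1 - y))) (at y)"
      using y by (auto intro!: derivative_eq_intros simp: divide_simps) algebra
    moreover have "1 / (1 + y) - (1 - y) = y\<^sup>2 / (1 + y)"
      using y by (simp add: field_simps power2_eq_square)
    ultimately have "((\<lambda>y. ln (1 + y) - (y - y\<^sup>2 / 2)) has_real_derivative y\<^sup>2 / (1 + y)) (at y)"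
      by (simp only:)
    then show "\<exists>d. ((\<lambda>y. ln (1 + y) - (y - y\<^sup>2 / 2)) has_real_derivative d) (at y) \<and> 0 \<le> d"
      using y by (intro exI[of _ "y\<^sup>2 / (1 + y)"]) simp
  qed
  then show ?thesis by simp
qed

lemma ln_one_plus_le_cubic:
  fixes x :: real
  assumes "0 \<le> x"
  shows "ln (1 + x) \<le> x - x\<^sup>2 / 2 + x ^ 3 / 3"
proof -
  have "(0 - 0\<^sup>2 / 2 + 0 ^ 3 / 3) - ln (1 + 0) \<le> (x - x\<^sup>2 / 2 + x ^ 3 / 3) - ln (1 + x)"
  proof (rule DERIV_nonneg_imp_nondecreasing[OF assms])
    fix y :: real assume y: "0 \<le> y" "y \<le> x"
    have "((\<lambda>y. (y - y\<^sup>2 / 2 + y ^ 3 / 3) - ln (1 + y)) has_real_derivative (1 - y + y\<^sup>2 - 1 / (1 + y))) (at y)"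
      using y by (auto intro!: derivative_eq_intros simp: divide_simps) algebra
    moreover have "1 - y + y\<^sup>2 - 1 / (1 + y) = y ^ 3 / (1 + y)"
      using y by (simp add: field_simps power2_eq_square power3_eq_cube)
    ultimately have "((\<lambda>y. (y - y\<^sup>2 / 2 + y ^ 3 / 3) - ln (1 + y)) has_real_derivative y ^ 3 / (1 + y)) (at y)"
      by (simp only:)
    then show "\<exists>d. ((\<lambda>y. (y - y\<^sup>2 / 2 + y ^ 3 / 3) - ln (1 + y)) has_real_derivative d) (at y) \<and> 0 \<le> d"
      using y by (intro exI[of _ "y ^ 3 / (1 + y)"]) simp
  qed
  then show ?thesis by simp
qed

text \<open>An antiderivative in \<open>y\<close> of 4 (1 + \<tau>) / (4 + y) - 1, the density of
  the deficit at a cut of value 2 - \<tau>. It rises until y = 4 \<tau> and falls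
  afterwards.\<close>

definition gain :: "real \<Rightarrow> real \<Rightarrow> real" where
  "gain \<tau> y = 4 * (1 + \<tau>) * ln (4 + y) - y"

text \<open>Both sides agree to second order in \<tau>, with coefficient 9/8. So for small \<tau>
  the cubic terms decide, and the logarithms must be expanded that far; beyond 1/4 the interval is
  cut off at 1.\<close>

lemma gain_le:
  assumes "0 \<le> \<tau>" "\<tau> \<le> 1"
  shows "gain \<tau> (min 1 (4 * \<tau>)) - gain \<tau> \<tau> \<le> \<tau> - (1 - \<tau>) * (4 * ln (4 + \<tau>) - 4 * ln 4)"
proof -
  have l4: "ln (4 + y) = ln 4 + ln (1 + y / 4)" if "0 \<le> y" for y :: real
  proof -
    have "4 + y = 4 * (1 + y / 4)" by simp
    then show ?thesis using ln_mult[of 4 "1 + y / 4"] that by (simp only:) simp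
  qed
  have q: "\<tau> / 4 - (\<tau> / 4)\<^sup>2 / 2 \<le> ln (1 + \<tau> / 4)" using assms by (intro ln_one_plus_ge_quadratic) simp
  then have q': "2 * \<tau> * (\<tau> / 4 - (\<tau> / 4)\<^sup>2 / 2) \<le> 2 * \<tau> * ln (1 + \<tau> / 4)"
    using assms by (intro mult_left_mono) auto
  show ?thesis
  proof (cases "4 * \<tau> \<le> 1")
    case True
    have "(1 + \<tau>) * ln (1 + \<tau>) \<le> (1 + \<tau>) * (\<tau> - \<tau>\<^sup>2 / 2 + \<tau> ^ 3 / 3)"
      using assms by (intro mult_left_mono ln_one_plus_le_cubic) auto
    moreover have "(1 + \<tau>) * (\<tau> - \<tau>\<^sup>2 / 2 + \<tau> ^ 3 / 3) - 2 * \<tau> * (\<tau> / 4 - (\<tau> / 4)\<^sup>2 / 2)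
        = \<tau> - \<tau> ^ 3 * (5 / 48 - \<tau> / 3)"
      by (simp add: field_simps power2_eq_square power3_eq_cube)
    moreover have "0 \<le> \<tau> ^ 3 * (5 / 48 - \<tau> / 3)" using assms True by (intro mult_nonneg_nonneg) auto
    ultimately have "(1 + \<tau>) * ln (1 + \<tau>) - 2 * \<tau> * ln (1 + \<tau> / 4) \<le> \<tau>" using q' by linarith
    then show ?thesis using True assms l4[of \<tau>] l4[of "4 * \<tau>"]
      by (simp add: gain_def min_def algebra_simps)
  next
    case False
    \<comment> \<open>Shifted to the border of the two cases, the polynomial has constant term 1/4 -
      1/3072, and its only positive nonconstant term is dominated by the quadratic one as t \<le>
      3/4.\<close>
    define t where "t = \<tau> - 1 / 4"
    have t: "0 \<le> t" "t \<le> 3 / 4" "\<tau> = t + 1 / 4" using False assms by (auto simp: t_def)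
    have "ln (5 / 4) \<le> (43 / 192 :: real)"
      using ln_one_plus_le_cubic[of "1 / 4"] by (simp add: power2_eq_square power3_eq_cube)
    then have "(1 + \<tau>) * ln (5 / 4) \<le> (1 + \<tau>) * (43 / 192)" using assms by (intro mult_left_mono) auto
    moreover have "(1 + \<tau>) * (43 / 192) - 2 * \<tau> * (\<tau> / 4 - (\<tau> / 4)\<^sup>2 / 2) \<le> 1 / 4"
    proof -
      have "t * t\<^sup>2 \<le> 3 / 4 * t\<^sup>2" using t by (intro mult_right_mono) auto
      then have "t ^ 3 \<le> 3 / 4 * t\<^sup>2" by (simp add: power3_eq_cube power2_eq_square mult.assoc)
      moreover have "0 \<le> t\<^sup>2" by simp
      ultimately have le: "767 / 3072 - 11 / 768 * t - 29 / 64 * t\<^sup>2 + 1 / 16 * t ^ 3 \<le> 1 / 4"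
        using t(1) by linarith
      have "(1 + \<tau>) * (43 / 192) - 2 * \<tau> * (\<tau> / 4 - (\<tau> / 4)\<^sup>2 / 2)
          = 767 / 3072 - 11 / 768 * t - 29 / 64 * t\<^sup>2 + 1 / 16 * t ^ 3"
        unfolding t(3) by (simp add: field_simps power2_eq_square power3_eq_cube)
      with le show ?thesis by (simp only:)
    qed
    ultimately have "(1 + \<tau>) * ln (5 / 4) - 2 * \<tau> * ln (1 + \<tau> / 4) \<le> 1 / 4" using q' by linarith
    then show ?thesis using False assms l4[of \<tau>] l4[of 1]
      by (simp add: gain_def min_def algebra_simps)
  qed
qed

text \<open>Only the part of a step below 4 \<tau> contributes a positive increment. Clipping the
  arguments there gives a bound that telescopes, whatever the positions of the partial sums.\<close>

lemma gain_step:
  assumes "0 \<le> \<tau>" "0 \<le> a" "a \<le> b"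
  shows "max 0 (gain \<tau> b - gain \<tau> a) \<le> gain \<tau> (min b (4 * \<tau>)) - gain \<tau> (min a (4 * \<tau>))"
proof -
  have ln_diff: "(y - x) / (4 + y) \<le> ln (4 + y) - ln (4 + x)" "ln (4 + y) - ln (4 + x) \<le> (y - x) / (4 + x)"
    if "0 \<le> x" "x \<le> y" for x y :: real
  proof -
    have "ln ((4 + x) / (4 + y)) \<le> (4 + x) / (4 + y) - 1" using that by (intro ln_le_minus_one) auto
    then show "(y - x) / (4 + y) \<le> ln (4 + y) - ln (4 + x)" using that by (simp add: ln_div field_simps)
    have "ln ((4 + y) / (4 + x)) \<le> (4 + y) / (4 + x) - 1" using that by (intro ln_le_minus_one) auto
    then show "ln (4 + y) - ln (4 + x) \<le> (y - x) / (4 + x)" using that by (simp add: ln_div field_simps)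
  qed
  have inc: "gain \<tau> x \<le> gain \<tau> y" if "0 \<le> x" "x \<le> y" "y \<le> 4 * \<tau>" for x y
  proof -
    have "y - x = 4 * (1 + \<tau>) * ((y - x) / (4 * (1 + \<tau>)))" using assms(1) by simp
    also have "\<dots> \<le> 4 * (1 + \<tau>) * ((y - x) / (4 + y))"
      using that assms(1) by (intro mult_left_mono divide_left_mono) auto
    also have "\<dots> \<le> 4 * (1 + \<tau>) * (ln (4 + y) - ln (4 + x))"
      using that assms(1) ln_diff(1)[OF that(1,2)] by (intro mult_left_mono) auto
    finally show ?thesis by (simp add: gain_def algebra_simps)
  qed
  have dec: "gain \<tau> y \<le> gain \<tau> x" if "4 * \<tau> \<le> x" "x \<le> y" for x y
  proof -
    have "0 \<le> x" using that assms(1) by simp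
    have "4 * (1 + \<tau>) * (ln (4 + y) - ln (4 + x)) \<le> 4 * (1 + \<tau>) * ((y - x) / (4 + x))"
      using that assms(1) ln_diff(2)[OF \<open>0 \<le> x\<close> that(2)] by (intro mult_left_mono) auto
    also have "\<dots> \<le> 4 * (1 + \<tau>) * ((y - x) / (4 * (1 + \<tau>)))"
      using that assms(1) by (intro mult_left_mono divide_left_mono) auto
    also have "\<dots> = y - x" using assms(1) by simp
    finally show ?thesis by (simp add: gain_def algebra_simps)
  qed
  consider "b \<le> 4 * \<tau>" | "a \<le> 4 * \<tau>" "4 * \<tau> \<le> b" | "4 * \<tau> \<le> a" by linarith
  then show ?thesis
  proof cases
    case 1
    then show ?thesis using inc[of a b] assms by simp
  next
    case 2
    then show ?thesis using inc[of a "4 * \<tau>"] dec[of "4 * \<tau>" b] assms by simp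
  next
    case 3
    then show ?thesis using dec[of a b] assms by simp
  qed
qed

locale tree_weights =
  fixes k :: nat and p :: "nat \<Rightarrow> real"
  assumes p_nonneg: "\<And>j. j \<in> {1..k} \<Longrightarrow> 0 \<le> p j" and p_sum: "(\<Sum>j=1..k. p j) = 1"
begin

definition \<sigma> :: "nat \<Rightarrow> real" where "\<sigma> j = (\<Sum>i=1..j. p i)"

definition \<phi> :: "nat \<Rightarrow> real" where "\<phi> j = 4 * ln (4 + \<sigma> j) - 4 * ln (4 + \<sigma> (j - 1))"

lemma \<sigma>_0 [simp]: "\<sigma> 0 = 0" by (simp add: \<sigma>_def)

lemma \<sigma>_Suc: "\<sigma> (Suc j) = \<sigma> j + p (Suc j)" by (simp add: \<sigma>_def)

lemma \<sigma>_step: "1 \<le> j \<Longrightarrow> \<sigma> j = \<sigma> (j - 1) + p j"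
  using \<sigma>_Suc[of "j - 1"] by simp

lemma \<sigma>_mono:
  assumes "i \<le> j" "j \<le> k"
  shows "\<sigma> i \<le> \<sigma> j"
  unfolding \<sigma>_def using assms p_nonneg by (intro sum_mono2) auto

lemma \<sigma>_nonneg: "j \<le> k \<Longrightarrow> 0 \<le> \<sigma> j"
  using \<sigma>_mono[of 0 j] by simp

lemma \<sigma>_k: "\<sigma> k = 1"
  using p_sum by (simp add: \<sigma>_def)

text \<open>The density 4 / (4 + \<sigma>) lies between 0 and 1. The upper bound keeps the
  coefficient p - \<phi> of the forest in the fractional join nonnegative.\<close>

lemma \<phi>_bounds:
  assumes "j \<in> {1..k}"
  shows "0 \<le> \<phi> j" "\<phi> j \<le> p j"
proof -
  let ?a = "\<sigma> (j - 1)"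
  have j: "1 \<le> j" "j \<le> k" "j - 1 \<le> k" using assms by auto
  have a: "0 \<le> ?a" using j by (intro \<sigma>_nonneg) auto
  have b: "\<sigma> j = ?a + p j" "0 \<le> p j" using \<sigma>_step j p_nonneg assms by auto
  show "0 \<le> \<phi> j" using a b by (simp add: \<phi>_def)
  have "ln ((4 + (?a + p j)) / (4 + ?a)) \<le> (4 + (?a + p j)) / (4 + ?a) - 1"
    using a b by (intro ln_le_minus_one) auto
  also have "\<dots> = p j / (4 + ?a)" using a by (simp add: field_simps)
  also have "\<dots> \<le> p j / 4" using a b by (intro divide_left_mono) auto
  finally show "\<phi> j \<le> p j" using a b by (simp add: \<phi>_def ln_div)
qed

lemma sum_\<phi>:
  assumes "r \<le> k"
  shows "(\<Sum>j=1..r. \<phi> j) = 4 * ln (4 + \<sigma> r) - 4 * ln 4"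
  by (induction r) (simp_all add: \<phi>_def)

lemma sum_\<phi>_k: "(\<Sum>j=1..k. \<phi> j) = 4 * ln (5 / 4)"
  using sum_\<phi>[of k] by (simp add: \<sigma>_k ln_div)

text \<open>The clipped increments telescope up to \<sigma> = 1, leaving the inequality between
  logarithms at \<tau> = \<open>\<sigma> r\<close>.\<close>

lemma deficit_le_surplus:
  assumes "r \<le> k"
  shows "(\<Sum>j=r+1..k. max 0 ((1 + \<sigma> r) * \<phi> j - p j)) \<le> \<sigma> r - (1 - \<sigma> r) * (\<Sum>j=1..r. \<phi> j)"
proof -
  let ?\<tau> = "\<sigma> r"
  have \<tau>: "0 \<le> ?\<tau>" "?\<tau> \<le> 1" using \<sigma>_nonneg \<sigma>_mono[of r k] \<sigma>_k assms by auto
  have "(\<Sum>j=r+1..m. max 0 ((1 + ?\<tau>) * \<phi> j - p j)) \<le> gain ?\<tau> (min (\<sigma> m) (4 * ?\<tau>)) - gain ?\<tau> (min ?\<tau> (4 * ?\<tau>))"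
    if "r \<le> m" "m \<le> k" for m
    using that
  proof (induction m rule: dec_induct)
    case (step m)
    have "(1 + ?\<tau>) * \<phi> (Suc m) - p (Suc m) = gain ?\<tau> (\<sigma> (Suc m)) - gain ?\<tau> (\<sigma> m)"
      by (simp add: gain_def \<phi>_def \<sigma>_Suc algebra_simps)
    moreover have "max 0 (gain ?\<tau> (\<sigma> (Suc m)) - gain ?\<tau> (\<sigma> m))
        \<le> gain ?\<tau> (min (\<sigma> (Suc m)) (4 * ?\<tau>)) - gain ?\<tau> (min (\<sigma> m) (4 * ?\<tau>))"
      using \<tau> step \<sigma>_nonneg[of m] \<sigma>_mono[of m "Suc m"] by (intro gain_step) auto
    moreover have "(\<Sum>j=r+1..Suc m. max 0 ((1 + ?\<tau>) * \<phi> j - p j)) =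
        (\<Sum>j=r+1..m. max 0 ((1 + ?\<tau>) * \<phi> j - p j)) + max 0 ((1 + ?\<tau>) * \<phi> (Suc m) - p (Suc m))"
      using step.hyps by simp
    moreover have "(\<Sum>j=r+1..m. max 0 ((1 + ?\<tau>) * \<phi> j - p j)) \<le> gain ?\<tau> (min (\<sigma> m) (4 * ?\<tau>)) - gain ?\<tau> (min ?\<tau> (4 * ?\<tau>))"
      using step by simp
    ultimately show ?case by linarith
  qed simp
  from this[OF assms order_refl] gain_le[OF \<tau>] show ?thesis
    using sum_\<phi>[OF assms] \<tau> by (simp add: \<sigma>_k min_def)
qed

end

section \<open>One iteration of the algorithm\<close>

lemma ex_is_arg_min_finite:
  fixes f :: "'b \<Rightarrow> real"
  assumes "finite {x. P x}" "P a"
  shows "\<exists>x. is_arg_min f P x"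
proof -
  obtain x where "x \<in> {x. P x}" "\<forall>y\<in>{x. P x}. f x \<le> f y"
    using ex_minimizer[OF assms(1), of f] assms(2) by blast
  then have "is_arg_min f P x" by (auto simp: is_arg_min_def not_less)
  then show ?thesis by blast
qed

lemma finite_T_joins: "finite V \<Longrightarrow> finite {J. T_join V T J}"
  by (rule finite_subset[of _ "Pow (edges_of V)"]) (auto simp: T_join_def finite_edges_of)

lemma odd_mdegree_mset_set:
  assumes "finite V" "A \<subseteq> edges_of V"
  shows "odd (mdegree (mset_set A) v) \<longleftrightarrow> v \<in> odd_vertices V A"
proof -
  have fin: "finite A" by (rule finite_subset[OF assms(2) finite_edges_of[OF assms(1)]])
  have "{e \<in> A. v \<in> e} = (if v \<in> V then A \<inter> cut V {v} else {})"
  proof -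
    have "v \<in> e \<longleftrightarrow> v \<in> V \<and> e \<in> cut V {v}" if "e \<in> A" for e
    proof -
      have "e \<in> edges_of V" using that assms(2) by blast
      then obtain a b where "e = {a, b}" "a \<noteq> b" "a \<in> V" "b \<in> V" by (rule edges_ofE)
      then show ?thesis by (auto simp: doubleton_in_cut)
    qed
    then show ?thesis by auto
  qed
  moreover have "mdegree (mset_set A) v = card {e \<in> A. v \<in> e}"
    using fin by (simp add: mdegree_def filter_mset_mset_set)
  ultimately show ?thesis by (simp add: odd_vertices_def)
qed

locale decomposed_lp = Metric_space V c for V :: "'a set" and c +
  fixes s t :: 'a and x :: "'a set \<Rightarrow> real" and k :: nat and p :: "nat \<Rightarrow> real"
    and S :: "nat \<Rightarrow> 'a set set"
  assumes finite_V: "finite V" and s_in: "s \<in> V" and t_in: "t \<in> V" and s_neq_t: "s \<noteq> t"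
    and feasible: "lp_feasible V s t x"
    and decomposition: "tree_decomposition V s t x k p S"
begin

sublocale tree_weights k p
  using decomposition by unfold_locales (auto simp: tree_decomposition_def)

abbreviation "E \<equiv> edges_of V"
abbreviation "N \<equiv> narrow_cuts V s t x"
abbreviation "L \<equiv> lonely_cuts V s t x p S"
abbreviation "F \<equiv> forest V s t x p S"
abbreviation "T \<equiv> parity_set V s t x p S"
abbreviation "ec \<equiv> edge_cost c"
abbreviation "jc \<equiv> join_cost V c s t x p S"

definition lone :: "nat \<Rightarrow> 'a set set \<Rightarrow> 'a set" where "lone j C = the_elem (C \<inter> S j)"

lemma finite_E: "finite E" by (rule finite_edges_of[OF finite_V])

lemma ec_nonneg: "e \<in> E \<Longrightarrow> 0 \<le> ec e"
  by (rule edge_cost_nonneg)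

lemma tree:
  assumes "j \<in> {1..k}"
  shows "S j \<subseteq> E" "graph_connected V (S j)"
proof -
  have "spanning_tree V (S j)" using decomposition assms unfolding tree_decomposition_def by blast
  then show "S j \<subseteq> E" "graph_connected V (S j)" unfolding spanning_tree_def by blast+
qed

lemma narrowE:
  assumes "C \<in> N"
  obtains U where "C = cut V U" "s \<in> U" "t \<notin> U" "U \<subseteq> V" "1 \<le> sum x C" "sum x C < 2"
proof -
  obtain U where U: "C = cut V U" "{s} \<subseteq> U" "U \<subseteq> V - {t}" "sum x (cut V U) < 2"
    using assms unfolding narrow_cuts_def by blast
  then have "1 \<le> sum x (cut V U)" by (intro lp_feasible_separating_cut[OF feasible])
  then show thesis using U by (intro that[of U]) auto
qed

lemma narrow_subset: "C \<in> N \<Longrightarrow> C \<subseteq> E"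
  by (elim narrowE) (simp add: cut_subset)

lemma finite_N: "finite N"
  by (rule finite_subset[of _ "Pow E"]) (use narrow_subset finite_E in auto)

lemma lonely_iff: "lonely V s t x p S j e C \<longleftrightarrow> C \<in> N \<and> {e} = C \<inter> S j \<and> \<sigma> j \<le> 2 - sum x C"
  by (simp add: lonely_def \<sigma>_def)

lemma L_iff: "C \<in> L j \<longleftrightarrow> C \<in> N \<and> card (C \<inter> S j) = 1 \<and> \<sigma> j \<le> 2 - sum x C"
  unfolding lonely_cuts_def mem_Collect_eq lonely_iff One_nat_def card_1_singleton_iff by blast

lemma L_subset_N: "L j \<subseteq> N"
  by (auto simp: L_iff)

lemma finite_L: "finite (L j)"
  by (rule finite_subset[OF L_subset_N finite_N])

lemma lone: "C \<in> L j \<Longrightarrow> C \<inter> S j = {lone j C}"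
  unfolding L_iff lone_def by (metis card_1_singletonE the_elem_eq)

lemma lone_in: "C \<in> L j \<Longrightarrow> lone j C \<in> C" "C \<in> L j \<Longrightarrow> lone j C \<in> S j"
  using lone by blast+

lemma narrow_cut_eq:
  assumes "j \<in> {1..k}" "C \<in> N" "D \<in> N" "C \<inter> S j = D \<inter> S j"
  shows "C = D"
proof -
  obtain U where U: "C = cut V U" "s \<in> U" "t \<notin> U" "U \<subseteq> V" using assms(2) by (rule narrowE)
  obtain W where W: "D = cut V W" "s \<in> W" "t \<notin> W" "W \<subseteq> V" using assms(3) by (rule narrowE)
  show ?thesis
    using cut_eq_if_same_tree_edges[OF tree(2,1)[OF assms(1)] U(4) W(4)] assms(4) U(1) W(1) by simp
qed

text \<open>\<open>D\<close> has just one edge in \<open>S j\<close>, so \<open>C\<close> and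
  \<open>D\<close> meet the tree in the same edge, and a cut is determined by its tree edges. Hence
  a lonely edge crosses no lonely cut of its tree except its own.\<close>

lemma lone_eqD:
  assumes "j \<in> {1..k}" "C \<in> L j" "D \<in> L j" "lone j C \<in> D"
  shows "C = D"
proof (rule narrow_cut_eq[OF assms(1)])
  have "lone j C \<in> D \<inter> S j" using assms(4) lone_in(2)[OF assms(2)] by simp
  then show "C \<inter> S j = D \<inter> S j" using lone[OF assms(2)] lone[OF assms(3)] by simp
qed (use assms(2,3) in \<open>simp_all add: L_iff\<close>)

lemma inj_on_lone: "j \<in> {1..k} \<Longrightarrow> inj_on (lone j) (L j)"
  by (rule inj_onI) (metis lone_eqD lone_in(1))

lemma forest_eq: "F j = S j - lone j ` L j"
proof -
  have "(\<exists>C. lonely V s t x p S j e C) \<longleftrightarrow> e \<in> lone j ` L j" for e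
  proof
    assume "\<exists>C. lonely V s t x p S j e C"
    then obtain C where C: "lonely V s t x p S j e C" ..
    then have "C \<in> L j" by (auto simp: lonely_cuts_def)
    moreover have "e = lone j C" using lone[OF calculation] C by (auto simp: lonely_iff)
    ultimately show "e \<in> lone j ` L j" by blast
  next
    assume "e \<in> lone j ` L j"
    then obtain C where C: "C \<in> L j" "e = lone j C" by blast
    then have "lonely V s t x p S j e C" using lone[OF C(1)] by (auto simp: lonely_iff L_iff)
    then show "\<exists>C. lonely V s t x p S j e C" ..
  qed
  then show ?thesis unfolding forest_def by simp
qed

lemma forest_subset: "F j \<subseteq> S j"
  by (auto simp: forest_eq)

lemma forest_Int_lonely_cut: "C \<in> L j \<Longrightarrow> F j \<inter> C = {}"
  unfolding forest_eq using lone by blast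

lemma finite_S: "j \<in> {1..k} \<Longrightarrow> finite (S j)"
  by (rule finite_subset[OF tree(1) finite_E])

lemma sum_tree_split:
  fixes h :: "'a set \<Rightarrow> real"
  assumes "j \<in> {1..k}"
  shows "sum h (S j) = sum h (F j) + (\<Sum>C\<in>L j. h (lone j C))"
proof -
  have sub: "lone j ` L j \<subseteq> S j" using lone_in(2) by blast
  have "sum h (S j) = sum h (S j - lone j ` L j) + sum h (lone j ` L j)"
    by (rule sum.subset_diff[OF sub finite_S[OF assms]])
  also have "sum h (lone j ` L j) = (\<Sum>C\<in>L j. h (lone j C))"
    by (subst sum.reindex[OF inj_on_lone[OF assms]]) simp
  finally show ?thesis by (simp add: forest_eq)
qed

section \<open>The costs of the join\<close>

definition peak :: "nat \<Rightarrow> 'a set \<Rightarrow> real" where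
  "peak j e = Max (insert 0 ((\<lambda>C. 2 * ec (lone j C)) ` {C \<in> L j. e \<in> C}))"

lemma join_cost_eq:
  "jc j e = ec e + (\<Sum>C | C \<in> L j \<and> e \<in> C. 2 * ec (lone j C)) - peak j e"
proof -
  have "sum ec (C \<inter> S j) = ec (lone j C)" if "C \<in> L j" for C by (simp add: lone[OF that])
  then have "(\<Sum>C | C \<in> L j \<and> e \<in> C. 2 * sum ec (C \<inter> S j)) = (\<Sum>C | C \<in> L j \<and> e \<in> C. 2 * ec (lone j C))"
    "(\<lambda>C. 2 * sum ec (C \<inter> S j)) ` {C \<in> L j. e \<in> C} = (\<lambda>C. 2 * ec (lone j C)) ` {C \<in> L j. e \<in> C}"
    by (auto intro!: sum.cong image_cong)
  moreover have "{2 * sum ec (C \<inter> S j) | C. C \<in> L j \<and> e \<in> C} = (\<lambda>C. 2 * sum ec (C \<inter> S j)) ` {C \<in> L j. e \<in> C}"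
    by blast
  ultimately show ?thesis unfolding join_cost_def peak_def by (simp only:)
qed

lemma peak_nonneg: "0 \<le> peak j e"
  unfolding peak_def using finite_L by (intro Max_ge) auto

lemma peak_ge: "C \<in> L j \<Longrightarrow> e \<in> C \<Longrightarrow> 2 * ec (lone j C) \<le> peak j e"
  unfolding peak_def using finite_L by (intro Max_ge) auto

lemma lone_cost_nonneg: "j \<in> {1..k} \<Longrightarrow> C \<in> L j \<Longrightarrow> 0 \<le> ec (lone j C)"
  using lone_in(2) tree(1) by (intro ec_nonneg) blast

lemma peak_empty: "{C \<in> L j. e \<in> C} = {} \<Longrightarrow> peak j e = 0"
  unfolding peak_def by (simp only: image_empty Max_singleton)

lemma peak_attained:
  assumes "j \<in> {1..k}" "{C \<in> L j. e \<in> C} \<noteq> {}"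
  shows "\<exists>C\<in>{C \<in> L j. e \<in> C}. peak j e = 2 * ec (lone j C)"
proof -
  let ?A = "{C \<in> L j. e \<in> C}"
  have "finite ?A" using finite_L[of j] by simp
  then have "\<exists>C\<in>?A. \<forall>D\<in>?A. - ec (lone j C) \<le> - ec (lone j D)" using assms(2) by (rule ex_minimizer)
  then obtain C where C: "C \<in> ?A" "\<forall>D\<in>?A. ec (lone j D) \<le> ec (lone j C)" by auto
  have "peak j e = 2 * ec (lone j C)"
    unfolding peak_def using C \<open>finite ?A\<close> lone_cost_nonneg[OF assms(1), of C] by (intro Max_eqI) auto
  then show ?thesis using C by blast
qed

lemma join_cost_ge:
  assumes "j \<in> {1..k}"
  shows "ec e \<le> jc j e"
proof (cases "{C \<in> L j. e \<in> C} = {}")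
  case True
  then show ?thesis unfolding join_cost_eq by (simp only: peak_empty sum.empty)
next
  case False
  then obtain D where D: "D \<in> {C \<in> L j. e \<in> C}" "peak j e = 2 * ec (lone j D)"
    using peak_attained[OF assms] by blast
  have "2 * ec (lone j D) \<le> (\<Sum>C\<in>{C \<in> L j. e \<in> C}. 2 * ec (lone j C))"
    using D finite_L[of j] lone_cost_nonneg[OF assms] by (intro member_le_sum) auto
  then show ?thesis using D(2) by (simp add: join_cost_eq)
qed

lemma join_cost_eq_edge_cost:
  assumes "{C \<in> L j. e \<in> C} \<subseteq> {D}" "j \<in> {1..k}"
  shows "jc j e = ec e"
proof (cases "{C \<in> L j. e \<in> C} = {}")
  case True
  then show ?thesis unfolding join_cost_eq by (simp only: peak_empty sum.empty)
next
  case False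
  then have D: "{C \<in> L j. e \<in> C} = {D}" using assms(1) by blast
  then have "peak j e = 2 * ec (lone j D)"
    using peak_attained[OF assms(2) False] by (metis singletonD)
  then show ?thesis unfolding join_cost_eq by (simp only: D sum.insert finite.emptyI) simp
qed

text \<open>A tree edge crosses at most one lonely cut of \<open>S j\<close>, and a single charge
  cancels against the subtracted maximum.\<close>

lemma join_cost_tree_edge:
  assumes "j \<in> {1..k}" "e \<in> S j"
  shows "jc j e = ec e"
proof (cases "\<exists>D. D \<in> L j \<and> e \<in> D")
  case True
  then obtain D where D: "D \<in> L j" "e \<in> D" by blast
  then have e: "e = lone j D" using lone[of D j] assms(2) by blast
  have "{C \<in> L j. e \<in> C} \<subseteq> {D}" using lone_eqD[OF assms(1) D(1)] e by blast
  then show ?thesis using assms(1) by (rule join_cost_eq_edge_cost)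
next
  case False
  then have "{C \<in> L j. e \<in> C} \<subseteq> {{}}" by blast
  then show ?thesis using assms(1) by (rule join_cost_eq_edge_cost)
qed

lemma forest_subset_E: "j \<in> {1..k} \<Longrightarrow> F j \<subseteq> E"
  using forest_subset tree(1) by blast

lemma T_subset: "T j \<subseteq> V"
  using odd_vertices_subset[of V "F j"] s_in t_in by (auto simp: parity_set_def)

lemma T_parity:
  assumes "j \<in> {1..k}" "U \<subseteq> V"
  shows "odd (card (T j \<inter> U)) \<longleftrightarrow> odd (card (F j \<inter> cut V U)) \<noteq> odd (card ({s, t} \<inter> U))"
proof -
  have fin: "finite (odd_vertices V (F j) \<inter> U)"
    by (rule finite_subset[OF _ finite_V]) (use assms in blast)
  have "T j \<inter> U = sym_diff (odd_vertices V (F j) \<inter> U) ({s, t} \<inter> U)"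
    unfolding parity_set_def by blast
  then show ?thesis
    using odd_card_sym_diff[OF fin, of "{s, t} \<inter> U"] handshake[OF finite_V forest_subset_E[OF assms(1)], of U] by simp
qed

lemma T_even:
  assumes "j \<in> {1..k}"
  shows "even (card (T j))"
proof -
  have "T j \<inter> V = T j" "{s, t} \<inter> V = {s, t}" using T_subset s_in t_in by auto
  then show ?thesis using T_parity[OF assms order_refl] s_neq_t by (simp add: cut_whole)
qed

text \<open>The forest misses \<open>C\<close>, while \<open>C\<close> separates \<open>s\<close>
  from \<open>t\<close>; so \<open>C\<close> is odd for the parity set.\<close>

lemma join_crosses_lonely_cut:
  assumes "j \<in> {1..k}" "T_join V (T j) J" "C \<in> L j"
  shows "J \<inter> C \<noteq> {}"
proof
  assume JC: "J \<inter> C = {}"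
  obtain U where U: "C = cut V U" "s \<in> U" "t \<notin> U" "U \<subseteq> V"
    using assms(3) L_subset_N by (blast elim: narrowE)
  have "odd (card (T j \<inter> U)) \<longleftrightarrow> odd (card (J \<inter> C))"
    using handshake[OF finite_V, of J U] assms(2) U(1) by (simp add: T_join_def)
  moreover have "{s, t} \<inter> U = {s}" using U by auto
  ultimately show False
    using T_parity[OF assms(1) U(4)] forest_Int_lonely_cut[OF assms(3)] U(1) JC by simp
qed

text \<open>
  For every edge of \<open>J\<close>, \<open>R\<close> takes the lonely edges of all lonely cuts that the edge crosses, except
  a most expensive one. If \<open>U\<close> were a cut without edges of the result, the tree path
  between the ends of a suitable edge of \<open>J\<close> would cross \<open>U\<close> exactly once.
\<close>

lemma ex_cheap_reconnection:
  assumes j: "j \<in> {1..k}" and J: "T_join V (T j) J"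
  shows "\<exists>R \<subseteq> S j - F j. graph_connected V (F j \<union> J \<union> R) \<and> sum ec J + 2 * sum ec R \<le> sum (jc j) J"
proof -
  have JE: "J \<subseteq> E" using J by (simp add: T_join_def)
  have finJ: "finite J" by (rule finite_subset[OF JE finite_E])
  let ?L = "\<lambda>e. {C \<in> L j. e \<in> C}"
  \<comment> \<open>The lonely cut that \<open>e\<close> reconnects for free; arbitrary if
    \<open>e\<close> crosses none.\<close>
  define D where "D e = (SOME C. C \<in> ?L e \<and> peak j e = 2 * ec (lone j C))" for e
  have D: "D e \<in> ?L e \<and> peak j e = 2 * ec (lone j (D e))" if ne: "?L e \<noteq> {}" for e
  proof -
    obtain C where "C \<in> ?L e" "peak j e = 2 * ec (lone j C)"
      using peak_attained[OF j ne] by (elim bexE)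
    then have "C \<in> ?L e \<and> peak j e = 2 * ec (lone j C)" ..
    then show ?thesis unfolding D_def by (rule someI)
  qed
  define Q where "Q = (SIGMA e:J. ?L e - {D e})"
  define R where "R = (\<lambda>(e, C). lone j C) ` Q"
  have finL: "finite (?L e)" for e using finite_L[of j] by simp
  have finQ: "finite Q" unfolding Q_def by (rule finite_SigmaI[OF finJ]) (use finL in blast)
  have Qcost: "0 \<le> ec (lone j (snd q))" if "q \<in> Q" for q
    using that by (intro lone_cost_nonneg[OF j]) (auto simp: Q_def)
  have R: "R \<subseteq> S j - F j" unfolding R_def Q_def forest_eq using lone_in(2) by auto
  have "2 * sum ec R \<le> 2 * sum (\<lambda>q. ec (lone j (snd q))) Q"
    using sum_image_le[OF finQ, of ec "\<lambda>(e, C). lone j C"] Qcost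
    by (simp add: R_def case_prod_unfold o_def)
  also have "sum (\<lambda>q. ec (lone j (snd q))) Q = (\<Sum>e\<in>J. \<Sum>C\<in>?L e - {D e}. ec (lone j C))"
    unfolding Q_def by (subst sum.Sigma) (use finJ finL in \<open>auto simp: case_prod_unfold\<close>)
  also have "2 * \<dots> = (\<Sum>e\<in>J. jc j e - ec e)"
  proof (subst sum_distrib_left, rule sum.cong[OF refl])
    fix e
    show "2 * (\<Sum>C\<in>?L e - {D e}. ec (lone j C)) = jc j e - ec e"
    proof (cases "?L e = {}")
      case True
      then show ?thesis unfolding join_cost_eq by (simp only: peak_empty sum.empty empty_Diff)
    next
      case False
      have "(\<Sum>C\<in>?L e. ec (lone j C)) = ec (lone j (D e)) + (\<Sum>C\<in>?L e - {D e}. ec (lone j C))"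
        using D[OF False] finL by (intro sum.remove) auto
      then show ?thesis using D[OF False] by (simp add: join_cost_eq sum_distrib_left[symmetric])
    qed
  qed
  also have "\<dots> = sum (jc j) J - sum ec J" by (simp add: sum_subtractf)
  finally have cost: "sum ec J + 2 * sum ec R \<le> sum (jc j) J" by simp
  have sub: "F j \<union> J \<union> R \<subseteq> E" using forest_subset_E[OF j] JE R tree(1)[OF j] by blast
  have "graph_connected V (F j \<union> J \<union> R)"
    unfolding graph_connected_iff_cuts[OF sub]
  proof (intro allI impI notI)
    fix U assume U: "U \<noteq> {} \<and> U \<subset> V" and none: "(F j \<union> J \<union> R) \<inter> cut V U = {}"
    have key: "\<exists>C\<in>L j. h = lone j C \<and> h \<notin> R" if "h \<in> S j" "h \<in> cut V U" for h
      using that none unfolding forest_eq by blast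
    have "S j \<inter> cut V U \<noteq> {}"
      using tree(2)[OF j] U unfolding graph_connected_iff_cuts[OF tree(1)[OF j]] by blast
    then obtain g C where g: "g \<in> S j" "g \<in> cut V U" "C \<in> L j" "g = lone j C" "g \<notin> R" using key by blast
    obtain e where e: "e \<in> J" "e \<in> C" using join_crosses_lonely_cut[OF j J g(3)] by blast
    have in_R: "lone j C' \<in> R" if "C' \<in> L j" "e \<in> C'" "C' \<noteq> D e" for C'
      using that e(1) unfolding R_def Q_def by (intro image_eqI[of _ _ "(e, C')"]) auto
    \<comment> \<open>For each lonely cut crossed by \<open>e\<close>, the lonely edge is in
      \<open>R\<close> unless the cut is \<open>D e\<close>; and \<open>g\<close> is not in
      \<open>R\<close>.\<close>
    then have CD: "C = D e" using g e(2) by blast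
    have "e \<in> E" using e JE by blast
    then obtain u v where uv: "e = {u, v}" "u \<noteq> v" "u \<in> V" "v \<in> V" by (rule edges_ofE)
    have "(u, v) \<in> (adj (S j))\<^sup>*" using tree(2)[OF j] uv unfolding graph_connected_iff_adj by blast
    from ex_join_of_adj_rtrancl[OF this tree(1)[OF j] finite_V uv(4)]
    obtain P where P: "P \<subseteq> S j" "odd_vertices V P = sym_diff {u} {v}" by metis
    then have oddP: "odd_vertices V P = {u, v}" using uv(2) by blast
    have PE: "P \<subseteq> E" using P(1) tree(1)[OF j] by blast
    have cross: "odd (card (P \<inter> cut V W)) \<longleftrightarrow> e \<in> cut V W" for W
    proof -
      have "odd (card ({u, v} \<inter> W)) \<longleftrightarrow> e \<in> cut V W"
        using uv by (auto simp: doubleton_in_cut Int_insert_left)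
      then show ?thesis using handshake[OF finite_V PE, of W] oddP by simp
    qed
    have lone_P: "lone j C' \<in> P \<longleftrightarrow> e \<in> C'" if C': "C' \<in> L j" for C'
    proof -
      obtain W where W: "C' = cut V W" using C' L_subset_N by (blast elim: narrowE)
      have "P \<inter> C' = P \<inter> (C' \<inter> S j)" using P(1) by blast
      also have "\<dots> = (if lone j C' \<in> P then {lone j C'} else {})" unfolding lone[OF C'] by auto
      finally have "P \<inter> C' = (if lone j C' \<in> P then {lone j C'} else {})" .
      then show ?thesis using cross[of W] W by (auto split: if_splits)
    qed
    \<comment> \<open>Every edge of the tree path inside the cut is an unrestored lonely edge. Its
      cut is crossed by \<open>e\<close>, so it is \<open>D e\<close> and the edge is
      \<open>g\<close>. One crossing forces \<open>e\<close> itself to cross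
      \<open>U\<close>.\<close>
    have "P \<inter> cut V U = {g}"
    proof (intro equalityI subsetI)
      fix h assume h: "h \<in> P \<inter> cut V U"
      then obtain C' where C': "C' \<in> L j" "h = lone j C'" "h \<notin> R" using key P(1) by blast
      then have "e \<in> C'" using lone_P h by blast
      then have "C' = D e" using in_R C' by blast
      then show "h \<in> {g}" using C'(2) CD g(4) by simp
    next
      fix h assume "h \<in> {g}"
      then show "h \<in> P \<inter> cut V U" using lone_P[OF g(3)] e(2) g(2,4) by simp
    qed
    then have "e \<in> cut V U" using cross[of U] by simp
    then show False using none e(1) by blast
  qed
  then show ?thesis using R cost by blast
qed

section \<open>Executability and cost of one iteration\<close>

lemma ex_join_step: "j \<in> {1..k} \<Longrightarrow> \<exists>J. join_step V c s t x p S j J"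
  unfolding join_step_def
  using ex_T_join[OF finite_V T_subset T_even] ex_is_arg_min_finite[OF finite_T_joins[OF finite_V]] by metis

lemma join_stepD:
  assumes "join_step V c s t x p S j J"
  shows "T_join V (T j) J" "T_join V (T j) J' \<Longrightarrow> sum (jc j) J \<le> sum (jc j) J'"
  using assms by (auto simp: join_step_def is_arg_min_def not_less)

lemma reconnect_stepD:
  assumes "reconnect_step V c s t x p S j J R"
  shows "R \<subseteq> S j - F j" "graph_connected V (F j \<union> J \<union> R)"
    "R' \<subseteq> S j - F j \<Longrightarrow> graph_connected V (F j \<union> J \<union> R') \<Longrightarrow> sum ec R \<le> sum ec R'"
  using assms by (auto simp: reconnect_step_def is_arg_min_def not_less)

lemma ex_reconnect_step:
  assumes "j \<in> {1..k}" "T_join V (T j) J"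
  shows "\<exists>R. reconnect_step V c s t x p S j J R"
proof -
  obtain R where R: "R \<subseteq> S j - F j \<and> graph_connected V (F j \<union> J \<union> R)"
    using ex_cheap_reconnection[OF assms] by blast
  have "finite {R. R \<subseteq> S j - F j \<and> graph_connected V (F j \<union> J \<union> R)}"
    by (rule finite_subset[of _ "Pow (S j)"]) (use finite_S[OF assms(1)] in auto)
  then show ?thesis unfolding reconnect_step_def using R by (rule ex_is_arg_min_finite)
qed

lemma steps_subset_E:
  assumes "j \<in> {1..k}" "T_join V (T j) J" "R \<subseteq> S j - F j"
  shows "F j \<subseteq> E" "J \<subseteq> E" "R \<subseteq> E"
  using assms forest_subset_E tree(1)[OF assms(1)] by (auto simp: T_join_def)

text \<open>The doubled \<open>R\<close> does not affect parities, and \<open>J\<close> corrects the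
  odd vertices of the forest to \<open>{s, t}\<close>.\<close>

lemma ex_walk_step:
  assumes j: "j \<in> {1..k}" and J: "T_join V (T j) J"
    and R: "R \<subseteq> S j - F j" "graph_connected V (F j \<union> J \<union> R)"
  shows "\<exists>w. walk_step V s t x p S j J R w"
proof -
  let ?H = "mset_set (F j) + mset_set J + mset_set R + mset_set R"
  note sub = steps_subset_E[OF j J R(1)]
  note fin = sub[THEN finite_subset, OF finite_E]
  have setH: "set_mset ?H = F j \<union> J \<union> R" using fin by auto
  have HE: "e \<in> E" if "e \<in># ?H" for e using that sub fin by auto
  have "card e = 2" if "e \<in># ?H" for e using HE[OF that] by (simp add: edges_of_def)
  moreover have "odd (mdegree ?H v) \<longleftrightarrow> (v = s) \<noteq> (v = t)" for v
  proof -
    have deg: "mdegree ?H v = mdegree (mset_set (F j)) v + mdegree (mset_set J) v + 2 * mdegree (mset_set R) v"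
      by simp
    have par: "odd (a + b + 2 * c) \<longleftrightarrow> odd a \<noteq> odd b" for a b c :: nat by simp
    have "odd (mdegree ?H v) \<longleftrightarrow> (v \<in> odd_vertices V (F j)) \<noteq> (v \<in> odd_vertices V J)"
      unfolding deg par odd_mdegree_mset_set[OF finite_V sub(1)] odd_mdegree_mset_set[OF finite_V sub(2)] ..
    also have "odd_vertices V J = sym_diff (odd_vertices V (F j)) {s, t}"
      using J by (simp add: T_join_def parity_set_def)
    finally show ?thesis using s_neq_t by auto
  qed
  moreover have "(s, v) \<in> (adj (set_mset ?H))\<^sup>*" if "e \<in># ?H" "v \<in> e" for e v
  proof -
    have "v \<in> V" using HE[OF that(1)] that(2) by (auto simp: edges_of_def)
    then show ?thesis using R(2) s_in unfolding setH graph_connected_iff_adj by blast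
  qed
  ultimately have "\<exists>w. w \<noteq> [] \<and> hd w = s \<and> last w = t \<and> mset (walk_edges w) = ?H"
    using s_neq_t by (intro ex_euler_walk) blast+
  then obtain w where w: "w \<noteq> []" "hd w = s" "last w = t" "mset (walk_edges w) = ?H" by blast
  \<comment> \<open>Only then does every vertex of the walk lie on one of its edges, which places
    the walk in \<open>V\<close>.\<close>
  have "2 \<le> length w"
  proof (rule ccontr)
    assume "\<not> 2 \<le> length w"
    then obtain a where "w = [a]" using w(1) by (cases w) (auto simp: Suc_le_eq)
    then show False using w(2,3) s_neq_t by simp
  qed
  then have "set w = \<Union>(set (walk_edges w))" by (simp add: Union_walk_edges_eq)
  moreover have "set (walk_edges w) = set_mset ?H" using w(4) by (metis set_mset_mset)
  ultimately have "set w \<subseteq> V" using HE by (auto simp: edges_of_def)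
  then have "walk_step V s t x p S j J R w"
    using w by (simp add: walk_step_def eulerian_walk_def)
  then show ?thesis by blast
qed

lemma walk_stepD:
  assumes j: "j \<in> {1..k}" and J: "T_join V (T j) J"
    and R: "R \<subseteq> S j - F j" "graph_connected V (F j \<union> J \<union> R)"
    and w: "walk_step V s t x p S j J R w"
  shows "w \<noteq> []" "hd w = s" "last w = t" "set w = V" "set (walk_edges w) \<subseteq> E"
    "path_cost c w = sum ec (F j) + sum ec J + 2 * sum ec R"
proof -
  let ?H = "mset_set (F j) + mset_set J + mset_set R + mset_set R"
  note sub = steps_subset_E[OF j J R(1)]
  note fin = sub[THEN finite_subset, OF finite_E]
  show w': "w \<noteq> []" "hd w = s" "last w = t"
    using w by (auto simp: walk_step_def eulerian_walk_def)
  have wH: "mset (walk_edges w) = ?H" and wV: "set w \<subseteq> V"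
    using w by (auto simp: walk_step_def eulerian_walk_def)
  have "set (walk_edges w) = set_mset ?H" using wH by (metis set_mset_mset)
  also have "\<dots> = F j \<union> J \<union> R" using fin by auto
  finally have setw: "set (walk_edges w) = F j \<union> J \<union> R" .
  then show "set (walk_edges w) \<subseteq> E" using sub by simp
  have "v \<in> set w" if "v \<in> V" for v
  proof -
    have "{v} \<subset> V" using that s_in t_in s_neq_t by auto
    then have "(F j \<union> J \<union> R) \<inter> cut V {v} \<noteq> {}"
      using R(2) sub by (subst (asm) graph_connected_iff_cuts) auto
    then obtain e where "e \<in> set (walk_edges w)" "e \<in> cut V {v}" unfolding setw by blast
    moreover from this(2) have "v \<in> e" by (auto elim: cutE)
    ultimately show ?thesis by (intro subsetD[OF Union_walk_edges, of v w]) blast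
  qed
  then show "set w = V" using wV by blast
  have "path_cost c w = sum_mset (image_mset ec (mset (walk_edges w)))"
    by (simp add: path_cost_def sum_mset_sum_list[symmetric])
  also have "\<dots> = sum ec (F j) + sum ec J + 2 * sum ec R"
    unfolding wH by (simp add: sum_unfold_sum_mset)
  finally show "path_cost c w = sum ec (F j) + sum ec J + 2 * sum ec R" .
qed

lemma iteration_executable:
  assumes "j \<in> {1..k}"
  shows "iteration_executable V c s t x p S j"
  unfolding iteration_executable_def
proof (intro conjI allI impI)
  show "\<exists>J. join_step V c s t x p S j J" by (rule ex_join_step[OF assms])
  fix J assume "join_step V c s t x p S j J"
  then have J: "T_join V (T j) J" by (rule join_stepD)
  show "\<exists>R. reconnect_step V c s t x p S j J R" by (rule ex_reconnect_step[OF assms J])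
  fix R assume "reconnect_step V c s t x p S j J R"
  note R = reconnect_stepD(1,2)[OF this]
  show "\<exists>w. walk_step V s t x p S j J R w" by (rule ex_walk_step[OF assms J R])
  fix w assume "walk_step V s t x p S j J R w"
  note w = walk_stepD[OF assms J R this]
  show "\<exists>Q. shortcut w Q" using w s_neq_t by (intro ex_shortcut) auto
qed

lemma ex_iteration_result:
  assumes "j \<in> {1..k}"
  shows "\<exists>Q. iteration_result V c s t x p S j Q"
  using iteration_executable[OF assms] unfolding iteration_executable_def iteration_result_def by metis

text \<open>After this bound the reconnection and the walk no longer matter: \<open>jc\<close> has
  absorbed them, and any T-join may be used for the estimate.\<close>

lemma iteration_resultD:
  assumes j: "j \<in> {1..k}" and Q: "iteration_result V c s t x p S j Q"
  shows "hamiltonian_path V s t Q"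
    and "T_join V (T j) J' \<Longrightarrow> path_cost c Q \<le> sum ec (F j) + sum (jc j) J'"
proof -
  obtain J R w where J: "join_step V c s t x p S j J" and R: "reconnect_step V c s t x p S j J R"
    and w: "walk_step V s t x p S j J R w" and sc: "shortcut w Q"
    using Q by (auto simp: iteration_result_def)
  note J' = join_stepD[OF J] and R' = reconnect_stepD[OF R]
  note w' = walk_stepD[OF j J'(1) R'(1,2) w]
  show "hamiltonian_path V s t Q"
    using sc w'(1-4) s_in by (auto simp: shortcut_def hamiltonian_path_def)
  obtain R0 where R0: "R0 \<subseteq> S j - F j" "graph_connected V (F j \<union> J \<union> R0)"
    "sum ec J + 2 * sum ec R0 \<le> sum (jc j) J"
    using ex_cheap_reconnection[OF j J'(1)] by blast
  assume "T_join V (T j) J'"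
  then have "sum (jc j) J \<le> sum (jc j) J'" by (rule J'(2))
  moreover have "path_cost c Q \<le> path_cost c w"
    using sc w' by (intro path_cost_shortcut_le) auto
  ultimately show "path_cost c Q \<le> sum ec (F j) + sum (jc j) J'"
    using w'(6) R'(3)[OF R0(1,2)] R0(3) by linarith
qed

end

section \<open>The correction vectors\<close>

context decomposed_lp
begin

lemma x_nonneg: "e \<in> E \<Longrightarrow> 0 \<le> x e"
  by (rule lp_feasible_nonneg[OF feasible])

lemma sum_delta_mult:
  fixes h :: "'a set \<Rightarrow> real"
  assumes "a \<in> E"
  shows "(\<Sum>e\<in>E. h e * (b * of_bool (e = a))) = b * h a"
proof -
  have "(\<Sum>e\<in>E. h e * (b * of_bool (e = a))) = (\<Sum>e\<in>E. if e = a then h e * b else 0)"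
    by (intro sum.cong) auto
  then show ?thesis using assms finite_E by (simp add: sum.delta)
qed

lemma lone_in_E: "j \<in> {1..k} \<Longrightarrow> C \<in> L j \<Longrightarrow> lone j C \<in> E"
  using lone_in(2) tree(1) by blast

lemma lp_cost_eq_trees: "lp_cost V c x = (\<Sum>j=1..k. p j * sum ec (S j))"
proof -
  have "lp_cost V c x = (\<Sum>e\<in>E. \<Sum>j=1..k. p j * (of_bool (e \<in> S j) * ec e))"
    unfolding lp_cost_def
  proof (rule sum.cong[OF refl])
    fix e assume "e \<in> E"
    then have "x e = (\<Sum>j=1..k. p j * indicator (S j) e)"
      using decomposition unfolding tree_decomposition_def by blast
    then show "ec e * x e = (\<Sum>j=1..k. p j * (of_bool (e \<in> S j) * ec e))"
      by (simp only: sum_distrib_left indicator_def mult_ac)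
  qed
  also have "\<dots> = (\<Sum>j=1..k. p j * (\<Sum>e\<in>E. of_bool (e \<in> S j) * ec e))"
    by (subst sum.swap) (simp add: sum_distrib_left)
  also have "\<dots> = (\<Sum>j=1..k. p j * sum ec (S j))"
    by (intro sum.cong refl) (simp add: sum_eq_sum_of_bool[OF finite_E tree(1)])
  finally show ?thesis .
qed

text \<open>Hall's condition for narrow cuts pays for all but one of the lonely edges charged in \<open>jc\<close>.\<close>

lemma join_cost_lp_le:
  assumes j: "j \<in> {1..k}"
  shows "(\<Sum>e\<in>E. jc j e * x e) \<le> lp_cost V c x + (\<Sum>C\<in>L j. 2 * ec (lone j C) * (sum x C - 1))"
proof -
  \<comment> \<open>The subtracted maximum recovers, in LP average, one full charge for each lonely
    cut; this turns the factor x(C) into x(C) - 1.\<close>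
  have "(\<Sum>C\<in>L j. 2 * ec (lone j C)) \<le> (\<Sum>e\<in>E. x e * peak j e)"
  proof (rule weighted_Hall[OF finite_E finite_L])
    fix \<B> assume "\<B> \<subseteq> L j"
    then show "card \<B> \<le> sum x (\<Union>\<B>)"
      using L_subset_N by (intro narrow_cuts_Union[OF finite_V feasible]) blast
  next
    fix C assume "C \<in> L j"
    then show "C \<subseteq> E" "0 \<le> 2 * ec (lone j C)"
      using L_subset_N narrow_subset lone_cost_nonneg[OF j] by auto
  qed (auto simp: x_nonneg peak_nonneg peak_ge)
  moreover have "(\<Sum>e\<in>E. x e * (\<Sum>C | C \<in> L j \<and> e \<in> C. 2 * ec (lone j C)))
      = (\<Sum>C\<in>L j. 2 * ec (lone j C) * sum x C)"
  proof -
    have "(\<Sum>e\<in>E. x e * (\<Sum>C | C \<in> L j \<and> e \<in> C. 2 * ec (lone j C)))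
        = (\<Sum>e\<in>E. \<Sum>C\<in>L j. 2 * ec (lone j C) * (of_bool (e \<in> C) * x e))"
    proof (rule sum.cong[OF refl])
      fix e
      have "(\<Sum>C | C \<in> L j \<and> e \<in> C. 2 * ec (lone j C)) = (\<Sum>C\<in>L j. of_bool (e \<in> C) * (2 * ec (lone j C)))"
        using sum_eq_sum_of_bool[OF finite_L[of j], of "{C \<in> L j. e \<in> C}" "\<lambda>C. 2 * ec (lone j C)"]
        by simp
      then show "x e * (\<Sum>C | C \<in> L j \<and> e \<in> C. 2 * ec (lone j C))
          = (\<Sum>C\<in>L j. 2 * ec (lone j C) * (of_bool (e \<in> C) * x e))"
        by (simp only: sum_distrib_left mult_ac)
    qed
    also have "\<dots> = (\<Sum>C\<in>L j. 2 * ec (lone j C) * (\<Sum>e\<in>E. of_bool (e \<in> C) * x e))"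
      by (subst sum.swap) (simp add: sum_distrib_left)
    also have "\<dots> = (\<Sum>C\<in>L j. 2 * ec (lone j C) * sum x C)"
    proof (rule sum.cong[OF refl])
      fix C assume "C \<in> L j"
      then have "C \<subseteq> E" using L_subset_N narrow_subset by blast
      then show "2 * ec (lone j C) * (\<Sum>e\<in>E. of_bool (e \<in> C) * x e) = 2 * ec (lone j C) * sum x C"
        by (simp only: sum_eq_sum_of_bool[OF finite_E, of C x])
    qed
    finally show ?thesis .
  qed
  moreover have "(\<Sum>e\<in>E. jc j e * x e) = lp_cost V c x
      + (\<Sum>e\<in>E. x e * (\<Sum>C | C \<in> L j \<and> e \<in> C. 2 * ec (lone j C))) - (\<Sum>e\<in>E. x e * peak j e)"
    by (simp add: join_cost_eq lp_cost_def algebra_simps sum.distrib sum_subtractf)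
  moreover have "(\<Sum>C\<in>L j. 2 * ec (lone j C) * (sum x C - 1))
      = (\<Sum>C\<in>L j. 2 * ec (lone j C) * sum x C) - (\<Sum>C\<in>L j. 2 * ec (lone j C))"
    by (simp add: right_diff_distrib sum_subtractf)
  ultimately show ?thesis by linarith
qed

text \<open>A narrow cut is lonely in an initial segment of the trees. A tree of weight 0 beyond the
  segment may share the partial sum of \<open>r\<close> and be lonely too, hence the positivity
  condition.\<close>

lemma narrow_threshold:
  assumes "C \<in> N"
  obtains r where "r \<in> {1..k}" "\<sigma> r = 2 - sum x C" "\<forall>j\<in>{1..r}. C \<in> L j"
    "\<forall>j\<in>{1..k}. 0 < p j \<longrightarrow> C \<in> L j \<longrightarrow> j \<le> r"
proof -
  obtain r where r: "r \<in> {1..k}" "(\<Sum>j=1..r. p j) = 2 - sum x C" "\<forall>j\<in>{1..r}. card (C \<inter> S j) = 1"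
    using decomposition assms unfolding tree_decomposition_def by blast
  then have \<sigma>r: "\<sigma> r = 2 - sum x C" by (simp add: \<sigma>_def)
  have "C \<in> L j" if "j \<in> {1..r}" for j
    using r that assms \<sigma>_mono[of j r] \<sigma>r by (auto simp: L_iff)
  moreover have "j \<le> r" if "j \<in> {1..k}" "0 < p j" "C \<in> L j" for j
  proof (rule ccontr)
    assume "\<not> j \<le> r"
    then have "\<sigma> r \<le> \<sigma> (j - 1)" using that(1) by (intro \<sigma>_mono) auto
    then have "\<sigma> r < \<sigma> j" using that(1,2) \<sigma>_step[of j] by simp
    then show False using that(3) \<sigma>r by (simp add: L_iff)
  qed
  ultimately show thesis using r(1) \<sigma>r by (intro that[of r]) auto
qed

text \<open>Here \<sigma> i < \<sigma> j, so every cut lonely in \<open>S j\<close> has its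
  threshold no earlier than \<open>i\<close> and is lonely in \<open>S i\<close> as well. The edge
  crosses only one cut lonely in \<open>S i\<close>, namely \<open>C\<close>, so no charge of
  \<open>S j\<close> hits it.\<close>

lemma join_cost_lone:
  assumes "i \<in> {1..k}" "j \<in> {1..k}" "0 < p j" "C \<in> L i" "C \<notin> L j"
  shows "jc j (lone i C) = ec (lone i C)"
proof -
  have CN: "C \<in> N" using assms(4) by (simp add: L_iff)
  obtain r where r: "r \<in> {1..k}" "\<sigma> r = 2 - sum x C" "\<forall>j\<in>{1..r}. C \<in> L j"
    using CN by (rule narrow_threshold)
  have "\<not> j \<le> r" using r(3) assms(2,5) by auto
  then have "\<sigma> r \<le> \<sigma> (j - 1)" using assms(2) by (intro \<sigma>_mono) auto
  then have "\<sigma> r < \<sigma> j" using assms(2,3) \<sigma>_step[of j] by simp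
  then have ij: "\<sigma> i < \<sigma> j" using assms(4) r(2) by (simp add: L_iff)
  have "lone i C \<notin> D" if D: "D \<in> L j" for D
  proof
    assume in_D: "lone i C \<in> D"
    have DN: "D \<in> N" using D by (simp add: L_iff)
    obtain r' where r': "r' \<in> {1..k}" "\<sigma> r' = 2 - sum x D" "\<forall>j\<in>{1..r'}. D \<in> L j"
      using DN by (rule narrow_threshold)
    have "\<sigma> i < \<sigma> r'" using ij D r'(2) by (simp add: L_iff)
    then have "i \<le> r'" using \<sigma>_mono[of r' i] assms(1) by (meson atLeastAtMost_iff leI less_imp_le_nat not_less)
    then have "D \<in> L i" using r'(3) assms(1) by simp
    then have "C = D" using lone_eqD[OF assms(1,4)] in_D by blast
    then show False using D assms(5) by simp
  qed
  then have "{D \<in> L j. lone i C \<in> D} \<subseteq> {{}}" by blast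
  then show ?thesis using assms(2) by (rule join_cost_eq_edge_cost)
qed

section \<open>The balance at a narrow cut and the fractional join\<close>

definition trees :: "'a set set \<Rightarrow> nat set" where "trees C = {i \<in> {1..k}. C \<in> L i}"

text \<open>Plays two roles: it is the amount p + \<phi> - \<phi> x(C) that a lonely cut lacks after
  \<phi> x, and half of the net saving 2 p - 2 \<phi> (x(C) - 1) per unit cost of the deleted edge.
  So half of the saving is spent at the cut itself and half is left for other trees.\<close>

definition surplus :: "nat \<Rightarrow> 'a set set \<Rightarrow> real" where
  "surplus j C = p j - (sum x C - 1) * \<phi> j"

text \<open>What a narrow cut with at least two tree edges may still lack: p + \<phi> minus \<phi>
  x(C) minus 2 (p - \<phi>).\<close>

definition deficit :: "nat \<Rightarrow> 'a set set \<Rightarrow> real" where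
  "deficit j C = max 0 ((3 - sum x C) * \<phi> j - p j)"

definition total_surplus :: "'a set set \<Rightarrow> real" where
  "total_surplus C = (\<Sum>i\<in>trees C. surplus i C)"

lemma narrow_bounds: "C \<in> N \<Longrightarrow> 1 \<le> sum x C" "C \<in> N \<Longrightarrow> sum x C < 2"
  by (auto elim: narrowE)

text \<open>The first bound makes the total surplus positive, so it can serve as a denominator; the
  second lets a lonely edge count at least as much as a forest edge at every other cut.\<close>

lemma surplus_ge:
  assumes "j \<in> {1..k}" "C \<in> N"
  shows "(2 - sum x C) * p j \<le> surplus j C" "p j - \<phi> j \<le> surplus j C" "0 \<le> surplus j C"
proof -
  note X = narrow_bounds[OF assms(2)] and \<phi> = \<phi>_bounds[OF assms(1)]
  have "(sum x C - 1) * \<phi> j \<le> (sum x C - 1) * p j" using X \<phi> by (intro mult_left_mono) auto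
  then show 1: "(2 - sum x C) * p j \<le> surplus j C" by (simp add: surplus_def algebra_simps)
  have "(sum x C - 1) * \<phi> j \<le> 1 * \<phi> j" using X \<phi> by (intro mult_right_mono) auto
  then show "p j - \<phi> j \<le> surplus j C" by (simp add: surplus_def)
  then show "0 \<le> surplus j C" using \<phi> by linarith
qed

text \<open>With \<tau> = \<open>\<sigma> r\<close> this is the balance between early and late
  trees. Lonely trees beyond \<open>r\<close> have weight 0, hence surplus 0.\<close>

lemma total_surplus:
  assumes "C \<in> N"
  shows "0 < total_surplus C" "(\<Sum>j\<in>{1..k} - trees C. deficit j C) \<le> total_surplus C"
proof -
  obtain r where r: "r \<in> {1..k}" "\<sigma> r = 2 - sum x C" "\<forall>j\<in>{1..r}. C \<in> L j"
    "\<forall>j\<in>{1..k}. 0 < p j \<longrightarrow> C \<in> L j \<longrightarrow> j \<le> r"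
    using assms by (rule narrow_threshold)
  have sub: "{1..r} \<subseteq> trees C" using r(1,3) by (auto simp: trees_def)
  have fin: "finite (trees C)" by (simp add: trees_def)
  have zero: "surplus i C = 0" if i: "i \<in> trees C - {1..r}" for i
  proof -
    have ik: "i \<in> {1..k}" "C \<in> L i" "\<not> i \<le> r" using i by (auto simp: trees_def)
    then have "\<not> 0 < p i" using r(4) by blast
    then have "p i = 0" using p_nonneg[OF ik(1)] by simp
    then show ?thesis using \<phi>_bounds[OF ik(1)] by (simp add: surplus_def)
  qed
  have tot: "total_surplus C = (\<Sum>i=1..r. surplus i C)"
    unfolding total_surplus_def using fin sub zero by (intro sum.mono_neutral_right) auto
  have "(2 - sum x C) * \<sigma> r \<le> (\<Sum>i=1..r. surplus i C)"
    unfolding \<sigma>_def sum_distrib_left using r(1) assms by (intro sum_mono surplus_ge(1)) auto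
  moreover have "0 < (2 - sum x C) * \<sigma> r" unfolding r(2) using narrow_bounds[OF assms] by simp
  ultimately show "0 < total_surplus C" using tot by linarith
  have "(\<Sum>j\<in>{1..k} - trees C. deficit j C) \<le> (\<Sum>j=r+1..k. deficit j C)"
  proof (rule sum_mono2)
    show "{1..k} - trees C \<subseteq> {r+1..k}"
    proof
      fix i assume "i \<in> {1..k} - trees C"
      then have "i \<notin> {1..r}" "i \<in> {1..k}" using sub by blast+
      then show "i \<in> {r+1..k}" by simp
    qed
  qed (auto simp: deficit_def)
  also have "\<dots> = (\<Sum>j=r+1..k. max 0 ((1 + \<sigma> r) * \<phi> j - p j))" by (simp add: deficit_def r(2))
  also have "\<dots> \<le> \<sigma> r - (1 - \<sigma> r) * (\<Sum>j=1..r. \<phi> j)" using r(1) by (intro deficit_le_surplus) simp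
  also have "\<dots> = (\<Sum>i=1..r. surplus i C)"
  proof -
    have "surplus i C = p i - (1 - \<sigma> r) * \<phi> i" for i by (simp add: surplus_def r(2))
    then show ?thesis
      by (simp only: sum_subtractf sum_distrib_left[symmetric] \<sigma>_def[symmetric])
  qed
  finally show "(\<Sum>j\<in>{1..k} - trees C. deficit j C) \<le> total_surplus C" using tot by simp
qed

text \<open>
  \<open>corr j\<close> is \<open>p j + \<phi> j\<close> times the fractional \<open>T j\<close>-join
  \<open>\<beta> x + (1 - 2 \<beta>) \<chi>\<^sup>F + \<dots>\<close> with \<open>\<beta> = \<phi> j / (p j + \<phi> j)\<close>. Narrow cuts that are not lonely in
  \<open>S j\<close> are repaired by the edges lonely at them in other trees, whose \<open>jc j\<close>-cost is their cost.
\<close>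

definition corr :: "nat \<Rightarrow> 'a set \<Rightarrow> real" where
  "corr j e = \<phi> j * x e + (p j - \<phi> j) * of_bool (e \<in> F j)
     + (\<Sum>C\<in>L j. surplus j C * of_bool (e = lone j C))
     + (\<Sum>C\<in>N - L j. \<Sum>i\<in>trees C. deficit j C * surplus i C / total_surplus C * of_bool (e = lone i C))"

lemma sum_corr:
  fixes h :: "'a set \<Rightarrow> real"
  assumes j: "j \<in> {1..k}"
  shows "(\<Sum>e\<in>E. h e * corr j e) = \<phi> j * (\<Sum>e\<in>E. h e * x e) + (p j - \<phi> j) * sum h (F j)
     + (\<Sum>C\<in>L j. surplus j C * h (lone j C))
     + (\<Sum>C\<in>N - L j. \<Sum>i\<in>trees C. deficit j C * surplus i C / total_surplus C * h (lone i C))"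
proof -
  have "(\<Sum>e\<in>E. h e * corr j e) = (\<Sum>e\<in>E. h e * (\<phi> j * x e)) + (\<Sum>e\<in>E. h e * ((p j - \<phi> j) * of_bool (e \<in> F j)))
     + (\<Sum>e\<in>E. \<Sum>C\<in>L j. h e * (surplus j C * of_bool (e = lone j C)))
     + (\<Sum>e\<in>E. \<Sum>C\<in>N - L j. \<Sum>i\<in>trees C. h e * (deficit j C * surplus i C / total_surplus C * of_bool (e = lone i C)))"
    unfolding corr_def distrib_left sum.distrib sum_distrib_left ..
  moreover have "(\<Sum>e\<in>E. h e * (\<phi> j * x e)) = \<phi> j * (\<Sum>e\<in>E. h e * x e)"
    by (simp add: sum_distrib_left mult_ac)
  moreover have "(\<Sum>e\<in>E. h e * ((p j - \<phi> j) * of_bool (e \<in> F j))) = (p j - \<phi> j) * sum h (F j)"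
    unfolding sum_eq_sum_of_bool[OF finite_E forest_subset_E[OF j]] sum_distrib_left
    by (intro sum.cong refl) (simp only: mult_ac)
  moreover have "(\<Sum>e\<in>E. \<Sum>C\<in>L j. h e * (surplus j C * of_bool (e = lone j C))) = (\<Sum>C\<in>L j. surplus j C * h (lone j C))"
    by (subst sum.swap) (intro sum.cong refl sum_delta_mult lone_in_E[OF j])
  moreover have "(\<Sum>e\<in>E. \<Sum>C\<in>N - L j. \<Sum>i\<in>trees C. h e * (deficit j C * surplus i C / total_surplus C * of_bool (e = lone i C)))
      = (\<Sum>C\<in>N - L j. \<Sum>i\<in>trees C. deficit j C * surplus i C / total_surplus C * h (lone i C))"
    by (subst sum.swap, intro sum.cong refl, subst sum.swap, intro sum.cong refl sum_delta_mult lone_in_E)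
      (auto simp: trees_def)
  ultimately show ?thesis by simp
qed

lemma corr_weight_nonneg:
  assumes "C \<in> N" "i \<in> trees C"
  shows "0 \<le> deficit j C * surplus i C / total_surplus C"
  using surplus_ge(3)[of i C] total_surplus(1)[OF assms(1)] assms
  by (intro divide_nonneg_nonneg mult_nonneg_nonneg) (auto simp: deficit_def trees_def)

lemma corr_nonneg:
  assumes "j \<in> {1..k}" "e \<in> E"
  shows "0 \<le> corr j e"
proof -
  have "0 \<le> (\<Sum>C\<in>L j. surplus j C * of_bool (e = lone j C))"
    using surplus_ge(3)[OF assms(1)] L_subset_N by (intro sum_nonneg mult_nonneg_nonneg) auto
  moreover have "0 \<le> (\<Sum>C\<in>N - L j. \<Sum>i\<in>trees C. deficit j C * surplus i C / total_surplus C * of_bool (e = lone i C))"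
    using corr_weight_nonneg by (intro sum_nonneg mult_nonneg_nonneg) auto
  moreover have "0 \<le> \<phi> j * x e" "0 \<le> (p j - \<phi> j) * of_bool (e \<in> F j)"
    using \<phi>_bounds[OF assms(1)] x_nonneg[OF assms(2)] by auto
  ultimately show ?thesis unfolding corr_def by linarith
qed

text \<open>A lonely cut is filled by its own edge, and LP value at least 2 suffices with one tree
  edge. The other odd cuts are narrow and contain at least two tree edges, so the deficit term
  completes them.\<close>

lemma corr_cut:
  assumes j: "j \<in> {1..k}" and U: "U \<subseteq> V" "odd (card (T j \<inter> U))"
  shows "p j + \<phi> j \<le> sum (corr j) (cut V U)"
proof -
  define C where "C = cut V U"
  have CE: "C \<subseteq> E" by (simp add: C_def cut_subset)
  let ?i = "\<lambda>e. of_bool (e \<in> C) :: real"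
  note \<phi> = \<phi>_bounds[OF j]
  define A3 where "A3 = (\<Sum>D\<in>L j. surplus j D * ?i (lone j D))"
  define A4 where "A4 = (\<Sum>D\<in>N - L j. \<Sum>i\<in>trees D. deficit j D * surplus i D / total_surplus D * ?i (lone i D))"
  have sumC: "sum (corr j) C = \<phi> j * sum x C + (p j - \<phi> j) * sum ?i (F j) + A3 + A4"
    using sum_corr[OF j, of ?i]
    unfolding sum_eq_sum_of_bool[OF finite_E CE, symmetric] A3_def A4_def .
  have inner4: "0 \<le> (\<Sum>i\<in>trees D. deficit j D * surplus i D / total_surplus D * ?i (lone i D))" if "D \<in> N" for D
    using corr_weight_nonneg[OF that] by (intro sum_nonneg mult_nonneg_nonneg) auto
  then have A4: "0 \<le> A4" unfolding A4_def by (rule sum_nonneg) blast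
  have A3_inner: "0 \<le> surplus j D * ?i (lone j D)" if "D \<in> L j" for D
    using surplus_ge(3)[OF j] L_subset_N that by (intro mult_nonneg_nonneg) auto
  show ?thesis
  proof (cases "C \<in> L j")
    case True
    have "surplus j C * ?i (lone j C) \<le> A3"
      unfolding A3_def using True finite_L A3_inner by (intro member_le_sum) auto
    moreover have "?i (lone j C) = 1" using lone_in(1)[OF True] by simp
    moreover have "0 \<le> (p j - \<phi> j) * sum ?i (F j)" using \<phi> by (intro mult_nonneg_nonneg sum_nonneg) auto
    ultimately show ?thesis
      using sumC A4 unfolding C_def[symmetric] by (simp add: surplus_def algebra_simps)
  next
    case False
    have count: "sum ?i (S j) = card (C \<inter> S j)" using finite_S[OF j] by (simp add: Int_commute)
    \<comment> \<open>Forest edges and lonely edges together act like the whole tree with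
      coefficient p - \<phi>, so tree edges can be counted without regard to deletions.\<close>
    have "(p j - \<phi> j) * (\<Sum>D\<in>L j. ?i (lone j D)) \<le> A3"
      unfolding A3_def sum_distrib_left
      using surplus_ge(2)[OF j] L_subset_N by (intro sum_mono mult_right_mono) auto
    then have "(p j - \<phi> j) * card (C \<inter> S j) \<le> (p j - \<phi> j) * sum ?i (F j) + A3"
      unfolding count[symmetric] sum_tree_split[OF j] distrib_left by linarith
    then have lower: "\<phi> j * sum x C + (p j - \<phi> j) * card (C \<inter> S j) + A4 \<le> sum (corr j) C"
      using sumC by linarith
    have "U \<noteq> {}" "U \<noteq> V" using U(2) T_even[OF j] T_subset[of j] by (auto simp: Int_absorb2)
    then have "S j \<inter> C \<noteq> {}"
      using tree(2)[OF j] U(1) unfolding graph_connected_iff_cuts[OF tree(1)[OF j]] C_def by blast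
    then have "card (C \<inter> S j) \<noteq> 0" using finite_S[OF j] by auto
    show ?thesis
    proof (cases "2 \<le> sum x C")
      case True
      then have "\<phi> j * 2 \<le> \<phi> j * sum x C" using \<phi> by (intro mult_left_mono) auto
      moreover have "(p j - \<phi> j) * 1 \<le> (p j - \<phi> j) * card (C \<inter> S j)"
        using \<phi> \<open>card (C \<inter> S j) \<noteq> 0\<close> by (intro mult_left_mono) auto
      ultimately show ?thesis using lower A4 unfolding C_def[symmetric] by simp
    next
      case X: False
      have sep: "s \<in> U \<longleftrightarrow> t \<notin> U"
      proof (rule ccontr)
        assume "\<not> ?thesis"
        then consider "s \<notin> U" "t \<notin> U" | "s \<in> U" "t \<in> U" by blast
        then show False
        proof cases
          case 1
          then show ?thesis
            using X lp_feasible_inner_cut[OF feasible \<open>U \<noteq> {}\<close>] U(1) by (auto simp: C_def)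
        next
          case 2
          then have "2 \<le> sum x (cut V (V - U))"
            using U(1) \<open>U \<noteq> V\<close> by (intro lp_feasible_inner_cut[OF feasible]) auto
          then show ?thesis using X by (simp add: C_def cut_Diff)
        qed
      qed
      have CN: "C \<in> N"
      proof (cases "s \<in> U")
        case True
        then show ?thesis using sep U(1) X unfolding narrow_cuts_def C_def by auto
      next
        case False
        have "C = cut V (V - U)" by (simp add: C_def cut_Diff)
        moreover have "{s} \<subseteq> V - U \<and> V - U \<subseteq> V - {t} \<and> sum x (cut V (V - U)) < 2"
          using False sep s_in X by (auto simp: C_def cut_Diff)
        ultimately show ?thesis unfolding narrow_cuts_def by blast
      qed
      \<comment> \<open>Oddness of a separating cut makes its number of forest edges even. A single
        tree edge was therefore deleted as lonely for some cut, which has the same tree edge and is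
        thus \<open>C\<close> itself.\<close>
      have "card (C \<inter> S j) \<noteq> 1"
      proof
        assume 1: "card (C \<inter> S j) = 1"
        then obtain e where e: "C \<inter> S j = {e}" by (rule card_1_singletonE)
        have "even (card (F j \<inter> C))"
          using T_parity[OF j U(1)] U(2) sep by (auto simp: C_def Int_insert_left)
        moreover have "F j \<inter> C \<subseteq> {e}" using e forest_subset by blast
        ultimately have "F j \<inter> C = {}" by (metis subset_singletonD card_1_singleton_iff odd_one One_nat_def)
        then obtain D where D: "D \<in> L j" "e = lone j D" using e unfolding forest_eq by blast
        then have "D \<in> N" by (simp add: L_iff)
        then have "C = D" using narrow_cut_eq[OF j CN] lone[OF D(1)] e D(2) by simp
        then show False using False D by simp
      qed
      then have "(p j - \<phi> j) * 2 \<le> (p j - \<phi> j) * card (C \<inter> S j)"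
        using \<phi> \<open>card (C \<inter> S j) \<noteq> 0\<close> by (intro mult_left_mono) auto
      moreover have "deficit j C \<le> A4"
      proof -
        have "(\<Sum>i\<in>trees C. deficit j C * surplus i C / total_surplus C * ?i (lone i C))
            = (\<Sum>i\<in>trees C. deficit j C / total_surplus C * surplus i C)"
          using lone_in(1) by (intro sum.cong) (auto simp: trees_def)
        also have "\<dots> = deficit j C / total_surplus C * total_surplus C"
          unfolding total_surplus_def[of C] sum_distrib_left ..
        also have "\<dots> = deficit j C" using total_surplus(1)[OF CN] by simp
        finally have "deficit j C = (\<Sum>i\<in>trees C. deficit j C * surplus i C / total_surplus C * ?i (lone i C))" ..
        also have "\<dots> \<le> A4"
          unfolding A4_def using CN False finite_N inner4 by (intro member_le_sum) auto
        finally show ?thesis .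
      qed
      moreover have "(3 - sum x C) * \<phi> j - p j \<le> deficit j C" by (simp add: deficit_def)
      ultimately show ?thesis using lower unfolding C_def[symmetric] by (simp add: algebra_simps)
    qed
  qed
qed

text \<open>The average cost of the lonely edges of \<open>C\<close>, weighted by surplus. With
  these weights the available saving is exactly the total surplus times the price of one unit of
  repair.\<close>

definition reuse_cost :: "'a set set \<Rightarrow> real" where
  "reuse_cost C = (\<Sum>i\<in>trees C. surplus i C * ec (lone i C)) / total_surplus C"

lemma tree_path_cost:
  assumes j: "j \<in> {1..k}" and Q: "iteration_result V c s t x p S j Q"
  shows "(p j + \<phi> j) * path_cost c Q \<le> 2 * p j * sum ec (S j) + \<phi> j * lp_cost V c x
    - (\<Sum>C\<in>L j. surplus j C * ec (lone j C)) + (\<Sum>C\<in>N - L j. deficit j C * reuse_cost C)"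
\<comment> \<open>For weight 0 all terms vanish; otherwise the normalisation by p + \<phi> and
  \<open>join_cost_lone\<close> need a positive weight.\<close>
proof (cases "p j = 0")
  case True
  then have "\<phi> j = 0" using \<phi>_bounds[OF j] by simp
  then show ?thesis using True by (simp add: surplus_def deficit_def)
next
  case False
  note \<phi> = \<phi>_bounds[OF j]
  have pj: "0 < p j" using False p_nonneg[OF j] by simp
  then have q: "0 < p j + \<phi> j" using \<phi> by simp
  have "\<exists>J. T_join V (T j) J \<and> sum (jc j) J \<le> (\<Sum>e\<in>E. jc j e * (corr j e / (p j + \<phi> j)))"
  proof (rule min_T_join_le_fractional[OF finite_V T_subset T_even[OF j]])
    fix e assume e: "e \<in> E"
    show "0 \<le> jc j e" using ec_nonneg[OF e] join_cost_ge[OF j, of e] by linarith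
    show "0 \<le> corr j e / (p j + \<phi> j)" using corr_nonneg[OF j e] q by simp
  next
    fix U assume "U \<subseteq> V" "odd (card (T j \<inter> U))"
    then have "p j + \<phi> j \<le> sum (corr j) (cut V U)" by (rule corr_cut[OF j])
    then show "1 \<le> (\<Sum>e\<in>cut V U. corr j e / (p j + \<phi> j))"
      using q by (simp add: sum_divide_distrib[symmetric] pos_le_divide_eq)
  qed
  then obtain J where J: "T_join V (T j) J" "sum (jc j) J \<le> (\<Sum>e\<in>E. jc j e * (corr j e / (p j + \<phi> j)))"
    by blast
  have "(\<Sum>e\<in>E. jc j e * (corr j e / (p j + \<phi> j))) = (\<Sum>e\<in>E. jc j e * corr j e) / (p j + \<phi> j)"
    by (simp add: sum_divide_distrib)
  then have "(p j + \<phi> j) * sum (jc j) J \<le> (\<Sum>e\<in>E. jc j e * corr j e)"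
    using J(2) q by (simp add: pos_le_divide_eq mult.commute)
  also have "\<dots> = \<phi> j * (\<Sum>e\<in>E. jc j e * x e) + (p j - \<phi> j) * sum ec (F j)
     + (\<Sum>C\<in>L j. surplus j C * ec (lone j C)) + (\<Sum>C\<in>N - L j. deficit j C * reuse_cost C)"
  proof -
    have "sum (jc j) (F j) = sum ec (F j)"
      using forest_subset by (intro sum.cong refl join_cost_tree_edge[OF j]) blast
    moreover have "(\<Sum>C\<in>L j. surplus j C * jc j (lone j C)) = (\<Sum>C\<in>L j. surplus j C * ec (lone j C))"
      by (intro sum.cong refl) (simp add: join_cost_tree_edge[OF j] lone_in(2))
    moreover have "(\<Sum>i\<in>trees C. deficit j C * surplus i C / total_surplus C * jc j (lone i C))
        = deficit j C * reuse_cost C" if C: "C \<in> N - L j" for C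
    proof -
      have "(\<Sum>i\<in>trees C. deficit j C * surplus i C / total_surplus C * jc j (lone i C))
          = (\<Sum>i\<in>trees C. deficit j C * (surplus i C * ec (lone i C) / total_surplus C))"
        using C by (intro sum.cong refl) (auto simp: trees_def join_cost_lone[OF _ j pj])
      then show ?thesis by (simp add: reuse_cost_def sum_distrib_left sum_divide_distrib)
    qed
    ultimately show ?thesis unfolding sum_corr[OF j] by simp
  qed
  also have "\<phi> j * (\<Sum>e\<in>E. jc j e * x e)
      \<le> \<phi> j * (lp_cost V c x + (\<Sum>C\<in>L j. 2 * ec (lone j C) * (sum x C - 1)))"
    using \<phi> join_cost_lp_le[OF j] by (intro mult_left_mono) auto
  finally have 1: "(p j + \<phi> j) * sum (jc j) J \<le> \<phi> j * lp_cost V c x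
      + \<phi> j * (\<Sum>C\<in>L j. 2 * ec (lone j C) * (sum x C - 1)) + (p j - \<phi> j) * sum ec (F j)
      + (\<Sum>C\<in>L j. surplus j C * ec (lone j C)) + (\<Sum>C\<in>N - L j. deficit j C * reuse_cost C)"
    by (simp add: distrib_left)
  have "(p j + \<phi> j) * path_cost c Q \<le> (p j + \<phi> j) * (sum ec (F j) + sum (jc j) J)"
    using iteration_resultD(2)[OF j Q J(1)] q by (intro mult_left_mono) auto
  then have "(p j + \<phi> j) * path_cost c Q \<le> (p j + \<phi> j) * sum ec (F j) + (p j + \<phi> j) * sum (jc j) J"
    by (simp only: distrib_left)
  \<comment> \<open>The forest is paid p + \<phi> in the path and p - \<phi> in the join, in total 2
    p. Each deleted edge thus saves 2 p times its cost.\<close>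
  moreover have "(p j + \<phi> j) * sum ec (F j) + (p j - \<phi> j) * sum ec (F j)
      = 2 * p j * sum ec (S j) - 2 * p j * (\<Sum>C\<in>L j. ec (lone j C))"
    unfolding sum_tree_split[OF j, of ec] by (simp add: algebra_simps)
  moreover have "\<phi> j * (\<Sum>C\<in>L j. 2 * ec (lone j C) * (sum x C - 1)) + (\<Sum>C\<in>L j. surplus j C * ec (lone j C))
      - 2 * p j * (\<Sum>C\<in>L j. ec (lone j C)) = - (\<Sum>C\<in>L j. surplus j C * ec (lone j C))"
    unfolding sum_distrib_left sum.distrib[symmetric] sum_subtractf[symmetric] sum_negf[symmetric]
    by (intro sum.cong refl) (simp add: surplus_def algebra_simps)
  ultimately show ?thesis using 1 by linarith
qed

lemma reuse_cost:
  assumes "C \<in> N"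
  shows "0 \<le> reuse_cost C" "(\<Sum>i\<in>trees C. surplus i C * ec (lone i C)) = total_surplus C * reuse_cost C"
proof -
  have "0 \<le> (\<Sum>i\<in>trees C. surplus i C * ec (lone i C))"
    using surplus_ge(3)[OF _ assms] lone_cost_nonneg
    by (intro sum_nonneg mult_nonneg_nonneg) (auto simp: trees_def)
  then show "0 \<le> reuse_cost C" using total_surplus(1)[OF assms] by (simp add: reuse_cost_def)
  show "(\<Sum>i\<in>trees C. surplus i C * ec (lone i C)) = total_surplus C * reuse_cost C"
    using total_surplus(1)[OF assms] by (simp add: reuse_cost_def)
qed

text \<open>Exchanging the sums over trees and narrow cuts makes the accounts local: at each cut the
  deficits of the trees where it is not lonely are covered by the surplus of those where it
  is.\<close>

theorem weighted_path_cost: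
  assumes Q: "\<And>j. j \<in> {1..k} \<Longrightarrow> iteration_result V c s t x p S j (Q j)"
  shows "(\<Sum>j=1..k. (p j + \<phi> j) * path_cost c (Q j)) \<le> (2 + 4 * ln (5 / 4)) * lp_cost V c x"
proof -
  have "(\<Sum>j=1..k. (p j + \<phi> j) * path_cost c (Q j)) \<le> (\<Sum>j=1..k. 2 * p j * sum ec (S j) + \<phi> j * lp_cost V c x
    - (\<Sum>C\<in>L j. surplus j C * ec (lone j C)) + (\<Sum>C\<in>N - L j. deficit j C * reuse_cost C))"
    using tree_path_cost Q by (intro sum_mono) blast
  also have "\<dots> = 2 * (\<Sum>j=1..k. p j * sum ec (S j)) + (\<Sum>j=1..k. \<phi> j) * lp_cost V c x
    - (\<Sum>j=1..k. \<Sum>C\<in>L j. surplus j C * ec (lone j C)) + (\<Sum>j=1..k. \<Sum>C\<in>N - L j. deficit j C * reuse_cost C)"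
    by (simp add: sum.distrib sum_subtractf sum_distrib_left sum_distrib_right mult_ac)
  also have "(\<Sum>j=1..k. \<Sum>C\<in>L j. surplus j C * ec (lone j C)) = (\<Sum>C\<in>N. total_surplus C * reuse_cost C)"
  proof -
    have "(\<Sum>j=1..k. \<Sum>C\<in>L j. surplus j C * ec (lone j C))
        = (\<Sum>j=1..k. \<Sum>C | C \<in> N \<and> C \<in> L j. surplus j C * ec (lone j C))"
      using L_subset_N by (intro sum.cong refl) blast
    also have "\<dots> = (\<Sum>C\<in>N. \<Sum>j | j \<in> {1..k} \<and> C \<in> L j. surplus j C * ec (lone j C))"
      by (rule sum.swap_restrict) (use finite_N in auto)
    also have "\<dots> = (\<Sum>C\<in>N. total_surplus C * reuse_cost C)"
      by (intro sum.cong refl) (use reuse_cost(2) in \<open>simp add: trees_def\<close>)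
    finally show ?thesis .
  qed
  also have "(\<Sum>j=1..k. \<Sum>C\<in>N - L j. deficit j C * reuse_cost C) \<le> (\<Sum>C\<in>N. total_surplus C * reuse_cost C)"
  proof -
    have "(\<Sum>j=1..k. \<Sum>C\<in>N - L j. deficit j C * reuse_cost C)
        = (\<Sum>j=1..k. \<Sum>C | C \<in> N \<and> C \<notin> L j. deficit j C * reuse_cost C)"
      by (intro sum.cong refl) blast
    also have "\<dots> = (\<Sum>C\<in>N. \<Sum>j | j \<in> {1..k} \<and> C \<notin> L j. deficit j C * reuse_cost C)"
      by (rule sum.swap_restrict) (use finite_N in auto)
    also have "\<dots> \<le> (\<Sum>C\<in>N. total_surplus C * reuse_cost C)"
    proof (rule sum_mono)
      fix C assume C: "C \<in> N"
      have "{j. j \<in> {1..k} \<and> C \<notin> L j} = {1..k} - trees C" by (auto simp: trees_def)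
      then have "(\<Sum>j | j \<in> {1..k} \<and> C \<notin> L j. deficit j C * reuse_cost C)
          = (\<Sum>j\<in>{1..k} - trees C. deficit j C) * reuse_cost C"
        by (simp only: sum_distrib_right)
      also have "\<dots> \<le> total_surplus C * reuse_cost C"
        using total_surplus(2)[OF C] reuse_cost(1)[OF C] by (rule mult_right_mono)
      finally show "(\<Sum>j | j \<in> {1..k} \<and> C \<notin> L j. deficit j C * reuse_cost C) \<le> total_surplus C * reuse_cost C" .
    qed
    finally show ?thesis .
  qed
  finally show ?thesis
    unfolding lp_cost_eq_trees[symmetric] sum_\<phi>_k by (simp add: algebra_simps)
qed

lemma k_pos: "1 \<le> k"
proof (rule ccontr)
  assume "\<not> 1 \<le> k"
  then show False using p_sum by simp
qed

text \<open>The cheapest path is at most the weighted average, and (2 + l) / (1 + l) with l = 4 ln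
  (5/4) is \<open>rho_star\<close>.\<close>

lemma algorithm_output_bound:
  assumes "algorithm_output V c s t x k p S P"
  shows "hamiltonian_path V s t P" "path_cost c P \<le> rho_star * lp_cost V c x"
proof -
  obtain Q where Q: "\<forall>j\<in>{1..k}. iteration_result V c s t x p S j (Q j)"
    and P: "is_arg_min (path_cost c) (\<lambda>P. P \<in> Q ` {1..k}) P"
    using assms unfolding algorithm_output_def by blast
  obtain i where i: "i \<in> {1..k}" "P = Q i" using P by (auto simp: is_arg_min_def)
  then show "hamiltonian_path V s t P" using iteration_resultD(1) Q by blast
  have min: "path_cost c P \<le> path_cost c (Q j)" if "j \<in> {1..k}" for j
    using P that by (auto simp: is_arg_min_def not_less)
  let ?l = "4 * ln (5 / 4) :: real"
  have l: "0 < 1 + ?l" by (simp add: add_pos_nonneg)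
  have "(1 + ?l) * path_cost c P = (\<Sum>j=1..k. (p j + \<phi> j) * path_cost c P)"
    unfolding sum_distrib_right[symmetric] sum.distrib p_sum sum_\<phi>_k ..
  also have "\<dots> \<le> (\<Sum>j=1..k. (p j + \<phi> j) * path_cost c (Q j))"
    using min p_nonneg \<phi>_bounds(1) by (intro sum_mono mult_left_mono add_nonneg_nonneg) auto
  also have "\<dots> \<le> (2 + ?l) * lp_cost V c x" by (rule weighted_path_cost[OF bspec[OF Q]])
  finally have "path_cost c P \<le> (2 + ?l) * lp_cost V c x / (1 + ?l)"
    using l by (simp add: pos_le_divide_eq mult.commute)
  also have "\<dots> = rho_star * lp_cost V c x"
    using l by (simp add: rho_star_def field_simps)
  finally show "path_cost c P \<le> rho_star * lp_cost V c x" .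
qed

lemma ex_algorithm_output: "\<exists>P. algorithm_output V c s t x k p S P"
proof -
  have "\<forall>j\<in>{1..k}. \<exists>Q. iteration_result V c s t x p S j Q" using ex_iteration_result by blast
  then obtain Q where Q: "\<forall>j\<in>{1..k}. iteration_result V c s t x p S j (Q j)" by (rule bchoice[THEN exE])
  have "\<exists>P. is_arg_min (path_cost c) (\<lambda>P. P \<in> Q ` {1..k}) P"
    by (rule ex_is_arg_min_finite[of _ "Q 1"]) (use k_pos in auto)
  then show ?thesis using Q unfolding algorithm_output_def by blast
qed

end

theorem theorem6:
  fixes V :: "'a set" and c :: "'a \<Rightarrow> 'a \<Rightarrow> real" and s t :: 'a
  assumes "finite V" and "Metric_space V c"
    and "s \<in> V" and "t \<in> V" and "s \<noteq> t"
  shows "(\<exists>x. lp_optimum V c s t x) \<and>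
    (\<forall>x k p S. lp_optimum V c s t x \<and> tree_decomposition V s t x k p S \<longrightarrow>
       (\<forall>j\<in>{1..k}. iteration_executable V c s t x p S j) \<and>
       (\<exists>P. algorithm_output V c s t x k p S P) \<and>
       (\<forall>P. algorithm_output V c s t x k p S P \<longrightarrow>
          hamiltonian_path V s t P \<and> path_cost c P \<le> rho_star * lp_cost V c x))"
proof (intro conjI allI impI)
  show "\<exists>x. lp_optimum V c s t x" using assms by (intro ex_lp_optimum)
next
  fix x k p S assume "lp_optimum V c s t x \<and> tree_decomposition V s t x k p S"
  then have "lp_feasible V s t x" "tree_decomposition V s t x k p S"
    by (auto simp: lp_optimum_def is_arg_min_def)
  then interpret decomposed_lp V c s t x k p S
    using assms by (intro decomposed_lp.intro decomposed_lp_axioms.intro)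
  show "\<forall>j\<in>{1..k}. iteration_executable V c s t x p S j" using iteration_executable by blast
  show "\<exists>P. algorithm_output V c s t x k p S P" by (rule ex_algorithm_output)
  show "hamiltonian_path V s t P" "path_cost c P \<le> rho_star * lp_cost V c x"
    if "algorithm_output V c s t x k p S P" for P
    using algorithm_output_bound[OF that] by blast+
qed

end
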